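(* Let $\Omega\subset\mathbb R^2$ be the meshed domain of the context. For all $(s^h,\hat s^h)\in\widetilde S(\Omega)\times\widetilde D(\partial\Omega)$, the dual degrees of freedom of $\widetilde{\mathrm{grad}}(s^h,\hat s^h)\in\widetilde D(\Omega)$ are $$\widetilde{\mathcal N}^1\big(\widetilde{\mathrm{grad}}(s^h,\hat s^h)\big)=-(\mathbb E^{2,1})^\intercal\,\widetilde{\mathcal N}^0(s^h)+\mathbb N_1\,\widetilde{\mathcal B}^0(\hat s^h),$$ and for all $(\boldsymbol d^h,\hat d^h)\in\widetilde D(\Omega)\times\widetilde C(\partial\Omega)$, the dual degrees of freedom of $\widetilde{\mathrm{rot}}(\boldsymbol d^h,\hat d^h)\in\widetilde C(\Omega)$ are $$\widetilde{\mathcal N}^2\big(\widetilde{\mathrm{rot}}(\boldsymbol d^h,\hat d^h)\big)=(\mathbb E^{1,0})^\intercal\,\widetilde{\mathcal N}^1(\boldsymbol d^h)+\mathbb N_0\,\widetilde{\mathcal B}^1(\hat d^h).$$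
   Context: Fix $N\ge1$; let $-1=\xi_0<\dots<\xi_N=1$ be the Gauss–Lobatto–Legendre (GLL) nodes, i.e. the roots of $(1-\xi^2)L_N'(\xi)$, $L_N$ the Legendre polynomial of degree $N$. $\mathcal P$, $\mathcal Q$ are the polynomials on $[-1,1]$ of degree at most $N$, $N-1$. On $K=[-1,1]^2$: $C(K)=\mathcal P\otimes\mathcal P$, $D(K)=(\mathcal P\otimes\mathcal Q)\times(\mathcal Q\otimes\mathcal P)$, $S(K)=\mathcal Q\otimes\mathcal Q$. $\Omega\subset\mathbb R^2$ is a bounded Lipschitz domain with outward unit normal $\boldsymbol n$, partitioned into conforming non-overlapping elements $\Omega_m=\Phi_m(K)$, with $\Phi_m$ diffeomorphisms with Jacobian matrix $\mathsf J$ ($\det\mathsf J>0$), such that the global map is continuous; the images of the GLL grid form a global mesh of nodes, small edges and small cells. $C(\Omega)$: continuous functions equal to $\bar f\circ\Phi_m^{-1}$, $\bar f\in C(K)$, on each $\Omega_m$. $D(\Omega)$: vector fields with continuous normal component across element boundaries, equal to $\big(\frac1{\det\mathsf J}\mathsf J\bar{\boldsymbol u}\big)\circ\Phi_m^{-1}$, $\bar{\boldsymbol u}\in D(K)$, on each $\Omega_m$. $S(\Omega)$: functions equal to $\big(\frac1{\det\mathsf J}\bar g\big)\circ\Phi_m^{-1}$, $\bar g\in S(K)$, on each $\Omega_m$. Degrees of freedom (column vectors): $\mathcal N^0$ = values at the nodes for $C(\Omega)$; $\mathcal N^1$ = fluxes through the small edges (each with a fixed chosen unit normal) for $D(\Omega)$;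 $\mathcal N^2$ = integrals over the small cells for $S(\Omega)$. $\Psi^0,\Psi^1,\Psi^2$ are the corresponding row vectors of basis functions, so each function equals $\Psi^k\mathcal N^k(\cdot)$. With $\mathrm{curl}\,\omega=(\partial_y\omega,-\partial_x\omega)^\intercal$, the incidence matrices (entries $-1,0,1$) are defined by $\mathrm{curl}\,\omega^h=\Psi^1\mathbb E^{1,0}\mathcal N^0(\omega^h)$ on $C(\Omega)$ and $\mathrm{div}\,\boldsymbol q^h=\Psi^2\mathbb E^{2,1}\mathcal N^1(\boldsymbol q^h)$ on $D(\Omega)$. Mass matrices $\mathbb M^{(k)}=\int_\Omega(\Psi^k)^\intercal\Psi^k\,\mathrm d\Omega$; dual bases $\widetilde\Psi^{2-k}=\Psi^k(\mathbb M^{(k)})^{-1}$; dual degrees of freedom $\widetilde{\mathcal N}^{2-k}=\mathbb M^{(k)}\mathcal N^k$. $\widetilde C(\Omega)$, $\widetilde D(\Omega)$, $\widetilde S(\Omega)$ are the spaces $C(\Omega)$, $D(\Omega)$, $S(\Omega)$ with elements expanded in the dual bases $\widetilde\Psi^2,\widetilde\Psi^1,\widetilde\Psi^0$. Inclusion matrices: $\mathbb N_1$ (rows: small edges; columns: small edges in $\partial\Omega$) has in the column of a boundary edge a single non-zero entry, in the row of that edge, equal to $+1$ if its chosen normal is outward and $-1$ otherwise. $\mathbb N_0$ (rows: nodes; columns: nodes on $\partial\Omega$) has in the column of a boundary node the single non-zero entry $1$ in the row of that node. Boundary spaces: $\Psi_b^1=(\Psi^1\cdot\boldsymbol n)|_{\partial\Omega}\mathbb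 N_1$ and $\Psi_b^0=\Psi^0|_{\partial\Omega}\mathbb N_0$ are bases of the trace spaces $D(\partial\Omega)$ and $C(\partial\Omega)$; with $\mathbb M_b^{(k)}=\int_{\partial\Omega}(\Psi_b^k)^\intercal\Psi_b^k\,\mathrm d\Gamma$, the dual bases are $\widetilde\Psi_b^{1-k}=\Psi_b^k(\mathbb M_b^{(k)})^{-1}$. Elements of $\widetilde D(\partial\Omega)$ are $\hat s^h=\widetilde\Psi_b^0\widetilde{\mathcal B}^0(\hat s^h)$ and elements of $\widetilde C(\partial\Omega)$ are $\hat d^h=\widetilde\Psi_b^1\widetilde{\mathcal B}^1(\hat d^h)$, with coefficient vectors $\widetilde{\mathcal B}^0,\widetilde{\mathcal B}^1$. Operators: $\widetilde{\mathrm{grad}}(s^h,\hat s^h)\in\widetilde D(\Omega)$ is defined by $$\int_\Omega\widetilde{\mathrm{grad}}(s^h,\hat s^h)\cdot\boldsymbol q^h\,\mathrm d\Omega=\int_\Omega s^h(-\mathrm{div}\,\boldsymbol q^h)\,\mathrm d\Omega+\int_{\partial\Omega}\hat s^h(\boldsymbol q^h\cdot\boldsymbol n)\,\mathrm d\Gamma\quad\forall\boldsymbol q^h\in D(\Omega),$$ and $\widetilde{\mathrm{rot}}(\boldsymbol d^h,\hat d^h)\in\widetilde C(\Omega)$ is defined by $$\int_\Omega\widetilde{\mathrm{rot}}(\boldsymbol d^h,\hat d^h)\,c^h\,\mathrm d\Omega=\int_\Omega\boldsymbol d^h\cdot\mathrm{curl}\,c^h\,\mathrm d\Omega+\int_{\partial\Omega}\hat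 d^h\,c^h\,\mathrm d\Gamma\quad\forall c^h\in C(\Omega).$$ *)

theory Defs
  imports "HOL-Analysis.Analysis" "HOL-Computational_Algebra.Polynomial"
begin

section \<open>Gauss--Lobatto--Legendre nodes and polynomials on the reference square\<close>

fun legendre :: "nat \<Rightarrow> real poly" where
  "legendre 0 = 1"
| "legendre (Suc 0) = [:0, 1:]"
| "legendre (Suc (Suc n)) =
     smult (1 / real (n + 2))
       (smult (real (2 * n + 3)) ([:0, 1:] * legendre (Suc n)) - smult (real (n + 1)) (legendre n))"

definition gll_nodes :: "nat \<Rightarrow> (nat \<Rightarrow> real) \<Rightarrow> bool" where
  "gll_nodes N \<xi> \<longleftrightarrow> \<xi> 0 = -1 \<and> \<xi> N = 1 \<and> (\<forall>i<N. \<xi> i < \<xi> (Suc i)) \<and>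
     \<xi> ` {..N} = {x. poly ([:1, 0, -1:] * pderiv (legendre N)) x = 0}"

definition refK :: "(real^2) set" where
  "refK = {x. \<forall>i. -1 \<le> x $ i \<and> x $ i \<le> 1}"

definition corners :: "(real^2) set" where
  "corners = {x. \<forall>i. x $ i \<in> {-1, 1}}"

text \<open>The point with \<open>k\<close>-th coordinate \<open>t\<close> and other coordinate \<open>s\<close>.  As \<open>t\<close> varies it traces a
  line parallel to the \<open>k\<close>-th axis, with tangent \<open>axis k 1\<close>; for \<open>s = 1\<close> and \<open>s = -1\<close> this is a side
  of the reference square.\<close>

definition line :: "2 \<Rightarrow> real \<Rightarrow> real \<Rightarrow> real^2" where
  "line k s t = (\<chi> l. if l = k then t else s)"

text \<open>Polynomials of degree at most \<open>p\<close> in the first and at most \<open>q\<close> in the second variable.\<close>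

definition tensor_poly :: "nat \<Rightarrow> nat \<Rightarrow> (real^2 \<Rightarrow> real) set" where
  "tensor_poly p q = {f. \<exists>a :: nat \<Rightarrow> nat \<Rightarrow> real.
      \<forall>x. f x = (\<Sum>i\<le>p. \<Sum>j\<le>q. a i j * (x $ 1) ^ i * (x $ 2) ^ j)}"

definition C_ref :: "nat \<Rightarrow> (real^2 \<Rightarrow> real) set" where
  "C_ref N = tensor_poly N N"

definition D_ref :: "nat \<Rightarrow> (real^2 \<Rightarrow> real^2) set" where
  "D_ref N = {u. (\<lambda>x. u x $ 1) \<in> tensor_poly N (N - 1) \<and> (\<lambda>x. u x $ 2) \<in> tensor_poly (N - 1) N}"

definition S_ref :: "nat \<Rightarrow> (real^2 \<Rightarrow> real) set" where
  "S_ref N = tensor_poly (N - 1) (N - 1)"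

section \<open>Lipschitz domains and outward normals\<close>

definition lipschitz_domain :: "(real^2) set \<Rightarrow> bool" where
  "lipschitz_domain \<Omega> \<longleftrightarrow> open \<Omega> \<and> connected \<Omega> \<and> \<Omega> \<noteq> {} \<and>
     (\<forall>x\<in>frontier \<Omega>. \<exists>a b :: real^2. \<exists>\<phi> :: real \<Rightarrow> real. \<exists>L r.
        norm a = 1 \<and> norm b = 1 \<and> a \<bullet> b = 0 \<and> r > 0 \<and> L-lipschitz_on UNIV \<phi> \<and>
        (\<forall>y\<in>ball x r. y \<in> \<Omega> \<longleftrightarrow> \<phi> (y \<bullet> a) < y \<bullet> b))"

text \<open>Near \<open>x\<close>, up to cones of arbitrarily small opening around the line orthogonal to \<open>\<nu>\<close>, the set
  \<open>\<Omega>\<close> is the half plane that \<open>\<nu>\<close> points out of.\<close>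

definition outward_unit_normal :: "(real^2) set \<Rightarrow> real^2 \<Rightarrow> real^2 \<Rightarrow> bool" where
  "outward_unit_normal \<Omega> x \<nu> \<longleftrightarrow> x \<in> frontier \<Omega> \<and> norm \<nu> = 1 \<and>
     (\<forall>\<epsilon>>0. \<exists>r>0. \<forall>y\<in>ball x r.
        ((y - x) \<bullet> \<nu> > \<epsilon> * norm (y - x) \<longrightarrow> y \<notin> closure \<Omega>) \<and>
        ((y - x) \<bullet> \<nu> < - \<epsilon> * norm (y - x) \<longrightarrow> y \<in> \<Omega>))"

section \<open>Meshed domains\<close>

text \<open>The index types number the elements (\<open>'m\<close>), the nodes (\<open>'v\<close>), the small edges (\<open>'e\<close>), the small
  cells (\<open>'c\<close>), the boundary nodes (\<open>'bv\<close>) and the boundary small edges (\<open>'be\<close>); the numberings are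
  the fields \<open>node\<close>, \<open>edge\<close>, \<open>cell\<close>, and \<open>bnode\<close>, \<open>bedge\<close>, the latter two giving for each boundary
  object its number among all nodes, respectively small edges.\<close>

record ('m, 'v, 'e, 'c, 'bv, 'be) gll_mesh =
  deg :: nat
  gll :: "nat \<Rightarrow> real"
  dmn :: "(real^2) set"
  nrm :: "real^2 \<Rightarrow> real^2"
  emap :: "'m \<Rightarrow> real^2 \<Rightarrow> real^2"
  jac :: "'m \<Rightarrow> real^2 \<Rightarrow> real^2^2"
  node :: "'v \<Rightarrow> real^2"
  edge :: "'e \<Rightarrow> (real^2) set"
  cell :: "'c \<Rightarrow> (real^2) set"
  edge_nrm :: "'e \<Rightarrow> real^2 \<Rightarrow> real^2"
  bnode :: "'bv \<Rightarrow> 'v"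
  bedge :: "'be \<Rightarrow> 'e"
  psi0 :: "'v \<Rightarrow> real^2 \<Rightarrow> real"
  psi1 :: "'e \<Rightarrow> real^2 \<Rightarrow> real^2"
  psi2 :: "'c \<Rightarrow> real^2 \<Rightarrow> real"

definition elem :: "('m, 'v, 'e, 'c, 'bv, 'be) gll_mesh \<Rightarrow> 'm \<Rightarrow> (real^2) set" where
  "elem M m = emap M m ` refK"

definition elem_int :: "('m, 'v, 'e, 'c, 'bv, 'be) gll_mesh \<Rightarrow> 'm \<Rightarrow> (real^2) set" where
  "elem_int M m = emap M m ` interior refK"

definition elem_verts :: "('m, 'v, 'e, 'c, 'bv, 'be) gll_mesh \<Rightarrow> (real^2) set" where
  "elem_verts M = (\<Union>m. emap M m ` corners)"

definition elem_sides :: "('m, 'v, 'e, 'c, 'bv, 'be) gll_mesh \<Rightarrow> (real^2) set set" where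
  "elem_sides M = {emap M m ` line k s ` {-1..1} | m k s. s \<in> {-1, 1}}"

definition small_edge ::
  "('m, 'v, 'e, 'c, 'bv, 'be) gll_mesh \<Rightarrow> 'm \<Rightarrow> 2 \<Rightarrow> nat \<Rightarrow> nat \<Rightarrow> (real^2) set" where
  "small_edge M m k i j = emap M m ` line k (gll M i) ` {gll M j..gll M (Suc j)}"

definition mesh_nodes :: "('m, 'v, 'e, 'c, 'bv, 'be) gll_mesh \<Rightarrow> (real^2) set" where
  "mesh_nodes M = {emap M m (vector [gll M i, gll M j]) | m i j. i \<le> deg M \<and> j \<le> deg M}"

definition mesh_edges :: "('m, 'v, 'e, 'c, 'bv, 'be) gll_mesh \<Rightarrow> (real^2) set set" where
  "mesh_edges M = {small_edge M m k i j | m k i j. i \<le> deg M \<and> j < deg M}"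

definition mesh_cells :: "('m, 'v, 'e, 'c, 'bv, 'be) gll_mesh \<Rightarrow> (real^2) set set" where
  "mesh_cells M = {emap M m ` {x. x $ 1 \<in> {gll M i..gll M (Suc i)} \<and> x $ 2 \<in> {gll M j..gll M (Suc j)}}
     | m i j. i < deg M \<and> j < deg M}"

text \<open>Twice continuously differentiable up to the boundary, so that \<open>J\<close> is continuously
  differentiable and the divergence of a Piola-transformed field exists classically.\<close>

definition element_map :: "(real^2 \<Rightarrow> real^2) \<Rightarrow> (real^2 \<Rightarrow> real^2^2) \<Rightarrow> bool" where
  "element_map \<Phi> J \<longleftrightarrow> inj_on \<Phi> refK \<and>
     (\<forall>x\<in>refK. (\<Phi> has_derivative (\<lambda>h. J x *v h)) (at x within refK) \<and> det (J x) > 0) \<and>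
     (\<exists>J'. (\<forall>x\<in>refK. (J has_derivative J' x) (at x within refK)) \<and>
           (\<forall>h. continuous_on refK (\<lambda>x. J' x h)))"

text \<open>A side of one element is a side of another one and the two element maps agree on it, up to
  the direction \<open>\<tau>\<close> in which it is traversed.\<close>

definition common_side ::
  "('m, 'v, 'e, 'c, 'bv, 'be) gll_mesh \<Rightarrow> 'm \<Rightarrow> 2 \<Rightarrow> real \<Rightarrow> 'm \<Rightarrow> 2 \<Rightarrow> real \<Rightarrow> real \<Rightarrow> bool" where
  "common_side M m k s m' k' s' \<tau> \<longleftrightarrow> s \<in> {-1, 1} \<and> s' \<in> {-1, 1} \<and> \<tau> \<in> {-1, 1} \<and>
     (\<forall>t\<in>{-1..1}. emap M m (line k s t) = emap M m' (line k' s' (\<tau> * t)))"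

text \<open>Different elements meet only in common vertices and in common whole sides.\<close>

definition conforming :: "('m, 'v, 'e, 'c, 'bv, 'be) gll_mesh \<Rightarrow> bool" where
  "conforming M \<longleftrightarrow>
     (\<forall>m m' p p'. m \<noteq> m' \<and> p \<in> refK \<and> p' \<in> refK \<and> emap M m p = emap M m' p' \<longrightarrow>
        (p \<in> corners \<and> p' \<in> corners) \<or>
        (\<exists>k s k' s' \<tau>. \<exists>t\<in>{-1..1}. common_side M m k s m' k' s' \<tau> \<and>
            p = line k s t \<and> p' = line k' s' (\<tau> * t)))"

text \<open>The conditions on \<open>frontier\<close> say that the mesh resolves the boundary: it is the union of the
  boundary sides, and every other side is interior.\<close>

definition partition_of_domain :: "('m, 'v, 'e, 'c, 'bv, 'be) gll_mesh \<Rightarrow> bool" where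
  "partition_of_domain M \<longleftrightarrow>
     (\<forall>m. element_map (emap M m) (jac M m)) \<and>
     closure (dmn M) = (\<Union>m. elem M m) \<and>
     (\<forall>m m'. m \<noteq> m' \<longrightarrow> elem_int M m \<inter> elem_int M m' = {}) \<and>
     conforming M \<and>
     frontier (dmn M) = \<Union>{A \<in> elem_sides M. A \<subseteq> frontier (dmn M)} \<and>
     (\<forall>A\<in>elem_sides M. A \<subseteq> frontier (dmn M) \<or> A - elem_verts M \<subseteq> dmn M)"

text \<open>The outward normal is only prescribed away from the vertices of the elements, where the
  boundary may have a kink.\<close>

definition meshed_domain :: "('m, 'v, 'e, 'c, 'bv, 'be) gll_mesh \<Rightarrow> bool" where
  "meshed_domain M \<longleftrightarrow>
     deg M \<ge> 1 \<and> gll_nodes (deg M) (gll M) \<and>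
     bounded (dmn M) \<and> lipschitz_domain (dmn M) \<and>
     (\<forall>x\<in>frontier (dmn M) - elem_verts M. outward_unit_normal (dmn M) x (nrm M x)) \<and>
     partition_of_domain M \<and>
     bij_betw (node M) UNIV (mesh_nodes M) \<and>
     bij_betw (edge M) UNIV (mesh_edges M) \<and>
     bij_betw (cell M) UNIV (mesh_cells M) \<and>
     bij_betw (bnode M) UNIV {v. node M v \<in> frontier (dmn M)} \<and>
     bij_betw (bedge M) UNIV {e. edge M e \<subseteq> frontier (dmn M)} \<and>
     (\<forall>e. continuous_on (edge M e) (edge_nrm M e) \<and>
        (\<forall>x\<in>edge M e. norm (edge_nrm M e x) = 1) \<and>
        (\<forall>m k i j. \<forall>t\<in>{gll M j..gll M (Suc j)}. i \<le> deg M \<and> j < deg M \<and> edge M e = small_edge M m k i j \<longrightarrow>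
           edge_nrm M e (emap M m (line k (gll M i) t)) \<bullet> (jac M m (line k (gll M i) t) *v axis k 1) = 0))"

section \<open>Function spaces\<close>

text \<open>Members of \<open>D_space\<close> and \<open>S_space\<close> are determined on the open elements only; their values on
  the null set of element boundaries are irrelevant.  The value on a boundary as seen
  from an adjacent element is the limit from within that element.\<close>

definition elem_trace ::
  "('m, 'v, 'e, 'c, 'bv, 'be) gll_mesh \<Rightarrow> 'm \<Rightarrow> (real^2 \<Rightarrow> real^2) \<Rightarrow> real^2 \<Rightarrow> real^2" where
  "elem_trace M m u x = Lim (at x within elem_int M m) u"

definition C_space :: "('m, 'v, 'e, 'c, 'bv, 'be) gll_mesh \<Rightarrow> (real^2 \<Rightarrow> real) set" where
  "C_space M = {f. continuous_on (closure (dmn M)) f \<and>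
     (\<forall>m. \<exists>f'\<in>C_ref (deg M). \<forall>x\<in>refK. f (emap M m x) = f' x)}"

definition normal_continuous ::
  "('m, 'v, 'e, 'c, 'bv, 'be) gll_mesh \<Rightarrow> (real^2 \<Rightarrow> real^2) \<Rightarrow> bool" where
  "normal_continuous M u \<longleftrightarrow>
     (\<forall>m k s m' k' s' \<tau> \<nu>. \<forall>t\<in>{-1..1}. common_side M m k s m' k' s' \<tau> \<and>
        \<nu> \<bullet> (jac M m (line k s t) *v axis k 1) = 0 \<longrightarrow>
        elem_trace M m u (emap M m (line k s t)) \<bullet> \<nu> = elem_trace M m' u (emap M m (line k s t)) \<bullet> \<nu>)"

definition D_space :: "('m, 'v, 'e, 'c, 'bv, 'be) gll_mesh \<Rightarrow> (real^2 \<Rightarrow> real^2) set" where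
  "D_space M = {u. normal_continuous M u \<and>
     (\<forall>m. \<exists>u'\<in>D_ref (deg M). \<forall>x\<in>interior refK.
        u (emap M m x) = (1 / det (jac M m x)) *\<^sub>R (jac M m x *v u' x))}"

definition S_space :: "('m, 'v, 'e, 'c, 'bv, 'be) gll_mesh \<Rightarrow> (real^2 \<Rightarrow> real) set" where
  "S_space M = {g. \<forall>m. \<exists>g'\<in>S_ref (deg M). \<forall>x\<in>interior refK.
     g (emap M m x) = 1 / det (jac M m x) * g' x}"

section \<open>Integrals and degrees of freedom\<close>

definition dmn_integral :: "('m, 'v, 'e, 'c, 'bv, 'be) gll_mesh \<Rightarrow> (real^2 \<Rightarrow> real) \<Rightarrow> real" where
  "dmn_integral M f = (LINT x:dmn M|lebesgue. f x)"

text \<open>Arc-length integral over a small edge.  If the edge belongs to two elements, the two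
  parametrisations differ by a reflection and it does not matter which one is taken.\<close>

definition edge_integral ::
  "('m, 'v, 'e, 'c, 'bv, 'be) gll_mesh \<Rightarrow> (real^2) set \<Rightarrow> (real^2 \<Rightarrow> real) \<Rightarrow> real" where
  "edge_integral M A f =
     (case (SOME (m, k, i, j). i \<le> deg M \<and> j < deg M \<and> A = small_edge M m k i j) of
        (m, k, i, j) \<Rightarrow>
          (LINT t:{gll M j..gll M (Suc j)}|lebesgue.
             f (emap M m (line k (gll M i) t)) * norm (jac M m (line k (gll M i) t) *v axis k 1)))"

definition bd_integral ::
  "('m, 'v, 'e, 'c, 'bv, 'be::finite) gll_mesh \<Rightarrow> (real^2 \<Rightarrow> real) \<Rightarrow> real" where
  "bd_integral M f = (\<Sum>b\<in>UNIV. edge_integral M (edge M (bedge M b)) f)"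

text \<open>Some element containing \<open>A\<close>; for the normal traces below the choice is immaterial, by
  continuity of the normal component.\<close>

definition elem_of :: "('m, 'v, 'e, 'c, 'bv, 'be) gll_mesh \<Rightarrow> (real^2) set \<Rightarrow> 'm" where
  "elem_of M A = (SOME m. A \<subseteq> elem M m)"

definition bd_normal_trace ::
  "('m, 'v, 'e, 'c, 'bv, 'be) gll_mesh \<Rightarrow> (real^2 \<Rightarrow> real^2) \<Rightarrow> real^2 \<Rightarrow> real" where
  "bd_normal_trace M u x = elem_trace M (elem_of M {x}) u x \<bullet> nrm M x"

definition dof0 :: "('m, 'v::finite, 'e, 'c, 'bv, 'be) gll_mesh \<Rightarrow> (real^2 \<Rightarrow> real) \<Rightarrow> real^'v" where
  "dof0 M f = (\<chi> v. f (node M v))"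

definition dof1 :: "('m, 'v, 'e::finite, 'c, 'bv, 'be) gll_mesh \<Rightarrow> (real^2 \<Rightarrow> real^2) \<Rightarrow> real^'e" where
  "dof1 M u = (\<chi> e. edge_integral M (edge M e)
     (\<lambda>x. elem_trace M (elem_of M (edge M e)) u x \<bullet> edge_nrm M e x))"

definition dof2 :: "('m, 'v, 'e, 'c::finite, 'bv, 'be) gll_mesh \<Rightarrow> (real^2 \<Rightarrow> real) \<Rightarrow> real^'c" where
  "dof2 M g = (\<chi> c. LINT x:cell M c|lebesgue. g x)"

text \<open>\<open>psi0\<close>, \<open>psi1\<close>, \<open>psi2\<close> are the bases corresponding to these degrees of freedom.\<close>

definition basis_functions :: "('m, 'v::finite, 'e::finite, 'c::finite, 'bv, 'be) gll_mesh \<Rightarrow> bool" where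
  "basis_functions M \<longleftrightarrow>
     (\<forall>v. psi0 M v \<in> C_space M \<and> dof0 M (psi0 M v) = axis v 1) \<and>
     (\<forall>f\<in>C_space M. \<forall>x\<in>closure (dmn M). f x = (\<Sum>v\<in>UNIV. psi0 M v x * dof0 M f $ v)) \<and>
     (\<forall>e. psi1 M e \<in> D_space M \<and> dof1 M (psi1 M e) = axis e 1) \<and>
     (\<forall>u\<in>D_space M. \<forall>m. \<forall>x\<in>elem_int M m. u x = (\<Sum>e\<in>UNIV. (dof1 M u $ e) *\<^sub>R psi1 M e x)) \<and>
     (\<forall>c. psi2 M c \<in> S_space M \<and> dof2 M (psi2 M c) = axis c 1) \<and>
     (\<forall>g\<in>S_space M. \<forall>m. \<forall>x\<in>elem_int M m. g x = (\<Sum>c\<in>UNIV. psi2 M c x * dof2 M g $ c))"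

section \<open>Incidence matrices\<close>

definition curl2 :: "(real^2 \<Rightarrow> real) \<Rightarrow> real^2 \<Rightarrow> real^2" where
  "curl2 f x = vector [frechet_derivative f (at x) (axis 2 1), - frechet_derivative f (at x) (axis 1 1)]"

definition div2 :: "(real^2 \<Rightarrow> real^2) \<Rightarrow> real^2 \<Rightarrow> real" where
  "div2 u x = (\<Sum>i\<in>UNIV. frechet_derivative u (at x) (axis i 1) $ i)"

definition incidence10 ::
  "('m, 'v::finite, 'e::finite, 'c, 'bv, 'be) gll_mesh \<Rightarrow> real^'v^'e \<Rightarrow> bool" where
  "incidence10 M E \<longleftrightarrow> (\<forall>e v. E $ e $ v \<in> {-1, 0, 1}) \<and>
     (\<forall>f\<in>C_space M. \<forall>m. \<forall>x\<in>elem_int M m.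
        curl2 f x = (\<Sum>e\<in>UNIV. ((E *v dof0 M f) $ e) *\<^sub>R psi1 M e x))"

definition incidence21 ::
  "('m, 'v, 'e::finite, 'c::finite, 'bv, 'be) gll_mesh \<Rightarrow> real^'e^'c \<Rightarrow> bool" where
  "incidence21 M E \<longleftrightarrow> (\<forall>c e. E $ c $ e \<in> {-1, 0, 1}) \<and>
     (\<forall>u\<in>D_space M. \<forall>m. \<forall>x\<in>elem_int M m.
        div2 u x = (\<Sum>c\<in>UNIV. psi2 M c x * (E *v dof1 M u) $ c))"

section \<open>Mass matrices, dual bases, dual degrees of freedom\<close>

definition mass0 :: "('m, 'v::finite, 'e, 'c, 'bv, 'be) gll_mesh \<Rightarrow> real^'v^'v" where
  "mass0 M = (\<chi> v w. dmn_integral M (\<lambda>x. psi0 M v x * psi0 M w x))"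

definition mass1 :: "('m, 'v, 'e::finite, 'c, 'bv, 'be) gll_mesh \<Rightarrow> real^'e^'e" where
  "mass1 M = (\<chi> e f. dmn_integral M (\<lambda>x. psi1 M e x \<bullet> psi1 M f x))"

definition mass2 :: "('m, 'v, 'e, 'c::finite, 'bv, 'be) gll_mesh \<Rightarrow> real^'c^'c" where
  "mass2 M = (\<chi> c d. dmn_integral M (\<lambda>x. psi2 M c x * psi2 M d x))"

definition dual_psi2 :: "('m, 'v::finite, 'e, 'c, 'bv, 'be) gll_mesh \<Rightarrow> 'v \<Rightarrow> real^2 \<Rightarrow> real" where
  "dual_psi2 M v x = (\<Sum>w\<in>UNIV. psi0 M w x * matrix_inv (mass0 M) $ w $ v)"

definition dual_psi1 :: "('m, 'v, 'e::finite, 'c, 'bv, 'be) gll_mesh \<Rightarrow> 'e \<Rightarrow> real^2 \<Rightarrow> real^2" where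
  "dual_psi1 M e x = (\<Sum>f\<in>UNIV. (matrix_inv (mass1 M) $ f $ e) *\<^sub>R psi1 M f x)"

definition dual_psi0 :: "('m, 'v, 'e, 'c::finite, 'bv, 'be) gll_mesh \<Rightarrow> 'c \<Rightarrow> real^2 \<Rightarrow> real" where
  "dual_psi0 M c x = (\<Sum>d\<in>UNIV. psi2 M d x * matrix_inv (mass2 M) $ d $ c)"

definition dual_dof2 :: "('m, 'v::finite, 'e, 'c, 'bv, 'be) gll_mesh \<Rightarrow> (real^2 \<Rightarrow> real) \<Rightarrow> real^'v" where
  "dual_dof2 M f = mass0 M *v dof0 M f"

definition dual_dof1 :: "('m, 'v, 'e::finite, 'c, 'bv, 'be) gll_mesh \<Rightarrow> (real^2 \<Rightarrow> real^2) \<Rightarrow> real^'e" where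
  "dual_dof1 M u = mass1 M *v dof1 M u"

definition dual_dof0 :: "('m, 'v, 'e, 'c::finite, 'bv, 'be) gll_mesh \<Rightarrow> (real^2 \<Rightarrow> real) \<Rightarrow> real^'c" where
  "dual_dof0 M g = mass2 M *v dof2 M g"

definition dual_C_space :: "('m, 'v::finite, 'e, 'c, 'bv, 'be) gll_mesh \<Rightarrow> (real^2 \<Rightarrow> real) set" where
  "dual_C_space M = {f \<in> C_space M. \<exists>a :: real^'v. \<forall>x\<in>closure (dmn M).
     f x = (\<Sum>v\<in>UNIV. dual_psi2 M v x * a $ v)}"

definition dual_D_space :: "('m, 'v, 'e::finite, 'c, 'bv, 'be) gll_mesh \<Rightarrow> (real^2 \<Rightarrow> real^2) set" where
  "dual_D_space M = {u \<in> D_space M. \<exists>a :: real^'e. \<forall>m. \<forall>x\<in>elem_int M m.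
     u x = (\<Sum>e\<in>UNIV. (a $ e) *\<^sub>R dual_psi1 M e x)}"

definition dual_S_space :: "('m, 'v, 'e, 'c::finite, 'bv, 'be) gll_mesh \<Rightarrow> (real^2 \<Rightarrow> real) set" where
  "dual_S_space M = {g \<in> S_space M. \<exists>a :: real^'c. \<forall>m. \<forall>x\<in>elem_int M m.
     g x = (\<Sum>c\<in>UNIV. dual_psi0 M c x * a $ c)}"

section \<open>Boundary spaces\<close>

definition incl0 :: "('m, 'v::finite, 'e, 'c, 'bv::finite, 'be) gll_mesh \<Rightarrow> real^'bv^'v" where
  "incl0 M = (\<chi> v b. if v = bnode M b then 1 else 0)"

definition incl1 :: "('m, 'v, 'e::finite, 'c, 'bv, 'be::finite) gll_mesh \<Rightarrow> real^'be^'e" where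
  "incl1 M = (\<chi> e b. if e = bedge M b
     then (if \<forall>x\<in>edge M e - elem_verts M. edge_nrm M e x = nrm M x then 1 else -1)
     else 0)"

definition bd_psi0 :: "('m, 'v::finite, 'e, 'c, 'bv::finite, 'be) gll_mesh \<Rightarrow> 'bv \<Rightarrow> real^2 \<Rightarrow> real" where
  "bd_psi0 M b x = (\<Sum>v\<in>UNIV. psi0 M v x * incl0 M $ v $ b)"

definition bd_psi1 :: "('m, 'v, 'e::finite, 'c, 'bv, 'be::finite) gll_mesh \<Rightarrow> 'be \<Rightarrow> real^2 \<Rightarrow> real" where
  "bd_psi1 M b x = (\<Sum>e\<in>UNIV. bd_normal_trace M (psi1 M e) x * incl1 M $ e $ b)"

definition bd_mass0 :: "('m, 'v::finite, 'e, 'c, 'bv::finite, 'be::finite) gll_mesh \<Rightarrow> real^'bv^'bv" where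
  "bd_mass0 M = (\<chi> a b. bd_integral M (\<lambda>x. bd_psi0 M a x * bd_psi0 M b x))"

definition bd_mass1 :: "('m, 'v, 'e::finite, 'c, 'bv, 'be::finite) gll_mesh \<Rightarrow> real^'be^'be" where
  "bd_mass1 M = (\<chi> a b. bd_integral M (\<lambda>x. bd_psi1 M a x * bd_psi1 M b x))"

definition dual_bd_psi1 ::
  "('m, 'v::finite, 'e, 'c, 'bv::finite, 'be::finite) gll_mesh \<Rightarrow> 'bv \<Rightarrow> real^2 \<Rightarrow> real" where
  "dual_bd_psi1 M b x = (\<Sum>a\<in>UNIV. bd_psi0 M a x * matrix_inv (bd_mass0 M) $ a $ b)"

definition dual_bd_psi0 ::
  "('m, 'v, 'e::finite, 'c, 'bv, 'be::finite) gll_mesh \<Rightarrow> 'be \<Rightarrow> real^2 \<Rightarrow> real" where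
  "dual_bd_psi0 M b x = (\<Sum>a\<in>UNIV. bd_psi1 M a x * matrix_inv (bd_mass1 M) $ a $ b)"

definition dual_bd_D_space :: "('m, 'v, 'e::finite, 'c, 'bv, 'be::finite) gll_mesh \<Rightarrow> (real^2 \<Rightarrow> real) set" where
  "dual_bd_D_space M = {h. \<exists>B :: real^'be. \<forall>x\<in>frontier (dmn M) - elem_verts M.
     h x = (\<Sum>b\<in>UNIV. dual_bd_psi0 M b x * B $ b)}"

definition dual_bd_C_space ::
  "('m, 'v::finite, 'e, 'c, 'bv::finite, 'be::finite) gll_mesh \<Rightarrow> (real^2 \<Rightarrow> real) set" where
  "dual_bd_C_space M = {h. \<exists>B :: real^'bv. \<forall>x\<in>frontier (dmn M).
     h x = (\<Sum>b\<in>UNIV. dual_bd_psi1 M b x * B $ b)}"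

definition bd_coeff0 :: "('m, 'v, 'e::finite, 'c, 'bv, 'be::finite) gll_mesh \<Rightarrow> (real^2 \<Rightarrow> real) \<Rightarrow> real^'be" where
  "bd_coeff0 M h = (THE B. \<forall>x\<in>frontier (dmn M) - elem_verts M.
     h x = (\<Sum>b\<in>UNIV. dual_bd_psi0 M b x * B $ b))"

definition bd_coeff1 ::
  "('m, 'v::finite, 'e, 'c, 'bv::finite, 'be::finite) gll_mesh \<Rightarrow> (real^2 \<Rightarrow> real) \<Rightarrow> real^'bv" where
  "bd_coeff1 M h = (THE B. \<forall>x\<in>frontier (dmn M).
     h x = (\<Sum>b\<in>UNIV. dual_bd_psi1 M b x * B $ b))"

section \<open>Dual gradient and dual rotation\<close>

text \<open>The defining relations determine the operators up to values on element boundaries (gradient),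
  respectively outside the closed domain (rotation), hence the choice operator.\<close>

definition dual_grad ::
  "('m, 'v, 'e::finite, 'c, 'bv, 'be::finite) gll_mesh \<Rightarrow>
     (real^2 \<Rightarrow> real) \<Rightarrow> (real^2 \<Rightarrow> real) \<Rightarrow> real^2 \<Rightarrow> real^2" where
  "dual_grad M s h = (SOME g. g \<in> dual_D_space M \<and>
     (\<forall>q\<in>D_space M. dmn_integral M (\<lambda>x. g x \<bullet> q x) =
        dmn_integral M (\<lambda>x. s x * (- div2 q x)) + bd_integral M (\<lambda>x. h x * bd_normal_trace M q x)))"

definition dual_rot ::
  "('m, 'v::finite, 'e, 'c, 'bv, 'be::finite) gll_mesh \<Rightarrow>
     (real^2 \<Rightarrow> real^2) \<Rightarrow> (real^2 \<Rightarrow> real) \<Rightarrow> real^2 \<Rightarrow> real" where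
  "dual_rot M d h = (SOME r. r \<in> dual_C_space M \<and>
     (\<forall>c\<in>C_space M. dmn_integral M (\<lambda>x. r x * c x) =
        dmn_integral M (\<lambda>x. d x \<bullet> curl2 c x) + bd_integral M (\<lambda>x. h x * c x)))"

end

theory Submission
  imports Defs
begin

text \<open>
Testing the defining relations with the basis functions turns both claims into identities between
coefficient vectors.  The domain integrals give mass matrices; these are invertible since an element
of the span with vanishing norm vanishes on every element and so has zero degrees of freedom.  The
boundary integrals give inclusion matrices, provided that basis functions of non-boundary edges and
nodes have no trace on \<open>\<partial>\<Omega>\<close>.  On a boundary side of an element the normal component of a member of
\<open>D(\<Omega>)\<close> is a polynomial of degree at most \<open>N - 1\<close>; if its fluxes through the \<open>N\<close> small edges of the
side vanish, it has a zero inside each of them, hence is zero.  A member of \<open>C(\<Omega>)\<close> is a polynomial of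
degree at most \<open>N\<close> with \<open>N + 1\<close> zeros there.  The sign in \<open>incl1\<close> is constant along an edge
because the outward normal is orthogonal to the edge and makes an obtuse angle with the image of the
direction pointing into the reference square.\<close>

section \<open>Elements of the mesh\<close>

text \<open>The operators are chosen with \<open>SOME\<close> and the boundary coefficient vectors
  with \<open>THE\<close>, so the formulas presuppose that a function satisfying the defining
  relation exists and that the coefficients are unique. Existence amounts to solving a mass system:
  every vector is the vector of dual degrees of freedom of some dual function, in particular the
  claimed right-hand side. Uniqueness holds because pairing with basis functions recovers the
  boundary coefficients up to sign.

  The obstacle is that fields in \<open>D_space\<close> and \<open>S_space\<close> are prescribed on
  open elements only, and normal traces are controlled only up to finitely many points of each edge,
  whereas sums are pulled out of integrals only for integrable summands. Two classes of integrands,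
  closed under sums and products, absorb this: functions that on each open element agree with a
  continuous function on the closed one, and functions that on an edge agree with a continuous one
  off a finite set. Moreover, normal traces must not depend on the element chosen at a boundary
  point (conformity), and a small edge in \<partial>\<Omega> must lie on a side of its element
  (outward normal).\<close>

lemma refK_eq_cbox: "refK = cbox (\<chi> i. - 1) (\<chi> i. 1)"
  by (auto simp: refK_def mem_box_cart)

lemma convex_refK: "convex refK" and compact_refK: "compact refK"
  by (simp_all add: refK_eq_cbox)

lemma interior_refK: "interior refK = {x. \<forall>i. - 1 < x $ i \<and> x $ i < 1}"
  by (auto simp: refK_eq_cbox interior_cbox mem_box_cart)

lemma closure_interior_refK: "closure (interior refK) = refK"
proof -
  have "interior refK \<noteq> {}"
    unfolding interior_refK by (auto intro!: exI[of _ 0])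
  then show ?thesis
    using convex_closure_interior[OF convex_refK] compact_refK
    by (simp add: compact_imp_closed closure_closed)
qed

lemma other_index: obtains l :: 2 where "l \<noteq> k" "\<And>i. i = k \<or> i = l"
proof (cases "k = 1")
  case True
  show ?thesis
    by (rule that[of 2]) (use True exhaust_2 in auto)
next
  case False
  show ?thesis
    by (rule that[of 1]) (use False exhaust_2 in auto)
qed

lemma line_in_refK_iff: "line k s t \<in> refK \<longleftrightarrow> s \<in> {-1..1} \<and> t \<in> {-1..1}"
proof -
  obtain l where "l \<noteq> k"
    using other_index by metis
  then show ?thesis
    unfolding refK_def line_def by auto
qed

lemma continuous_on_line [continuous_intros]:
  assumes "continuous_on S f" "continuous_on S g"
  shows "continuous_on S (\<lambda>x. line k (f x) (g x))"
  unfolding line_def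
proof (rule continuous_on_vec_lambda)
  fix l
  show "continuous_on S (\<lambda>x. if l = k then g x else f x)"
    using assms by (cases "l = k") auto
qed

lemma line_same [simp]: "line k s t $ k = t"
  by (simp add: line_def)

lemma line_other [simp]: "l \<noteq> k \<Longrightarrow> line k s t $ l = s"
  by (simp add: line_def)

lemma finite_corners: "finite corners"
proof -
  have "corners \<subseteq> (\<lambda>(a, b). vector [a, b]) ` ({-1, 1} \<times> {-1, 1})"
  proof
    fix x :: "real^2" assume "x \<in> corners"
    then have "x $ 1 \<in> {-1, 1}" "x $ 2 \<in> {-1, 1}" "x = vector [x $ 1, x $ 2]"
      by (auto simp: corners_def vec_eq_iff forall_2)
    then show "x \<in> (\<lambda>(a, b). vector [a, b]) ` ({-1, 1} \<times> {-1, 1})"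
      by (metis (mono_tags, lifting) SigmaI case_prod_conv image_eqI)
  qed
  then show ?thesis
    by (rule finite_subset) auto
qed

lemma finite_elem_verts: "finite (elem_verts (M :: ('m::finite, 'v, 'e, 'c, 'bv, 'be) gll_mesh))"
  by (simp add: elem_verts_def finite_corners)

section \<open>Integrands that are continuous element by element\<close>

lemma absolutely_integrable_on_compact:
  fixes f :: "'a::euclidean_space \<Rightarrow> 'b::euclidean_space"
  assumes "compact S" "continuous_on S f"
  shows "f absolutely_integrable_on S"
proof -
  have "(\<lambda>x. indicator S x *\<^sub>R f x) \<in> borel_measurable borel"
    using borel_integrable_compact[OF assms] by (metis borel_measurable_integrable measurable_lborel2)
  moreover have "integrable lborel (\<lambda>x. indicator S x *\<^sub>R f x)"
    by (rule borel_integrable_compact[OF assms])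
  ultimately show ?thesis
    unfolding set_integrable_def by (simp add: integrable_completion)
qed

text \<open>The continuous representative lives on the closed, hence compact, element, which yields
  integrability. Nothing is asked of \<open>f\<close> on element boundaries, where members of
  \<open>D_space\<close> and \<open>S_space\<close> are arbitrary.\<close>

definition piecewise_continuous ::
  "('m, 'v, 'e, 'c, 'bv, 'be) gll_mesh \<Rightarrow> (real^2 \<Rightarrow> 'a::topological_space) \<Rightarrow> bool" where
  "piecewise_continuous M f \<longleftrightarrow>
     (\<forall>m. \<exists>g. continuous_on (elem M m) g \<and> (\<forall>x\<in>elem_int M m. f x = g x))"

lemma piecewise_continuous_cong:
  assumes "\<And>m x. x \<in> elem_int M m \<Longrightarrow> f x = g x"
  shows "piecewise_continuous M f \<longleftrightarrow> piecewise_continuous M g"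
  using assms unfolding piecewise_continuous_def by (metis (no_types, lifting))

lemma piecewise_continuous_const: "piecewise_continuous M (\<lambda>x. c)"
  unfolding piecewise_continuous_def by (auto intro!: exI[of _ "\<lambda>x. c"])

lemma piecewise_continuous_compose2:
  assumes "piecewise_continuous M f" "piecewise_continuous M g"
    and "\<And>(S :: (real^2) set) f g. continuous_on S f \<Longrightarrow> continuous_on S g \<Longrightarrow> continuous_on S (\<lambda>x. h (f x) (g x))"
  shows "piecewise_continuous M (\<lambda>x. h (f x) (g x))"
  unfolding piecewise_continuous_def
proof
  fix m
  obtain f' g' where "continuous_on (elem M m) f'" "\<forall>x\<in>elem_int M m. f x = f' x"
    "continuous_on (elem M m) g'" "\<forall>x\<in>elem_int M m. g x = g' x"
    using assms(1,2) unfolding piecewise_continuous_def by blast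
  then show "\<exists>k. continuous_on (elem M m) k \<and> (\<forall>x\<in>elem_int M m. h (f x) (g x) = k x)"
    using assms(3)[of "elem M m" f' g'] by (intro exI[of _ "\<lambda>x. h (f' x) (g' x)"]) simp
qed

lemma piecewise_continuous_add:
  fixes f g :: "real^2 \<Rightarrow> 'a::real_normed_vector"
  shows "piecewise_continuous M f \<Longrightarrow> piecewise_continuous M g \<Longrightarrow>
    piecewise_continuous M (\<lambda>x. f x + g x)"
  by (rule piecewise_continuous_compose2) (auto intro: continuous_intros)

lemma piecewise_continuous_scaleR:
  fixes g :: "real^2 \<Rightarrow> 'a::real_normed_vector"
  shows "piecewise_continuous M f \<Longrightarrow> piecewise_continuous M g \<Longrightarrow>
    piecewise_continuous M (\<lambda>x. f x *\<^sub>R g x)"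
  by (rule piecewise_continuous_compose2[where h = scaleR]) (auto intro: continuous_intros)

lemma piecewise_continuous_inner:
  fixes f g :: "real^2 \<Rightarrow> 'a::real_inner"
  shows "piecewise_continuous M f \<Longrightarrow> piecewise_continuous M g \<Longrightarrow>
    piecewise_continuous M (\<lambda>x. f x \<bullet> g x)"
  by (rule piecewise_continuous_compose2[where h = inner]) (auto intro: continuous_intros)

lemma piecewise_continuous_sum:
  fixes f :: "'i \<Rightarrow> real^2 \<Rightarrow> 'a::real_normed_vector"
  assumes "\<And>i. i \<in> I \<Longrightarrow> piecewise_continuous M (f i)"
  shows "piecewise_continuous M (\<lambda>x. \<Sum>i\<in>I. f i x)"
  using assms
  by (induction I rule: infinite_finite_induct)
    (auto simp: piecewise_continuous_const intro!: piecewise_continuous_add)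

locale gll_meshed_domain =
  fixes M :: "('m::finite, 'v::finite, 'e::finite, 'c::finite, 'bv::finite, 'be::finite) gll_mesh"
  assumes meshed: "meshed_domain M"
begin

section \<open>Topology and null sets of the mapped elements\<close>

lemma partition: "partition_of_domain M"
  using meshed by (simp add: meshed_domain_def)

lemma element_map: "element_map (emap M m) (jac M m)"
  using partition by (simp add: partition_of_domain_def)

lemma closure_dmn: "closure (dmn M) = (\<Union>m. elem M m)"
  using partition by (simp add: partition_of_domain_def)

lemma open_dmn: "open (dmn M)"
  using meshed by (simp add: meshed_domain_def lipschitz_domain_def)

lemma inj_emap: "inj_on (emap M m) refK"
  using element_map by (simp add: element_map_def)

lemma emap_has_derivative:
  "x \<in> refK \<Longrightarrow> (emap M m has_derivative (\<lambda>h. jac M m x *v h)) (at x within refK)"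
  using element_map by (simp add: element_map_def)

lemma det_jac_pos: "x \<in> refK \<Longrightarrow> det (jac M m x) > 0"
  using element_map by (simp add: element_map_def)

lemma continuous_on_jac: "continuous_on refK (jac M m)"
  using element_map unfolding element_map_def by (metis has_derivative_continuous_on)

lemma continuous_on_emap: "continuous_on refK (emap M m)"
  using emap_has_derivative by (rule has_derivative_continuous_on)

lemma compact_elem: "compact (elem M m)"
  unfolding elem_def using compact_continuous_image continuous_on_emap compact_refK by blast

lemma elem_int_subset: "elem_int M m \<subseteq> elem M m"
  unfolding elem_int_def elem_def using interior_subset by blast

lemma elem_subset_closure: "elem M m \<subseteq> closure (dmn M)"
  using closure_dmn by blast

lemma continuous_on_emap_inv: "continuous_on (elem M m) (the_inv_into refK (emap M m))"
  unfolding elem_def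
  by (intro continuous_on_inv_into continuous_on_emap compact_refK inj_emap)

lemma continuous_on_elem_comp_inv:
  "continuous_on refK g \<Longrightarrow> continuous_on (elem M m) (\<lambda>x. g (the_inv_into refK (emap M m) x))"
  by (rule continuous_on_compose2[OF _ continuous_on_emap_inv])
    (auto simp: elem_def the_inv_into_f_f inj_emap)

lemma open_elem_int: "open (elem_int M m)"
  unfolding elem_int_def
  by (intro invariance_of_domain continuous_on_subset[OF continuous_on_emap]
      inj_on_subset[OF inj_emap] open_interior interior_subset)

lemma elem_subset_closure_elem_int: "elem M m \<subseteq> closure (elem_int M m)"
proof -
  have "emap M m ` closure (interior refK) \<subseteq> closure (elem_int M m)"
    by (rule image_closure_subset)
      (auto simp: closure_interior_refK continuous_on_emap elem_int_def closure_subset[THEN subsetD])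
  then show ?thesis
    by (simp add: closure_interior_refK elem_def)
qed

text \<open>This makes \<open>elem_trace\<close> meaningful: limits from within the open element are
  unique at every point of the closed element, including its boundary.\<close>

lemma not_trivial_limit_elem_int:
  assumes "x \<in> elem M m"
  shows "at x within elem_int M m \<noteq> bot"
proof -
  have "x islimpt elem_int M m"
  proof (cases "x \<in> elem_int M m")
    case True
    then show ?thesis
      using interior_limit_point interior_open open_elem_int by metis
  next
    case False
    then show ?thesis
      using assms elem_subset_closure_elem_int[of m] by (auto simp: closure_def)
  qed
  then show ?thesis
    by (simp add: trivial_limit_within)
qed

text \<open>The elements are given as a cover of the closure of the domain. An open set inside that
  closure must meet the domain itself, and this weaker fact suffices for continuity
  arguments.\<close>

lemma elem_int_dense_in_dmn:
  assumes "open U" "U \<noteq> {}" "U \<subseteq> elem_int M m"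
  shows "U \<inter> dmn M \<noteq> {}"
  using assms elem_int_subset[of m] elem_subset_closure[of m] open_Int_closure_eq_empty[of U "dmn M"]
  by blast

text \<open>The closed elements cover the domain, so what remains lies in the images of the boundary
  of the square; these are null as differentiable images of a null set in the same
  dimension.\<close>

lemma negligible_dmn_minus_elem_int: "negligible (dmn M - (\<Union>m. elem_int M m))"
proof -
  have side: "negligible (emap M m ` (refK - interior refK))" for m
  proof (rule negligible_differentiable_image_negligible)
    show "negligible (refK - interior refK)"
      unfolding refK_eq_cbox interior_cbox by (rule negligible_frontier_interval)
    show "emap M m differentiable_on refK - interior refK"
      unfolding differentiable_on_def differentiable_def
      using emap_has_derivative has_derivative_subset by blast
  qed simp
  have "negligible (\<Union>m. emap M m ` (refK - interior refK))"
  proof (rule negligible_Union[OF finite_imageI[OF finite]])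
    fix t assume "t \<in> range (\<lambda>m. emap M m ` (refK - interior refK))"
    then show "negligible t"
      using side by (elim rangeE) simp
  qed
  moreover have "dmn M - (\<Union>m. elem_int M m) \<subseteq> (\<Union>m. emap M m ` (refK - interior refK))"
    using closure_subset[of "dmn M"] unfolding closure_dmn elem_def elem_int_def by (auto; blast)
  ultimately show ?thesis
    by (rule negligible_subset)
qed

section \<open>Integration over the meshed domain\<close>

lemma piecewise_continuous_integrable:
  fixes f :: "real^2 \<Rightarrow> real"
  assumes "piecewise_continuous M f"
  shows "f absolutely_integrable_on dmn M"
proof -
  have sets: "elem_int M m \<inter> dmn M \<in> sets lebesgue" for m
    using borel_open[OF open_Int[OF open_elem_int open_dmn]] by simp
  have "f absolutely_integrable_on (elem_int M m \<inter> dmn M)" for m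
  proof -
    obtain g where g: "continuous_on (elem M m) g" "\<forall>x\<in>elem_int M m. f x = g x"
      using assms unfolding piecewise_continuous_def by blast
    have "g absolutely_integrable_on (elem_int M m \<inter> dmn M)"
      by (rule set_integrable_subset[OF absolutely_integrable_on_compact[OF compact_elem g(1)] sets])
        (use elem_int_subset in blast)
    then show ?thesis
      by (rule absolutely_integrable_spike[OF _ negligible_empty]) (use g in simp)
  qed
  then have "f absolutely_integrable_on (\<Union>m. elem_int M m \<inter> dmn M)"
    using sets by (intro set_integrable_UN) simp_all
  then show ?thesis
  proof (rule absolutely_integrable_spike_set)
    show "negligible {x \<in> (\<Union>m. elem_int M m \<inter> dmn M) - dmn M. f x \<noteq> 0}"
      by (rule negligible_subset[OF negligible_empty]) blast
    show "negligible {x \<in> dmn M - (\<Union>m. elem_int M m \<inter> dmn M). f x \<noteq> 0}"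
      by (rule negligible_subset[OF negligible_dmn_minus_elem_int]) blast
  qed
qed

lemma dmn_integral_eq_integral: "piecewise_continuous M f \<Longrightarrow> dmn_integral M f = integral (dmn M) f"
  unfolding dmn_integral_def
  by (rule set_lebesgue_integral_eq_integral(2)[OF piecewise_continuous_integrable])

lemma dmn_integral_cong:
  assumes "piecewise_continuous M g" "\<And>m x. x \<in> elem_int M m \<Longrightarrow> f x = g x"
  shows "dmn_integral M f = dmn_integral M g"
proof -
  have "piecewise_continuous M f"
    using assms piecewise_continuous_cong by metis
  moreover have "integral (dmn M) f = integral (dmn M) g"
    by (rule integral_spike[OF negligible_dmn_minus_elem_int]) (use assms(2) in auto)
  ultimately show ?thesis
    using assms(1) by (simp add: dmn_integral_eq_integral)
qed

lemma dmn_integral_cmult: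
  "piecewise_continuous M f \<Longrightarrow> dmn_integral M (\<lambda>x. c * f x) = c * dmn_integral M f"
  unfolding dmn_integral_def by simp

lemma dmn_integral_sum:
  assumes "finite I" "\<And>i. i \<in> I \<Longrightarrow> piecewise_continuous M (f i)"
  shows "dmn_integral M (\<lambda>x. \<Sum>i\<in>I. f i x) = (\<Sum>i\<in>I. dmn_integral M (f i))"
proof -
  have "dmn_integral M (\<lambda>x. \<Sum>i\<in>I. f i x) = integral (dmn M) (\<lambda>x. \<Sum>i\<in>I. f i x)"
    using assms by (intro dmn_integral_eq_integral piecewise_continuous_sum)
  also have "\<dots> = (\<Sum>i\<in>I. integral (dmn M) (f i))"
    using assms piecewise_continuous_integrable
    by (intro Henstock_Kurzweil_Integration.integral_sum) (auto simp: absolutely_integrable_on_def)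
  also have "\<dots> = (\<Sum>i\<in>I. dmn_integral M (f i))"
    using assms(2) by (intro sum.cong) (simp_all add: dmn_integral_eq_integral)
  finally show ?thesis .
qed

text \<open>Vanishing is first obtained at points of the domain, from a small box on which the
  continuous \<open>f\<close> integrates to zero. A point of the element with nonzero value would
  have an open set of such points around it, and that set meets the domain.\<close>

lemma dmn_integral_zero:
  assumes f: "piecewise_continuous M f" and nonneg: "\<And>x. f x \<ge> 0"
    and zero: "dmn_integral M f = 0" and x: "x \<in> elem_int M m"
  shows "f x = 0"
proof -
  obtain g where g: "continuous_on (elem M m) g" "\<forall>x\<in>elem_int M m. f x = g x"
    using f unfolding piecewise_continuous_def by blast
  have cont: "continuous_on (elem_int M m) f"
    using continuous_on_subset[OF g(1) elem_int_subset] g(2) by (metis continuous_on_cong)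
  have int: "f integrable_on dmn M"
    using piecewise_continuous_integrable[OF f] by (rule set_lebesgue_integral_eq_integral)
  have *: "f y = 0" if y: "y \<in> elem_int M m \<inter> dmn M" for y
  proof -
    have "open (elem_int M m \<inter> dmn M)"
      by (intro open_Int open_elem_int open_dmn)
    then obtain a b where ab: "cbox a b \<subseteq> elem_int M m \<inter> dmn M" "y \<in> box a b"
      using open_contains_cbox[OF _ y] by metis
    have cont': "continuous_on (cbox a b) f"
      using cont ab continuous_on_subset by blast
    then have "integral (cbox a b) f \<le> integral (dmn M) f"
      using ab int nonneg by (intro integral_subset_le) (auto intro: integrable_continuous)
    moreover have "integral (cbox a b) f \<ge> 0"
      using nonneg cont' by (intro integral_nonneg) (auto intro: integrable_continuous)
    ultimately have "integral (cbox a b) f = 0"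
      using zero f by (simp add: dmn_integral_eq_integral)
    then show ?thesis
      using integral_cbox_eq_0_iff[OF cont'] nonneg ab(2) box_subset_cbox[of a b] by (metis empty_iff subsetD)
  qed
  show ?thesis
  proof (rule ccontr)
    assume "f x \<noteq> 0"
    define U where "U = elem_int M m \<inter> f -` (- {0})"
    have "open U"
      unfolding U_def using cont open_elem_int by (rule continuous_open_preimage) auto
    then have "U \<inter> dmn M \<noteq> {}"
      using x \<open>f x \<noteq> 0\<close> by (intro elem_int_dense_in_dmn) (auto simp: U_def)
    then show False
      using * by (auto simp: U_def)
  qed
qed

end

section \<open>Polynomial spaces on the reference square\<close>

lemma tensor_poly_sum:
  assumes "\<And>i. i \<in> I \<Longrightarrow> f i \<in> tensor_poly p q"
  shows "(\<lambda>x. \<Sum>i\<in>I. c i * f i x) \<in> tensor_poly p q"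
proof -
  have "\<forall>i\<in>I. \<exists>a. \<forall>x. f i x = (\<Sum>j\<le>p. \<Sum>k\<le>q. a j k * (x $ 1) ^ j * (x $ 2) ^ k)"
    using assms unfolding tensor_poly_def by simp
  from bchoice[OF this] obtain a where a: "\<And>i x. i \<in> I \<Longrightarrow>
      f i x = (\<Sum>j\<le>p. \<Sum>k\<le>q. a i j k * (x $ 1) ^ j * (x $ 2) ^ k)"
    by blast
  have "(\<Sum>i\<in>I. c i * f i x) =
      (\<Sum>j\<le>p. \<Sum>k\<le>q. (\<Sum>i\<in>I. c i * a i j k) * (x $ 1) ^ j * (x $ 2) ^ k)" for x
  proof -
    have "(\<Sum>i\<in>I. c i * f i x) =
        (\<Sum>i\<in>I. \<Sum>j\<le>p. \<Sum>k\<le>q. c i * a i j k * (x $ 1) ^ j * (x $ 2) ^ k)"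
      by (intro sum.cong) (simp_all add: a sum_distrib_left mult.assoc)
    also have "\<dots> = (\<Sum>j\<le>p. \<Sum>i\<in>I. \<Sum>k\<le>q. c i * a i j k * (x $ 1) ^ j * (x $ 2) ^ k)"
      by (rule sum.swap)
    also have "\<dots> = (\<Sum>j\<le>p. \<Sum>k\<le>q. \<Sum>i\<in>I. c i * a i j k * (x $ 1) ^ j * (x $ 2) ^ k)"
      by (intro sum.cong refl sum.swap)
    finally show ?thesis
      by (simp add: sum_distrib_right)
  qed
  then show ?thesis
    unfolding tensor_poly_def mem_Collect_eq
    by (intro exI[of _ "\<lambda>j k. \<Sum>i\<in>I. c i * a i j k"] allI)
qed

lemma continuous_on_tensor_poly:
  assumes "f \<in> tensor_poly p q"
  shows "continuous_on S f"
proof -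
  obtain a where "\<And>x. f x = (\<Sum>i\<le>p. \<Sum>j\<le>q. a i j * (x $ 1) ^ i * (x $ 2) ^ j)"
    using assms unfolding tensor_poly_def by blast
  then have "f = (\<lambda>x. \<Sum>i\<le>p. \<Sum>j\<le>q. a i j * (x $ 1) ^ i * (x $ 2) ^ j)"
    by blast
  then show ?thesis
    by (auto intro!: continuous_intros)
qed

lemma tensor_poly_line:
  assumes "f \<in> tensor_poly p q"
  obtains P where "degree P \<le> (if k = 1 then p else q)" "\<And>t. f (line k s t) = poly P t"
proof -
  obtain a where a: "\<And>x. f x = (\<Sum>i\<le>p. \<Sum>j\<le>q. a i j * (x $ 1) ^ i * (x $ 2) ^ j)"
    using assms unfolding tensor_poly_def by blast
  show thesis
  proof (cases "k = 1")
    case True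
    show thesis
    proof (rule that)
      show "degree (\<Sum>i\<le>p. monom (\<Sum>j\<le>q. a i j * s ^ j) i) \<le> (if k = 1 then p else q)"
        using True by (auto intro!: degree_sum_le degree_monom_le[THEN order_trans])
      show "f (line k s t) = poly (\<Sum>i\<le>p. monom (\<Sum>j\<le>q. a i j * s ^ j) i) t" for t
        using True by (simp add: a poly_sum poly_monom sum_distrib_left sum_distrib_right ac_simps)
    qed
  next
    case False
    then have k: "k = 2"
      using exhaust_2 by blast
    show thesis
    proof (rule that)
      show "degree (\<Sum>j\<le>q. monom (\<Sum>i\<le>p. a i j * s ^ i) j) \<le> (if k = 1 then p else q)"
        using False by (auto intro!: degree_sum_le degree_monom_le[THEN order_trans])
      have "f (line k s t) = (\<Sum>i\<le>p. \<Sum>j\<le>q. a i j * s ^ i * t ^ j)" for t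
        using k by (simp add: a)
      also have "\<dots> t = (\<Sum>j\<le>q. \<Sum>i\<le>p. a i j * s ^ i * t ^ j)" for t
        by (rule sum.swap)
      finally show "f (line k s t) = poly (\<Sum>j\<le>q. monom (\<Sum>i\<le>p. a i j * s ^ i) j) t" for t
        by (simp add: poly_sum poly_monom sum_distrib_left sum_distrib_right ac_simps)
    qed
  qed
qed

text \<open>The component transverse to the line is the one that enters normal fluxes, and its
  degree along the line is at most \<open>N - 1\<close> instead of \<open>N\<close>.\<close>

lemma D_ref_component:
  assumes "u \<in> D_ref N" "l \<noteq> k"
  obtains P where "degree P \<le> N - 1" "\<And>t. u (line k s t) $ l = poly P t"
proof (cases "k = 1")
  case True
  then have "(\<lambda>x. u x $ l) \<in> tensor_poly (N - 1) N"
    using assms exhaust_2[of l] by (auto simp: D_ref_def)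
  from tensor_poly_line[OF this, of k s] True that show ?thesis by auto
next
  case False
  then have "(\<lambda>x. u x $ l) \<in> tensor_poly N (N - 1)"
    using assms exhaust_2[of l] exhaust_2[of k] by (auto simp: D_ref_def)
  from tensor_poly_line[OF this, of k s] False that show ?thesis by auto
qed

lemma continuous_on_D_ref:
  assumes "u \<in> D_ref N"
  shows "continuous_on S u"
proof -
  have "continuous_on S (\<lambda>x. u x $ i)" for i
    using assms exhaust_2[of i] by (auto simp: D_ref_def intro: continuous_on_tensor_poly)
  then have "continuous_on S (\<lambda>x. \<chi> i. u x $ i)"
    by (rule continuous_on_vec_lambda)
  then show ?thesis
    by simp
qed

lemma continuous_on_matrix_vector_mult:
  fixes A :: "'a::topological_space \<Rightarrow> real^'n^'m"
  assumes "continuous_on S A" "continuous_on S v"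
  shows "continuous_on S (\<lambda>x. A x *v v x)"
  unfolding matrix_vector_mult_def
  by (intro continuous_intros continuous_on_vec_lambda assms)

section \<open>Traces and linear combinations in the mesh function spaces\<close>

context gll_meshed_domain
begin

lemma continuous_on_piola:
  assumes "continuous_on refK u"
  shows "continuous_on refK (\<lambda>x. (1 / det (jac M m x)) *\<^sub>R (jac M m x *v u x))"
proof -
  have "continuous_on refK (\<lambda>x. det (jac M m x))"
    unfolding det_2 by (intro continuous_intros continuous_on_jac)
  then show ?thesis
    using assms det_jac_pos continuous_on_jac
    by (intro continuous_intros continuous_on_matrix_vector_mult) (auto simp: less_imp_neq[symmetric])
qed

text \<open>The limit from the open element exists because \<open>u\<close> agrees there with a
  function continuous up to the boundary, and it is unique by
  \<open>not_trivial_limit_elem_int\<close>.\<close>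

lemma elem_trace_eqI:
  assumes "continuous_on (elem M m) g" "\<And>x. x \<in> elem_int M m \<Longrightarrow> u x = g x" "x \<in> elem M m"
  shows "elem_trace M m u x = g x"
proof -
  have "(g \<longlongrightarrow> g x) (at x within elem_int M m)"
    using assms(1,3) elem_int_subset tendsto_within_subset unfolding continuous_on_def by blast
  then have "(u \<longlongrightarrow> g x) (at x within elem_int M m)"
    by (rule Lim_transform_within[where d = 1]) (use assms(2) in auto)
  then show ?thesis
    unfolding elem_trace_def using not_trivial_limit_elem_int[OF assms(3)] by (intro tendsto_Lim)
qed

text \<open>The Piola form is required on the open square only. It extends continuously to the
  closed square, where the determinant has no zero, and the extension is what the trace sees; all
  computations on edges rest on this.\<close>

lemma D_space_trace_rep:
  assumes "u \<in> D_space M"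
  obtains u' where "u' \<in> D_ref (deg M)"
    "\<And>x. x \<in> refK \<Longrightarrow>
      elem_trace M m u (emap M m x) = (1 / det (jac M m x)) *\<^sub>R (jac M m x *v u' x)"
    "continuous_on (elem M m) (elem_trace M m u)"
    "\<And>x. x \<in> elem_int M m \<Longrightarrow> elem_trace M m u x = u x"
proof -
  obtain u' where u': "u' \<in> D_ref (deg M)"
    "\<And>x. x \<in> interior refK \<Longrightarrow>
      u (emap M m x) = (1 / det (jac M m x)) *\<^sub>R (jac M m x *v u' x)"
    using assms unfolding D_space_def by blast
  define w where "w x = (1 / det (jac M m x)) *\<^sub>R (jac M m x *v u' x)" for x
  define g where "g x = w (the_inv_into refK (emap M m) x)" for x
  have g_emap: "g (emap M m x) = w x" if "x \<in> refK" for x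
    using that by (simp add: g_def the_inv_into_f_f[OF inj_emap])
  have contg: "continuous_on (elem M m) g"
    unfolding g_def w_def
    using continuous_on_piola[OF continuous_on_D_ref[OF u'(1)]] by (rule continuous_on_elem_comp_inv)
  have ug: "u x = g x" if "x \<in> elem_int M m" for x
    using that u'(2) g_emap interior_subset unfolding elem_int_def w_def by fastforce
  have trace: "elem_trace M m u x = g x" if "x \<in> elem M m" for x
    using contg ug that by (rule elem_trace_eqI)
  show thesis
  proof (rule that[OF u'(1)])
    show "elem_trace M m u (emap M m x) = (1 / det (jac M m x)) *\<^sub>R (jac M m x *v u' x)"
      if "x \<in> refK" for x
      using that trace[of "emap M m x"] by (simp add: elem_def g_emap w_def)
    show "continuous_on (elem M m) (elem_trace M m u)"
      using contg trace by (metis continuous_on_cong)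
    show "elem_trace M m u x = u x" if "x \<in> elem_int M m" for x
      using that trace[of x] ug elem_int_subset by auto
  qed
qed

lemma continuous_on_elem_trace: "u \<in> D_space M \<Longrightarrow> continuous_on (elem M m) (elem_trace M m u)"
  using D_space_trace_rep by metis

lemma elem_trace_interior: "u \<in> D_space M \<Longrightarrow> x \<in> elem_int M m \<Longrightarrow> elem_trace M m u x = u x"
  using D_space_trace_rep by metis

lemma D_space_piecewise_continuous: "u \<in> D_space M \<Longrightarrow> piecewise_continuous M u"
  unfolding piecewise_continuous_def using continuous_on_elem_trace elem_trace_interior by metis

text \<open>The hypothesis on \<open>v\<close> concerns the open element only, so basis expansions,
  which are given there, carry over to traces on the closed element.\<close>

lemma elem_trace_sum:
  assumes "\<And>i. i \<in> I \<Longrightarrow> u i \<in> D_space M" "x \<in> elem M m"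
    and "\<And>y. y \<in> elem_int M m \<Longrightarrow> v y = (\<Sum>i\<in>I. c i *\<^sub>R u i y)"
  shows "elem_trace M m v x = (\<Sum>i\<in>I. c i *\<^sub>R elem_trace M m (u i) x)"
  using assms
  by (intro elem_trace_eqI[OF _ _ assms(2)])
    (auto intro!: continuous_intros continuous_on_elem_trace sum.cong simp: elem_trace_interior)

lemma D_space_sum:
  assumes u: "\<And>i. i \<in> I \<Longrightarrow> u i \<in> D_space M"
  shows "(\<lambda>x. \<Sum>i\<in>I. c i *\<^sub>R u i x) \<in> D_space M"
proof -
  have "normal_continuous M (\<lambda>x. \<Sum>i\<in>I. c i *\<^sub>R u i x)"
    unfolding normal_continuous_def
  proof (intro allI ballI impI, elim conjE)
    fix m k s m' k' s' \<tau> \<nu> and t :: real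
    assume t: "t \<in> {-1..1}" and cs: "common_side M m k s m' k' s' \<tau>"
      and \<nu>: "\<nu> \<bullet> (jac M m (line k s t) *v axis k 1) = 0"
    let ?x = "emap M m (line k s t)"
    \<comment> \<open>The common point has to be placed in both elements before the traces from the
      two sides can be expanded.\<close>
    have "line k s t \<in> refK" "line k' s' (\<tau> * t) \<in> refK" "?x = emap M m' (line k' s' (\<tau> * t))"
      using cs t by (auto simp: common_side_def line_in_refK_iff)
    then have x: "?x \<in> elem M m" "?x \<in> elem M m'"
      unfolding elem_def by (metis imageI)+
    have "elem_trace M m (u i) ?x \<bullet> \<nu> = elem_trace M m' (u i) ?x \<bullet> \<nu>" if "i \<in> I" for i
      using u[OF that] t cs \<nu> unfolding D_space_def normal_continuous_def by blast
    then show "elem_trace M m (\<lambda>x. \<Sum>i\<in>I. c i *\<^sub>R u i x) ?x \<bullet> \<nu> =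
        elem_trace M m' (\<lambda>x. \<Sum>i\<in>I. c i *\<^sub>R u i x) ?x \<bullet> \<nu>"
      using elem_trace_sum[OF u x(1) refl, where c = c] elem_trace_sum[OF u x(2) refl, where c = c]
      by (simp add: inner_sum_left)
  qed
  moreover have "\<exists>w\<in>D_ref (deg M). \<forall>x\<in>interior refK. (\<Sum>i\<in>I. c i *\<^sub>R u i (emap M m x)) =
      (1 / det (jac M m x)) *\<^sub>R (jac M m x *v w x)" for m
  proof -
    have "\<forall>i\<in>I. \<exists>w\<in>D_ref (deg M). \<forall>x\<in>interior refK.
        u i (emap M m x) = (1 / det (jac M m x)) *\<^sub>R (jac M m x *v w x)"
      using u unfolding D_space_def by blast
    then obtain w where w: "\<And>i. i \<in> I \<Longrightarrow> w i \<in> D_ref (deg M)"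
      "\<And>i x. i \<in> I \<Longrightarrow> x \<in> interior refK \<Longrightarrow>
        u i (emap M m x) = (1 / det (jac M m x)) *\<^sub>R (jac M m x *v w i x)"
      by metis
    have "(\<lambda>x. \<Sum>i\<in>I. c i *\<^sub>R w i x) \<in> D_ref (deg M)"
      using w(1) tensor_poly_sum[of I "\<lambda>i x. w i x $ 1"] tensor_poly_sum[of I "\<lambda>i x. w i x $ 2"]
      unfolding D_ref_def by (auto simp: sum_component)
    moreover have "jac M m x *v (\<Sum>i\<in>I. c i *\<^sub>R w i x) = (\<Sum>i\<in>I. c i *\<^sub>R (jac M m x *v w i x))" for x
      by (simp add: linear_sum[OF matrix_vector_mul_linear] matrix_vector_mult_scaleR)
    ultimately show ?thesis
      using w(2) by (intro bexI[of _ "\<lambda>x. \<Sum>i\<in>I. c i *\<^sub>R w i x"])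
        (auto simp: scaleR_right.sum intro!: sum.cong)
  qed
  ultimately show ?thesis
    by (simp add: D_space_def)
qed

lemma C_space_sum:
  assumes f: "\<And>i. i \<in> I \<Longrightarrow> f i \<in> C_space M"
  shows "(\<lambda>x. \<Sum>i\<in>I. c i * f i x) \<in> C_space M"
proof -
  have "\<exists>g\<in>C_ref (deg M). \<forall>x\<in>refK. (\<Sum>i\<in>I. c i * f i (emap M m x)) = g x" for m
  proof -
    have "\<forall>i\<in>I. \<exists>g\<in>C_ref (deg M). \<forall>x\<in>refK. f i (emap M m x) = g x"
      using f unfolding C_space_def by blast
    then obtain g where "\<And>i. i \<in> I \<Longrightarrow> g i \<in> C_ref (deg M)"
      "\<And>i x. i \<in> I \<Longrightarrow> x \<in> refK \<Longrightarrow> f i (emap M m x) = g i x"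
      by metis
    then show ?thesis
      using tensor_poly_sum[of I g "deg M" "deg M" c] unfolding C_ref_def
      by (intro bexI[of _ "\<lambda>x. \<Sum>i\<in>I. c i * g i x"]) auto
  qed
  then show ?thesis
    using f by (auto simp: C_space_def intro!: continuous_intros)
qed

lemma C_space_continuous: "f \<in> C_space M \<Longrightarrow> continuous_on (closure (dmn M)) f"
  by (simp add: C_space_def)

lemma C_space_piecewise_continuous: "f \<in> C_space M \<Longrightarrow> piecewise_continuous M f"
  unfolding piecewise_continuous_def
  using C_space_continuous continuous_on_subset elem_subset_closure by metis

lemma S_space_piecewise_continuous:
  assumes "g \<in> S_space M"
  shows "piecewise_continuous M g"
  unfolding piecewise_continuous_def
proof
  fix m
  obtain g' where g': "g' \<in> S_ref (deg M)"
    "\<And>x. x \<in> interior refK \<Longrightarrow> g (emap M m x) = 1 / det (jac M m x) * g' x"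
    using assms unfolding S_space_def by blast
  have "continuous_on refK (\<lambda>x. det (jac M m x))"
    unfolding det_2 by (intro continuous_intros continuous_on_jac)
  then have "continuous_on refK (\<lambda>x. 1 / det (jac M m x) * g' x)"
    using continuous_on_tensor_poly[OF g'(1)[unfolded S_ref_def]] det_jac_pos
    by (intro continuous_intros) (auto simp: less_imp_neq[symmetric])
  from continuous_on_elem_comp_inv[OF this]
  show "\<exists>h. continuous_on (elem M m) h \<and> (\<forall>x\<in>elem_int M m. g x = h x)"
  proof (intro exI conjI ballI)
    fix x assume "x \<in> elem_int M m"
    then obtain y where y: "y \<in> interior refK" "x = emap M m y"
      by (auto simp: elem_int_def)
    then have "the_inv_into refK (emap M m) x = y"
      using interior_subset by (auto intro!: the_inv_into_f_f[OF inj_emap])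
    then show "g x = 1 / det (jac M m (the_inv_into refK (emap M m) x)) *
        g' (the_inv_into refK (emap M m) x)"
      using g'(2) y by simp
  qed
qed

end

section \<open>Integrals over small edges\<close>

text \<open>Exceptional points arise at vertices of elements, where no normal is prescribed, and at
  ends of small edges. A finite set of them pulls back to a finite, hence null, set under an
  injective parametrisation.\<close>

definition almost_continuous_on :: "'a::topological_space set \<Rightarrow> ('a \<Rightarrow> real) \<Rightarrow> bool" where
  "almost_continuous_on A f \<longleftrightarrow> (\<exists>g. continuous_on A g \<and> finite {x \<in> A. f x \<noteq> g x})"

lemma almost_continuous_onI: "continuous_on A g \<Longrightarrow> finite {x \<in> A. f x \<noteq> g x} \<Longrightarrow> almost_continuous_on A f"
  unfolding almost_continuous_on_def by blast

lemma continuous_imp_almost_continuous_on: "continuous_on A f \<Longrightarrow> almost_continuous_on A f"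
  by (rule almost_continuous_onI[of A f]) auto

lemma almost_continuous_on_cong:
  assumes "almost_continuous_on A g" "finite {x \<in> A. f x \<noteq> g x}"
  shows "almost_continuous_on A f"
proof -
  obtain h where h: "continuous_on A h" "finite {x \<in> A. g x \<noteq> h x}"
    using assms(1) unfolding almost_continuous_on_def by blast
  have "finite {x \<in> A. f x \<noteq> h x}"
    by (rule finite_subset[OF _ finite_UnI[OF h(2) assms(2)]]) auto
  then show ?thesis
    using h(1) by (rule almost_continuous_onI[rotated])
qed

lemma almost_continuous_on_compose2:
  assumes "almost_continuous_on A f" "almost_continuous_on A g"
    and "\<And>f g. continuous_on A f \<Longrightarrow> continuous_on A g \<Longrightarrow> continuous_on A (\<lambda>x. h (f x) (g x))"
  shows "almost_continuous_on A (\<lambda>x. h (f x) (g x))"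
proof -
  obtain f' g' where fg: "continuous_on A f'" "finite {x \<in> A. f x \<noteq> f' x}"
    "continuous_on A g'" "finite {x \<in> A. g x \<noteq> g' x}"
    using assms(1,2) unfolding almost_continuous_on_def by blast
  have "finite {x \<in> A. h (f x) (g x) \<noteq> h (f' x) (g' x)}"
    by (rule finite_subset[OF _ finite_UnI[OF fg(2,4)]]) auto
  then show ?thesis
    using assms(3)[OF fg(1,3)] by (rule almost_continuous_onI[rotated])
qed

lemma almost_continuous_on_mult:
  "almost_continuous_on A f \<Longrightarrow> almost_continuous_on A g \<Longrightarrow> almost_continuous_on A (\<lambda>x. f x * g x)"
  by (rule almost_continuous_on_compose2) (auto intro: continuous_intros)

lemma almost_continuous_on_add:
  "almost_continuous_on A f \<Longrightarrow> almost_continuous_on A g \<Longrightarrow> almost_continuous_on A (\<lambda>x. f x + g x)"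
  by (rule almost_continuous_on_compose2) (auto intro: continuous_intros)

lemma almost_continuous_on_cmult:
  "almost_continuous_on A f \<Longrightarrow> almost_continuous_on A (\<lambda>x. c * f x)"
  by (rule almost_continuous_on_mult[OF continuous_imp_almost_continuous_on[OF continuous_on_const]])

lemma almost_continuous_on_sum:
  assumes "\<And>i. i \<in> I \<Longrightarrow> almost_continuous_on A (f i)"
  shows "almost_continuous_on A (\<lambda>x. \<Sum>i\<in>I. f i x)"
  using assms
  by (induction I rule: infinite_finite_induct)
    (auto simp: continuous_imp_almost_continuous_on intro!: almost_continuous_on_add)

lemma connected_nonzero_sign:
  fixes h :: "'a::topological_space \<Rightarrow> real"
  assumes "connected S" "continuous_on S h" "\<And>x. x \<in> S \<Longrightarrow> h x \<noteq> 0"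
  shows "(\<forall>x\<in>S. h x > 0) \<or> (\<forall>x\<in>S. h x < 0)"
proof (rule ccontr)
  assume "\<not> ?thesis"
  then obtain x y where xy: "x \<in> S" "y \<in> S" "h x < 0" "h y > 0"
    using assms(3) by (metis linorder_neqE_linordered_idom)
  have "connected (h ` S)"
    using assms(1,2) by (rule connected_continuous_image[rotated])
  then have "0 \<in> h ` S"
    using xy unfolding connected_iff_interval by (meson image_eqI less_imp_le)
  then show False
    using assms(3) by auto
qed

section \<open>GLL nodes and parametrised small edges\<close>

context gll_meshed_domain
begin

lemma gll_nodes: "gll_nodes (deg M) (gll M)" and deg_pos: "deg M \<ge> 1"
  using meshed by (auto simp: meshed_domain_def)

lemma gll_0: "gll M 0 = -1" and gll_deg: "gll M (deg M) = 1"
  using gll_nodes by (auto simp: gll_nodes_def)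

lemma gll_less: "i < j \<Longrightarrow> j \<le> deg M \<Longrightarrow> gll M i < gll M j"
proof (induction j)
  case (Suc j)
  have "gll M j < gll M (Suc j)"
    using Suc.prems gll_nodes by (simp add: gll_nodes_def)
  then show ?case
    using Suc by (cases "i = j") auto
qed simp

lemma gll_le: "i \<le> j \<Longrightarrow> j \<le> deg M \<Longrightarrow> gll M i \<le> gll M j"
  using gll_less[of i j] by (cases "i = j") auto

lemma gll_bounds: "i \<le> deg M \<Longrightarrow> gll M i \<in> {-1..1}"
  using gll_le[of 0 i] gll_le[of i "deg M"] by (simp add: gll_0 gll_deg)

lemma gll_inj: "i \<le> deg M \<Longrightarrow> j \<le> deg M \<Longrightarrow> gll M i = gll M j \<Longrightarrow> i = j"
  using gll_less[of i j] gll_less[of j i] by (cases i j rule: linorder_cases) auto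

lemma gll_interval_subset: "j < deg M \<Longrightarrow> {gll M j..gll M (Suc j)} \<subseteq> {-1..1}"
  using gll_bounds[of j] gll_bounds[of "Suc j"] by auto

lemma gll_interior: "j < deg M \<Longrightarrow> gll M j < t \<Longrightarrow> t < gll M (Suc j) \<Longrightarrow> -1 < t \<and> t < 1"
  using gll_bounds[of j] gll_bounds[of "Suc j"] by simp

lemma gll_cover:
  assumes "t \<in> {-1..1}"
  obtains j where "j < deg M" "t \<in> {gll M j..gll M (Suc j)}"
proof -
  define j where "j = (LEAST j. t \<le> gll M (Suc j))"
  have *: "t \<le> gll M (Suc (deg M - 1))"
    using assms deg_pos by (simp add: gll_deg)
  then have t: "t \<le> gll M (Suc j)" and j: "j \<le> deg M - 1"
    unfolding j_def by (rule LeastI, rule Least_le[where P = "\<lambda>j. t \<le> gll M (Suc j)"])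
  have "gll M j \<le> t"
  proof (cases j)
    case (Suc j')
    then show ?thesis
      using not_less_Least[of j' "\<lambda>j. t \<le> gll M (Suc j)"] by (simp add: j_def)
  qed (use assms gll_0 in simp)
  then show thesis
    using that[of j] t j deg_pos by auto
qed

lemma line_in_refK: "i \<le> deg M \<Longrightarrow> t \<in> {-1..1} \<Longrightarrow> line k (gll M i) t \<in> refK"
  using gll_bounds by (auto simp: line_in_refK_iff)

lemma small_edge_subset_elem: "i \<le> deg M \<Longrightarrow> j < deg M \<Longrightarrow> small_edge M m k i j \<subseteq> elem M m"
  unfolding small_edge_def elem_def using gll_interval_subset line_in_refK by blast

lemma edge_in_mesh_edges: "edge M e \<in> mesh_edges M"
  using meshed by (auto simp: meshed_domain_def bij_betw_def)

lemma edge_obtain_small_edge: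
  obtains m k i j where "i \<le> deg M" "j < deg M" "edge M e = small_edge M m k i j"
  using edge_in_mesh_edges[of e] unfolding mesh_edges_def by auto

lemma small_edge_obtain_edge:
  assumes "i \<le> deg M" "j < deg M"
  obtains e where "edge M e = small_edge M m k i j"
proof -
  have "small_edge M m k i j \<in> range (edge M)"
    using assms meshed by (auto simp: meshed_domain_def bij_betw_def mesh_edges_def)
  then show thesis
    using that by (metis imageE)
qed

lemma edge_subset_elem_of: "edge M e \<subseteq> elem M (elem_of M (edge M e))"
proof -
  have "\<exists>m. edge M e \<subseteq> elem M m"
    using edge_obtain_small_edge[of e] small_edge_subset_elem by metis
  then show ?thesis
    unfolding elem_of_def by (rule someI_ex)
qed

lemma continuous_on_emap_line:
  "i \<le> deg M \<Longrightarrow> continuous_on {-1..1} (\<lambda>t. emap M m (line k (gll M i) t))"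
  by (rule continuous_on_compose2[OF continuous_on_emap])
    (auto intro!: continuous_intros line_in_refK)

lemma inj_on_emap_line:
  assumes "i \<le> deg M"
  shows "inj_on (\<lambda>t. emap M m (line k (gll M i) t)) {-1..1}"
proof (rule inj_onI)
  fix s t assume "s \<in> {-1..1}" "t \<in> {-1..1}"
    "emap M m (line k (gll M i) s) = emap M m (line k (gll M i) t)"
  then have "line k (gll M i) s = line k (gll M i) t"
    using inj_onD[OF inj_emap] line_in_refK assms by metis
  then show "s = t"
    by (metis line_same)
qed

lemma jac_mult_eq_0_iff:
  assumes "x \<in> refK"
  shows "jac M m x *v v = 0 \<longleftrightarrow> v = 0"
proof -
  have "invertible (jac M m x)"
    using det_jac_pos[OF assms, of m] by (simp add: invertible_det_nz)
  then have "\<forall>v. jac M m x *v v = 0 \<longrightarrow> v = 0"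
    unfolding invertible_left_inverse matrix_left_invertible_ker .
  then show ?thesis
    by auto
qed

lemma jac_axis_nonzero: "x \<in> refK \<Longrightarrow> jac M m x *v axis k 1 \<noteq> 0"
  by (simp add: jac_mult_eq_0_iff axis_eq_0_iff)

text \<open>\<open>edge_integral\<close> takes some description of the edge through
  \<open>SOME\<close>. Hiding it behind a curve and a positive weight lets later arguments ignore
  the element from which the parametrisation comes.\<close>

lemma edge_parametrization:
  obtains a b :: real and \<gamma> w where "a < b" "continuous_on {a..b} \<gamma>" "inj_on \<gamma> {a..b}"
    "\<gamma> ` {a..b} = edge M e" "continuous_on {a..b} w" "\<And>t. t \<in> {a..b} \<Longrightarrow> w t > 0"
    "\<And>f. edge_integral M (edge M e) f = (LINT t:{a..b}|lebesgue. f (\<gamma> t) * w t)"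
proof -
  let ?P = "\<lambda>(m, k, i, j). i \<le> deg M \<and> j < deg M \<and> edge M e = small_edge M m k i j"
  obtain m k i j where mk: "(SOME x. ?P x) = (m, k, i, j)"
    by (rule prod_cases4)
  have "\<exists>x. ?P x"
    by (rule edge_obtain_small_edge[of e]) auto
  then have "?P (SOME x. ?P x)"
    by (rule someI_ex)
  then have ij: "i \<le> deg M" "j < deg M" "edge M e = small_edge M m k i j"
    unfolding mk by auto
  let ?\<gamma> = "\<lambda>t. emap M m (line k (gll M i) t)"
    and ?w = "\<lambda>t. norm (jac M m (line k (gll M i) t) *v axis k 1)"
  note sub = gll_interval_subset[OF ij(2)]
  show thesis
  proof (rule that[of "gll M j" "gll M (Suc j)" ?\<gamma> ?w])
    show "gll M j < gll M (Suc j)"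
      using ij by (intro gll_less) auto
    show "continuous_on {gll M j..gll M (Suc j)} ?\<gamma>"
      using continuous_on_emap_line[OF ij(1)] sub by (rule continuous_on_subset)
    show "inj_on ?\<gamma> {gll M j..gll M (Suc j)}"
      using inj_on_emap_line[OF ij(1)] sub by (rule inj_on_subset)
    show "?\<gamma> ` {gll M j..gll M (Suc j)} = edge M e"
      by (auto simp: ij(3) small_edge_def)
    have "continuous_on {-1..1} (\<lambda>t. jac M m (line k (gll M i) t))"
      by (rule continuous_on_compose2[OF continuous_on_jac])
        (auto intro!: continuous_intros line_in_refK ij)
    then show "continuous_on {gll M j..gll M (Suc j)} ?w"
      using sub by (intro continuous_intros continuous_on_matrix_vector_mult)
        (auto intro: continuous_on_subset)
    show "?w t > 0" if "t \<in> {gll M j..gll M (Suc j)}" for t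
      using that sub ij by (auto intro!: jac_axis_nonzero line_in_refK)
    show "edge_integral M (edge M e) f =
        (LINT t:{gll M j..gll M (Suc j)}|lebesgue. f (?\<gamma> t) * ?w t)" for f
      unfolding edge_integral_def mk by simp
  qed
qed

text \<open>Replacing the Lebesgue by the gauge integral makes changes on finite sets harmless without
  measurability obligations.\<close>

lemma edge_parametrization_integral:
  obtains a b :: real and \<gamma> w where "a < b" "continuous_on {a..b} \<gamma>" "inj_on \<gamma> {a..b}"
    "\<gamma> ` {a..b} = edge M e" "continuous_on {a..b} w" "\<And>t. t \<in> {a..b} \<Longrightarrow> w t > 0"
    "\<And>f. almost_continuous_on (edge M e) f \<Longrightarrow>
       (\<lambda>t. f (\<gamma> t) * w t) integrable_on {a..b}"
    "\<And>f. almost_continuous_on (edge M e) f \<Longrightarrow>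
       edge_integral M (edge M e) f = integral {a..b} (\<lambda>t. f (\<gamma> t) * w t)"
proof -
  obtain a b :: real and \<gamma> w where par: "a < b" "continuous_on {a..b} \<gamma>" "inj_on \<gamma> {a..b}"
    "\<gamma> ` {a..b} = edge M e" "continuous_on {a..b} w" "\<And>t. t \<in> {a..b} \<Longrightarrow> w t > 0"
    "\<And>f. edge_integral M (edge M e) f = (LINT t:{a..b}|lebesgue. f (\<gamma> t) * w t)"
    by (rule edge_parametrization[of e]) (rule that; assumption)
  have abs: "(\<lambda>t. f (\<gamma> t) * w t) absolutely_integrable_on {a..b}"
    if f: "almost_continuous_on (edge M e) f" for f
  proof -
    obtain g where g: "continuous_on (edge M e) g" "finite {x \<in> edge M e. f x \<noteq> g x}"
      using f unfolding almost_continuous_on_def by blast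
    have "finite {t \<in> {a..b}. f (\<gamma> t) \<noteq> g (\<gamma> t)}"
    proof (rule inj_on_finite)
      show "inj_on \<gamma> {t \<in> {a..b}. f (\<gamma> t) \<noteq> g (\<gamma> t)}"
        using par(3) by (rule inj_on_subset) blast
      show "\<gamma> ` {t \<in> {a..b}. f (\<gamma> t) \<noteq> g (\<gamma> t)} \<subseteq> {x \<in> edge M e. f x \<noteq> g x}"
        using par(4) by blast
    qed (rule g(2))
    then have neg: "negligible {t \<in> {a..b}. f (\<gamma> t) \<noteq> g (\<gamma> t)}"
      by (rule negligible_finite)
    have "continuous_on {a..b} (\<lambda>t. g (\<gamma> t) * w t)"
      using par by (intro continuous_intros continuous_on_compose2[OF g(1)]) auto
    then have "(\<lambda>t. g (\<gamma> t) * w t) absolutely_integrable_on {a..b}"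
      by (rule absolutely_integrable_continuous_real)
    then show ?thesis
      by (rule absolutely_integrable_spike[OF _ neg]) auto
  qed
  show thesis
    by (rule that[OF par(1-6)]) (simp_all add: par(7) set_lebesgue_integral_eq_integral[OF abs])
qed

lemma infinite_edge: "infinite (edge M e)"
proof -
  obtain a b :: real and \<gamma> w where "a < b" "inj_on \<gamma> {a..b}" "\<gamma> ` {a..b} = edge M e"
    by (rule edge_parametrization[of e]) (rule that; assumption)
  then show ?thesis
    using finite_imageD infinite_Icc by metis
qed

lemma edge_integral_cong:
  assumes g: "almost_continuous_on (edge M e) g" and fin: "finite {x \<in> edge M e. f x \<noteq> g x}"
  shows "edge_integral M (edge M e) f = edge_integral M (edge M e) g"
proof -
  obtain a b :: real and \<gamma> w where par: "inj_on \<gamma> {a..b}" "\<gamma> ` {a..b} = edge M e"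
    "\<And>f. almost_continuous_on (edge M e) f \<Longrightarrow>
       edge_integral M (edge M e) f = integral {a..b} (\<lambda>t. f (\<gamma> t) * w t)"
    by (rule edge_parametrization_integral[of e]) (rule that; assumption)
  have "finite {t \<in> {a..b}. f (\<gamma> t) \<noteq> g (\<gamma> t)}"
  proof (rule inj_on_finite)
    show "inj_on \<gamma> {t \<in> {a..b}. f (\<gamma> t) \<noteq> g (\<gamma> t)}"
      using par(1) by (rule inj_on_subset) blast
    show "\<gamma> ` {t \<in> {a..b}. f (\<gamma> t) \<noteq> g (\<gamma> t)} \<subseteq> {x \<in> edge M e. f x \<noteq> g x}"
      using par(2) by blast
  qed (rule fin)
  then have "integral {a..b} (\<lambda>t. g (\<gamma> t) * w t) = integral {a..b} (\<lambda>t. f (\<gamma> t) * w t)"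
    by (intro integral_spike[OF negligible_finite]) auto
  then show ?thesis
    using par(3) g almost_continuous_on_cong[OF g fin] by simp
qed

lemma edge_integral_cmult: "edge_integral M A (\<lambda>x. c * f x) = c * edge_integral M A f"
  unfolding edge_integral_def by (auto split: prod.split simp: mult.assoc)

lemma edge_integral_sum:
  assumes "finite I" "\<And>i. i \<in> I \<Longrightarrow> almost_continuous_on (edge M e) (f i)"
  shows "edge_integral M (edge M e) (\<lambda>x. \<Sum>i\<in>I. f i x) = (\<Sum>i\<in>I. edge_integral M (edge M e) (f i))"
proof -
  obtain a b :: real and \<gamma> w where par:
    "\<And>f. almost_continuous_on (edge M e) f \<Longrightarrow>
       (\<lambda>t. f (\<gamma> t) * w t) integrable_on {a..b}"
    "\<And>f. almost_continuous_on (edge M e) f \<Longrightarrow>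
       edge_integral M (edge M e) f = integral {a..b} (\<lambda>t. f (\<gamma> t) * w t)"
    by (rule edge_parametrization_integral[of e]) (rule that; assumption)
  have "edge_integral M (edge M e) (\<lambda>x. \<Sum>i\<in>I. f i x) =
      integral {a..b} (\<lambda>t. \<Sum>i\<in>I. f i (\<gamma> t) * w t)"
    using par[OF almost_continuous_on_sum[of I, OF assms(2)]] by (simp add: sum_distrib_right)
  also have "\<dots> = (\<Sum>i\<in>I. integral {a..b} (\<lambda>t. f i (\<gamma> t) * w t))"
    using assms par by (intro Henstock_Kurzweil_Integration.integral_sum) auto
  also have "\<dots> = (\<Sum>i\<in>I. edge_integral M (edge M e) (f i))"
    using assms(2) par by (intro sum.cong) auto
  finally show ?thesis .
qed

lemma edge_integral_nonneg:
  assumes f: "almost_continuous_on (edge M e) f" and nonneg: "\<And>x. x \<in> edge M e \<Longrightarrow> f x \<ge> 0"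
  shows "edge_integral M (edge M e) f \<ge> 0"
proof -
  obtain a b :: real and \<gamma> w where par:
    "\<gamma> ` {a..b} = edge M e" "\<And>t. t \<in> {a..b} \<Longrightarrow> w t > 0"
    "\<And>f. almost_continuous_on (edge M e) f \<Longrightarrow>
       (\<lambda>t. f (\<gamma> t) * w t) integrable_on {a..b}"
    "\<And>f. almost_continuous_on (edge M e) f \<Longrightarrow>
       edge_integral M (edge M e) f = integral {a..b} (\<lambda>t. f (\<gamma> t) * w t)"
    by (rule edge_parametrization_integral[of e]) (rule that; assumption)
  have "f (\<gamma> t) * w t \<ge> 0" if "t \<in> {a..b}" for t
    using nonneg[of "\<gamma> t"] imageI[OF that, of \<gamma>] par(1) par(2)[OF that]
    by (intro mult_nonneg_nonneg) (simp_all add: less_imp_le)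
  then have "integral {a..b} (\<lambda>t. f (\<gamma> t) * w t) \<ge> 0"
    using par f by (intro integral_nonneg) auto
  then show ?thesis
    using par(4) f by simp
qed

lemma edge_integral_zero:
  assumes f: "almost_continuous_on (edge M e) f" and nonneg: "\<And>x. x \<in> edge M e \<Longrightarrow> f x \<ge> 0"
    and zero: "edge_integral M (edge M e) f = 0"
  shows "finite {x \<in> edge M e. f x \<noteq> 0}"
proof -
  obtain g where g: "continuous_on (edge M e) g" "finite {x \<in> edge M e. f x \<noteq> g x}"
    using f unfolding almost_continuous_on_def by blast
  \<comment> \<open>As \<open>f\<close> is nonnegative, the absolute value of \<open>g\<close>
    agrees with \<open>f\<close> wherever \<open>g\<close> does. It is nonnegative everywhere, as
    the criterion for a vanishing integral of a continuous function requires.\<close>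
  have "{x \<in> edge M e. f x \<noteq> \<bar>g x\<bar>} \<subseteq> {x \<in> edge M e. f x \<noteq> g x}"
    using nonneg by fastforce
  then have fin: "finite {x \<in> edge M e. f x \<noteq> \<bar>g x\<bar>}"
    using g(2) by (rule finite_subset)
  have contg: "continuous_on (edge M e) (\<lambda>x. \<bar>g x\<bar>)"
    using g(1) by (intro continuous_intros)
  obtain a b :: real and \<gamma> w where par: "a < b" "continuous_on {a..b} \<gamma>"
    "\<gamma> ` {a..b} = edge M e" "continuous_on {a..b} w" "\<And>t. t \<in> {a..b} \<Longrightarrow> w t > 0"
    "\<And>f. almost_continuous_on (edge M e) f \<Longrightarrow>
       edge_integral M (edge M e) f = integral {a..b} (\<lambda>t. f (\<gamma> t) * w t)"
    by (rule edge_parametrization_integral[of e]) (rule that; assumption)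
  have "integral {a..b} (\<lambda>t. \<bar>g (\<gamma> t)\<bar> * w t) = 0"
    using zero edge_integral_cong[OF continuous_imp_almost_continuous_on[OF contg] fin]
      par(6)[OF continuous_imp_almost_continuous_on[OF contg]] by simp
  moreover have "continuous_on {a..b} (\<lambda>t. \<bar>g (\<gamma> t)\<bar> * w t)"
    using par by (intro continuous_intros continuous_on_compose2[OF g(1)]) auto
  ultimately have "\<forall>t\<in>{a..b}. \<bar>g (\<gamma> t)\<bar> * w t = 0"
    using par by (subst (asm) integral_eq_0_iff) (auto intro!: mult_nonneg_nonneg simp: less_imp_le)
  then have "g x = 0" if "x \<in> edge M e" for x
    using that par(3) par(5) by force
  then have "{x \<in> edge M e. f x \<noteq> 0} \<subseteq> {x \<in> edge M e. f x \<noteq> g x}"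
    by auto
  then show ?thesis
    using g(2) by (rule finite_subset)
qed

text \<open>Without a zero between the two nodes, \<open>f\<close> has a fixed sign there, so its
  absolute value is a constant multiple of \<open>f\<close> apart from the end points and also
  integrates to zero. Then \<open>f\<close> vanishes off a finite set, although the edge is
  infinite. Arguing with \<open>edge_integral\<close> as a whole avoids relating the given
  description of the edge to the one chosen in its definition.\<close>

lemma edge_integral_zero_imp_interior_zero:
  assumes e: "edge M e = small_edge M m k i j" "i \<le> deg M" "j < deg M"
    and f: "continuous_on (edge M e) f" and zero: "edge_integral M (edge M e) f = 0"
  obtains t where "gll M j < t" "t < gll M (Suc j)" "f (emap M m (line k (gll M i) t)) = 0"
proof (rule ccontr)
  assume "\<not> thesis"
  note no = this and zero_found = that
  let ?\<gamma> = "\<lambda>t. emap M m (line k (gll M i) t)" and ?I = "{gll M j<..<gll M (Suc j)}"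
  have nz: "f (?\<gamma> t) \<noteq> 0" if "t \<in> ?I" for t
    using no that zero_found[of t] by auto
  have "continuous_on {gll M j..gll M (Suc j)} ?\<gamma>"
    using continuous_on_emap_line[OF e(2)] gll_interval_subset[OF e(3)] by (rule continuous_on_subset)
  then have "continuous_on {gll M j..gll M (Suc j)} (\<lambda>t. f (?\<gamma> t))"
    by (rule continuous_on_compose2[OF f]) (auto simp: e(1) small_edge_def)
  then have "continuous_on ?I (\<lambda>t. f (?\<gamma> t))"
    by (rule continuous_on_subset) auto
  then have "(\<forall>t\<in>?I. f (?\<gamma> t) > 0) \<or> (\<forall>t\<in>?I. f (?\<gamma> t) < 0)"
    using nz by (intro connected_nonzero_sign) auto
  then obtain c :: real where c: "c \<noteq> 0" "\<forall>t\<in>?I. \<bar>f (?\<gamma> t)\<bar> = c * f (?\<gamma> t)"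
    by (metis abs_of_neg abs_of_pos mult_1 mult_minus1 neg_equal_0_iff_equal zero_neq_one)
  have "{x \<in> edge M e. \<bar>f x\<bar> \<noteq> c * f x} \<subseteq> {?\<gamma> (gll M j), ?\<gamma> (gll M (Suc j))}"
    using c(2) by (auto simp: e(1) small_edge_def order.order_iff_strict)
  then have "edge_integral M (edge M e) (\<lambda>x. \<bar>f x\<bar>) = edge_integral M (edge M e) (\<lambda>x. c * f x)"
    using f by (intro edge_integral_cong continuous_imp_almost_continuous_on continuous_intros)
      (auto intro: finite_subset)
  then have "finite {x \<in> edge M e. \<bar>f x\<bar> \<noteq> 0}"
    using f zero by (intro edge_integral_zero continuous_imp_almost_continuous_on continuous_intros)
      (auto simp: edge_integral_cmult)
  moreover have "{x \<in> edge M e. \<bar>f x\<bar> \<noteq> 0} \<union> {?\<gamma> (gll M j), ?\<gamma> (gll M (Suc j))} \<supseteq> edge M e"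
    using nz by (auto simp: e(1) small_edge_def order.order_iff_strict)
  ultimately show False
    using infinite_edge[of e] by (meson finite.simps finite_UnI finite_subset)
qed

section \<open>Flux degrees of freedom\<close>

lemma edge_nrm_props:
  shows continuous_on_edge_nrm: "continuous_on (edge M e) (edge_nrm M e)"
    and norm_edge_nrm: "x \<in> edge M e \<Longrightarrow> norm (edge_nrm M e x) = 1"
    and edge_nrm_orthogonal: "edge M e = small_edge M m k i j \<Longrightarrow> i \<le> deg M \<Longrightarrow> j < deg M \<Longrightarrow>
      t \<in> {gll M j..gll M (Suc j)} \<Longrightarrow>
      edge_nrm M e (emap M m (line k (gll M i) t)) \<bullet> (jac M m (line k (gll M i) t) *v axis k 1) = 0"
  using meshed unfolding meshed_domain_def by blast+

text \<open>The integrand of \<open>dof1\<close>. It differs from \<open>bd_normal_trace\<close> in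
  two choices: the element is picked per edge instead of per point, and the normal is the chosen one
  instead of the outward one.\<close>

definition flux :: "'e \<Rightarrow> (real^2 \<Rightarrow> real^2) \<Rightarrow> real^2 \<Rightarrow> real" where
  "flux e u x = elem_trace M (elem_of M (edge M e)) u x \<bullet> edge_nrm M e x"

lemma dof1_eq_flux: "dof1 M u $ e = edge_integral M (edge M e) (flux e u)"
  by (simp add: dof1_def flux_def[abs_def])

lemma continuous_on_flux: "u \<in> D_space M \<Longrightarrow> continuous_on (edge M e) (flux e u)"
  unfolding flux_def
  using continuous_on_elem_trace edge_subset_elem_of
  by (intro continuous_intros continuous_on_edge_nrm) (blast intro: continuous_on_subset)

lemma flux_sum:
  assumes "\<And>i. i \<in> I \<Longrightarrow> u i \<in> D_space M" "x \<in> edge M e"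
    and "\<And>m y. y \<in> elem_int M m \<Longrightarrow> v y = (\<Sum>i\<in>I. c i *\<^sub>R u i y)"
  shows "flux e v x = (\<Sum>i\<in>I. c i * flux e (u i) x)"
  unfolding flux_def
  using elem_trace_sum[OF assms(1) subsetD[OF edge_subset_elem_of assms(2)] assms(3)]
  by (simp add: inner_sum_left)

lemma dof1_sum:
  assumes "finite I" "\<And>i. i \<in> I \<Longrightarrow> u i \<in> D_space M"
    and "\<And>m y. y \<in> elem_int M m \<Longrightarrow> v y = (\<Sum>i\<in>I. c i *\<^sub>R u i y)"
  shows "dof1 M v = (\<Sum>i\<in>I. c i *\<^sub>R dof1 M (u i))"
proof -
  have "dof1 M v $ e = (\<Sum>i\<in>I. c i * dof1 M (u i) $ e)" for e
  proof -
    have ac: "almost_continuous_on (edge M e) (\<lambda>x. c i * flux e (u i) x)" if "i \<in> I" for i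
      using assms(2)[OF that] continuous_on_flux
      by (intro almost_continuous_on_cmult continuous_imp_almost_continuous_on)
    have "flux e v x = (\<Sum>i\<in>I. c i * flux e (u i) x)" if "x \<in> edge M e" for x
      using assms(2) that assms(3) by (rule flux_sum)
    then have "{x \<in> edge M e. flux e v x \<noteq> (\<Sum>i\<in>I. c i * flux e (u i) x)} = {}"
      by blast
    then have "finite {x \<in> edge M e. flux e v x \<noteq> (\<Sum>i\<in>I. c i * flux e (u i) x)}"
      by (simp only: finite.emptyI)
    then have "dof1 M v $ e = edge_integral M (edge M e) (\<lambda>x. \<Sum>i\<in>I. c i * flux e (u i) x)"
      unfolding dof1_eq_flux using ac
      by (intro edge_integral_cong almost_continuous_on_sum)
    then show ?thesis
      using edge_integral_sum[OF assms(1) ac] by (simp add: edge_integral_cmult dof1_eq_flux)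
  qed
  then show ?thesis
    by (simp add: vec_eq_iff)
qed

end

section \<open>Outward normals\<close>

text \<open>If the one-sided velocity \<open>v\<close> has a positive component along \<nu>, points
  of the curve arbitrarily near its start lie in a cone about \<nu>, which misses the closure; with
  a negative component they lie in the opposite cone, which is contained in the domain. The
  auxiliary fact \<open>dir\<close> serves both cases, with \<nu> and with its negative.\<close>

lemma outward_normal_tangent:
  fixes y :: "real \<Rightarrow> real^2"
  assumes y: "(y has_vector_derivative v) (at 0 within {0..\<delta>})" and \<delta>: "\<delta> > 0"
    and normal: "outward_unit_normal \<Omega> (y 0) \<nu>"
  shows outward_normal_tangent_le: "(\<And>h. h \<in> {0..\<delta>} \<Longrightarrow> y h \<in> closure \<Omega>) \<Longrightarrow> v \<bullet> \<nu> \<le> 0"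
    and outward_normal_tangent_ge: "(\<And>h. h \<in> {0..\<delta>} \<Longrightarrow> y h \<notin> \<Omega>) \<Longrightarrow> v \<bullet> \<nu> \<ge> 0"
proof -
  have at: "at 0 within {0..\<delta>} = at_right 0"
    using \<delta> by (rule at_within_Icc_at_right)
  have lim0: "((\<lambda>h. ((y h - y 0) - (h - 0) *\<^sub>R v) /\<^sub>R norm (h - 0)) \<longlongrightarrow> 0) (at_right 0)"
    using y unfolding has_vector_derivative_def has_derivative_at_within at by blast
  have "((\<lambda>h. ((y h - y 0) - (h - 0) *\<^sub>R v) /\<^sub>R norm (h - 0) + v) \<longlongrightarrow> 0 + v) (at_right 0)"
    by (intro tendsto_intros lim0)
  moreover have "\<forall>\<^sub>F h in at_right 0.
      ((y h - y 0) - (h - 0) *\<^sub>R v) /\<^sub>R norm (h - 0) + v = (1 / h) *\<^sub>R (y h - y 0)"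
    unfolding eventually_at_filter
    by (intro always_eventually) (auto simp: scaleR_diff_right divide_inverse)
  ultimately have lim: "((\<lambda>h. (1 / h) *\<^sub>R (y h - y 0)) \<longlongrightarrow> v) (at_right 0)"
    using Lim_transform_eventually by fastforce
  have cont: "(y \<longlongrightarrow> y 0) (at_right 0)"
    using has_vector_derivative_continuous[OF y] unfolding continuous_within at .
  have dir: "\<exists>\<epsilon>>0. \<forall>r>0. \<exists>h\<in>{0..\<delta>}. y h \<in> ball (y 0) r \<and> (y h - y 0) \<bullet> u > \<epsilon> * norm (y h - y 0)"
    if u: "v \<bullet> u > 0" for u
  proof (intro exI conjI allI impI)
    \<comment> \<open>Any positive \<epsilon> with
      \<open>\<epsilon> * norm v < v \<bullet> u\<close> works: the difference quotient tends to
      \<open>v\<close>, so it eventually inherits this strict inequality, and multiplying by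
      \<open>h\<close> gives the cone condition. The \<open>+ 1\<close> keeps the denominator
      positive.\<close>
    define \<epsilon> where "\<epsilon> = v \<bullet> u / (2 * (norm v + 1))"
    show "\<epsilon> > 0"
      using u by (simp add: \<epsilon>_def add_nonneg_pos)
    fix r :: real assume "r > 0"
    have "\<epsilon> * norm v = (v \<bullet> u) * (norm v / (2 * (norm v + 1)))"
      by (simp add: \<epsilon>_def)
    also have "\<dots> < (v \<bullet> u) * 1"
      using u by (intro mult_strict_left_mono) (simp_all add: pos_divide_less_eq add_nonneg_pos)
    finally have "v \<bullet> u - \<epsilon> * norm v > 0"
      by simp
    moreover have "((\<lambda>h. ((1 / h) *\<^sub>R (y h - y 0)) \<bullet> u - \<epsilon> * norm ((1 / h) *\<^sub>R (y h - y 0)))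
        \<longlongrightarrow> v \<bullet> u - \<epsilon> * norm v) (at_right 0)"
      by (intro tendsto_intros lim)
    ultimately have ev: "\<forall>\<^sub>F h in at_right 0.
        ((1 / h) *\<^sub>R (y h - y 0)) \<bullet> u - \<epsilon> * norm ((1 / h) *\<^sub>R (y h - y 0)) > 0"
      by (rule order_tendstoD(1)[rotated])
    have "\<forall>\<^sub>F h in at_right 0. dist (y h) (y 0) < r"
      using cont \<open>r > 0\<close> by (rule tendstoD)
    moreover have "\<forall>\<^sub>F h in at_right 0. h \<in> {0<..<\<delta>}"
      using \<delta> by (rule eventually_at_right_real)
    ultimately have "\<forall>\<^sub>F h in at_right 0.
        h \<in> {0..\<delta>} \<and> y h \<in> ball (y 0) r \<and> (y h - y 0) \<bullet> u > \<epsilon> * norm (y h - y 0)"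
      using ev
    proof eventually_elim
      case (elim h)
      have "norm ((1 / h) *\<^sub>R (y h - y 0)) = 1 / h * norm (y h - y 0)"
        using elim by (simp only: norm_scaleR) simp
      then have "(1 / h) * ((y h - y 0) \<bullet> u) - \<epsilon> * (1 / h * norm (y h - y 0)) > 0"
        using elim by (simp only: inner_scaleR_left)
      then have "(1 / h) * ((y h - y 0) \<bullet> u - \<epsilon> * norm (y h - y 0)) > 0"
        by (simp only: right_diff_distrib mult.left_commute)
      then have "(y h - y 0) \<bullet> u - \<epsilon> * norm (y h - y 0) > 0"
        using elim by (simp only: zero_less_mult_iff) auto
      then show ?case
        using elim by (auto simp: dist_commute)
    qed
    from eventually_happens'[OF trivial_limit_at_right_real this]
    show "\<exists>h\<in>{0..\<delta>}. y h \<in> ball (y 0) r \<and> (y h - y 0) \<bullet> u > \<epsilon> * norm (y h - y 0)"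
      by blast
  qed
  note nrm = normal[unfolded outward_unit_normal_def, THEN conjunct2, THEN conjunct2, rule_format]
  show "v \<bullet> \<nu> \<le> 0" if "\<And>h. h \<in> {0..\<delta>} \<Longrightarrow> y h \<in> closure \<Omega>"
  proof (rule ccontr)
    assume "\<not> v \<bullet> \<nu> \<le> 0"
    then obtain \<epsilon> where \<epsilon>: "\<epsilon> > 0"
      "\<And>r. r > 0 \<Longrightarrow> \<exists>h\<in>{0..\<delta>}. y h \<in> ball (y 0) r \<and> (y h - y 0) \<bullet> \<nu> > \<epsilon> * norm (y h - y 0)"
      using dir[of \<nu>] by (meson not_le)
    obtain r where "r > 0"
      "\<forall>z\<in>ball (y 0) r. (z - y 0) \<bullet> \<nu> > \<epsilon> * norm (z - y 0) \<longrightarrow> z \<notin> closure \<Omega>"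
      using nrm[OF \<epsilon>(1)] by blast
    then show False
      using \<epsilon>(2)[of r] that by blast
  qed
  show "v \<bullet> \<nu> \<ge> 0" if "\<And>h. h \<in> {0..\<delta>} \<Longrightarrow> y h \<notin> \<Omega>"
  proof (rule ccontr)
    assume "\<not> v \<bullet> \<nu> \<ge> 0"
    then have "v \<bullet> (- \<nu>) > 0"
      by simp
    then obtain \<epsilon> where \<epsilon>: "\<epsilon> > 0"
      "\<And>r. r > 0 \<Longrightarrow> \<exists>h\<in>{0..\<delta>}. y h \<in> ball (y 0) r \<and> (y h - y 0) \<bullet> (- \<nu>) > \<epsilon> * norm (y h - y 0)"
      using dir[of "- \<nu>"] by meson
    obtain r where r: "r > 0"
      "\<forall>z\<in>ball (y 0) r. (z - y 0) \<bullet> \<nu> < - \<epsilon> * norm (z - y 0) \<longrightarrow> z \<in> \<Omega>"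
      using nrm[OF \<epsilon>(1)] by blast
    obtain h where h: "h \<in> {0..\<delta>}" "y h \<in> ball (y 0) r"
      "(y h - y 0) \<bullet> (- \<nu>) > \<epsilon> * norm (y h - y 0)"
      using \<epsilon>(2)[OF r(1)] by blast
    from h(3) have "(y h - y 0) \<bullet> \<nu> < - \<epsilon> * norm (y h - y 0)"
      by simp
    then show False
      using r(2) h that by blast
  qed
qed

lemma unit_orthogonal_unique:
  fixes a n \<nu> :: "real^2"
  assumes "a \<noteq> 0" "n \<bullet> a = 0" "\<nu> \<bullet> a = 0" "norm n = 1" "norm \<nu> = 1"
  shows "\<nu> = n \<or> \<nu> = - n"
proof -
  have n: "n $ 1 * a $ 1 + n $ 2 * a $ 2 = 0" and \<nu>: "\<nu> $ 1 * a $ 1 + \<nu> $ 2 * a $ 2 = 0"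
    using assms(2,3) by (simp_all add: inner_vec_def sum_2)
  have "n \<bullet> n = 1" "\<nu> \<bullet> \<nu> = 1"
    using assms(4,5) by (simp_all add: dot_square_norm)
  then have n1: "n $ 1 * n $ 1 + n $ 2 * n $ 2 = 1" and \<nu>1: "\<nu> $ 1 * \<nu> $ 1 + \<nu> $ 2 * \<nu> $ 2 = 1"
    by (simp_all add: inner_vec_def sum_2)
  \<comment> \<open>The bracket is the planar cross product of \<nu> and \<open>n\<close>. Both are
    orthogonal to \<open>a\<close>, so it vanishes, and their inner product \<open>c\<close> is then
    the factor between them.\<close>
  have "a $ 1 * (\<nu> $ 1 * n $ 2 - \<nu> $ 2 * n $ 1) = 0" "a $ 2 * (\<nu> $ 1 * n $ 2 - \<nu> $ 2 * n $ 1) = 0"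
    using n \<nu> by algebra+
  moreover have "a $ 1 \<noteq> 0 \<or> a $ 2 \<noteq> 0"
    using assms(1) by (auto simp: vec_eq_iff forall_2)
  ultimately have D: "\<nu> $ 1 * n $ 2 - \<nu> $ 2 * n $ 1 = 0"
    by (metis mult_eq_0_iff)
  define c where "c = \<nu> $ 1 * n $ 1 + \<nu> $ 2 * n $ 2"
  have "\<nu> $ 1 = c * n $ 1" "\<nu> $ 2 = c * n $ 2" "c * c = 1"
    unfolding c_def using n1 D \<nu>1 by algebra+
  then show ?thesis
    by (auto simp: vec_eq_iff forall_2 square_eq_1_iff)
qed

lemma vec2_decompose:
  fixes v :: "real^2"
  assumes "l \<noteq> k"
  shows "v = (v $ k) *\<^sub>R axis k 1 + (v $ l) *\<^sub>R axis l 1"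
  using assms exhaust_2[of k] exhaust_2[of l] by (auto simp: vec_eq_iff forall_2 axis_def)

section \<open>The outward normal along a boundary edge\<close>

context gll_meshed_domain
begin

text \<open>The two columns of the invertible Jacobian matrix span the plane.\<close>

lemma jac_range_orthogonal:
  assumes "x \<in> refK" "l \<noteq> k" "n \<bullet> (jac M m x *v axis k 1) = 0" "n \<bullet> (jac M m x *v axis l 1) = 0"
  shows "n = 0"
proof -
  have "invertible (jac M m x)"
    using det_jac_pos[OF assms(1), of m] by (simp add: invertible_det_nz)
  then have "surj (\<lambda>v. jac M m x *v v)"
    using invertible_right_inverse matrix_right_invertible_surjective by blast
  then obtain v where v: "n = jac M m x *v v"
    by (metis surjD)
  have "jac M m x *v v = (v $ k) *\<^sub>R (jac M m x *v axis k 1) + (v $ l) *\<^sub>R (jac M m x *v axis l 1)"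
    by (subst vec2_decompose[OF assms(2), of v])
      (simp add: matrix_vector_right_distrib matrix_vector_mult_scaleR)
  then have "n \<bullet> (jac M m x *v v) = 0"
    by (simp add: inner_add_right assms(3,4))
  then have "n \<bullet> n = 0"
    by (simp only: v[symmetric])
  then show ?thesis
    by simp
qed

text \<open>The element map is differentiable within the square only, so the ray has to stay inside
  for the chain rule to give a one-sided derivative.\<close>

lemma emap_ray_has_vector_derivative:
  assumes "\<And>h. h \<in> {0..\<delta>} \<Longrightarrow> p + h *\<^sub>R d \<in> refK" "\<delta> > 0"
  shows "((\<lambda>h. emap M m (p + h *\<^sub>R d)) has_vector_derivative (jac M m p *v d)) (at 0 within {0..\<delta>})"
proof -
  have p: "p \<in> refK"
    using assms(1)[of 0] assms(2) by simp
  have ray: "((\<lambda>h. p + h *\<^sub>R d) has_vector_derivative d) (at 0 within {0..\<delta>})"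
    unfolding has_vector_derivative_def by (rule derivative_eq_intros refl | simp)+
  have "(emap M m has_derivative (\<lambda>h. jac M m p *v h))
      (at p within (\<lambda>h. p + h *\<^sub>R d) ` {0..\<delta>})"
    using assms(1) by (intro has_derivative_subset[OF emap_has_derivative[OF p]]) blast
  then show ?thesis
    using vector_derivative_diff_chain_within[OF ray, of "emap M m"] by (simp add: o_def)
qed

lemma line_add_tangent: "line k s t + h *\<^sub>R axis k 1 = line k s (t + h)"
  by (simp add: vec_eq_iff line_def axis_def)

lemma line_add_normal: "l \<noteq> k \<Longrightarrow> line k s t + h *\<^sub>R axis l 1 = line k (s + h) t"
  using exhaust_2[of k] exhaust_2[of l] by (auto simp: vec_eq_iff forall_2 line_def axis_def)

lemma outward_normal_nrm: "x \<in> frontier (dmn M) \<Longrightarrow> x \<notin> elem_verts M \<Longrightarrow> outward_unit_normal (dmn M) x (nrm M x)"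
  using meshed by (auto simp: meshed_domain_def)

lemma frontier_disjoint_dmn: "x \<in> frontier (dmn M) \<Longrightarrow> x \<notin> dmn M"
  using open_dmn by (simp add: frontier_def interior_open)

text \<open>Moving along the edge keeps the point on the frontier, which lies in the closure and
  misses the open domain. Both one-sided estimates therefore apply to the same direction and force
  the inner product to vanish.\<close>

lemma nrm_orthogonal_tangent:
  assumes bd: "small_edge M m k i j \<subseteq> frontier (dmn M)" and ij: "i \<le> deg M" "j < deg M"
    and t: "t \<in> {gll M j..gll M (Suc j)}" and nv: "emap M m (line k (gll M i) t) \<notin> elem_verts M"
  shows "nrm M (emap M m (line k (gll M i) t)) \<bullet> (jac M m (line k (gll M i) t) *v axis k 1) = 0"
proof -
  let ?p = "line k (gll M i) t" and ?\<nu> = "nrm M (emap M m (line k (gll M i) t))"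
  have front: "emap M m (line k (gll M i) t') \<in> frontier (dmn M)"
    if "t' \<in> {gll M j..gll M (Suc j)}" for t'
    using bd that unfolding small_edge_def by blast
  have len: "gll M j < gll M (Suc j)"
    using ij by (intro gll_less) auto
  have normal: "outward_unit_normal (dmn M) (emap M m ?p) ?\<nu>"
    using front[OF t] nv by (rule outward_normal_nrm)
  \<comment> \<open>At the right end of the small edge the direction is reversed, so that the ray
    remains on the edge for a while in every case.\<close>
  obtain \<sigma> \<delta> :: real where \<sigma>: "\<sigma> \<noteq> 0" "\<delta> > 0"
    "\<And>h. h \<in> {0..\<delta>} \<Longrightarrow> t + h * \<sigma> \<in> {gll M j..gll M (Suc j)}"
  proof (cases "t < gll M (Suc j)")
    case True
    then show thesis
      using t by (intro that[of 1 "gll M (Suc j) - t"]) auto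
  next
    case False
    then show thesis
      using t len by (intro that[of "-1" "t - gll M j"]) auto
  qed
  let ?d = "\<sigma> *\<^sub>R axis k 1 :: real^2"
  have ray: "?p + h *\<^sub>R ?d = line k (gll M i) (t + h * \<sigma>)" for h
    using line_add_tangent[of k "gll M i" t "h * \<sigma>"] by simp
  have "?p + h *\<^sub>R ?d \<in> refK" if "h \<in> {0..\<delta>}" for h
    unfolding ray using \<sigma>(3)[OF that] gll_interval_subset[OF ij(2)] ij(1)
    by (intro line_in_refK) auto
  then have deriv: "((\<lambda>h. emap M m (?p + h *\<^sub>R ?d)) has_vector_derivative (jac M m ?p *v ?d))
      (at 0 within {0..\<delta>})"
    using \<sigma>(2) by (rule emap_ray_has_vector_derivative)
  have fr: "emap M m (?p + h *\<^sub>R ?d) \<in> frontier (dmn M)" if "h \<in> {0..\<delta>}" for h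
    unfolding ray using \<sigma>(3)[OF that] by (rule front)
  have "(jac M m ?p *v ?d) \<bullet> ?\<nu> \<le> 0"
    by (rule outward_normal_tangent_le[OF deriv \<sigma>(2)])
      (use normal fr in \<open>auto simp: frontier_def\<close>)
  moreover have "(jac M m ?p *v ?d) \<bullet> ?\<nu> \<ge> 0"
    by (rule outward_normal_tangent_ge[OF deriv \<sigma>(2)])
      (use normal fr frontier_disjoint_dmn in auto)
  ultimately have "\<sigma> * ((jac M m ?p *v axis k 1) \<bullet> ?\<nu>) = 0"
    by (simp add: matrix_vector_mult_scaleR)
  then show ?thesis
    using \<sigma>(1) by (simp add: inner_commute)
qed

text \<open>The direction \<open>\<sigma> *\<^sub>R axis l 1\<close> points into the reference square along the whole edge, so its
  image lies on the side of the edge opposite to the outward normal.\<close>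

lemma nrm_inward:
  assumes bd: "small_edge M m k i j \<subseteq> frontier (dmn M)" and ij: "i \<le> deg M" "j < deg M"
    and t: "t \<in> {gll M j..gll M (Suc j)}" and nv: "emap M m (line k (gll M i) t) \<notin> elem_verts M"
    and l: "l \<noteq> k" and \<sigma>: "\<sigma> = (if gll M i < 1 then 1 else -1)"
  shows "nrm M (emap M m (line k (gll M i) t)) \<bullet> (jac M m (line k (gll M i) t) *v (\<sigma> *\<^sub>R axis l 1)) \<le> 0"
proof -
  let ?p = "line k (gll M i) t" and ?\<nu> = "nrm M (emap M m (line k (gll M i) t))"
    and ?d = "\<sigma> *\<^sub>R axis l 1 :: real^2"
  have "emap M m ?p \<in> frontier (dmn M)"
    using bd t unfolding small_edge_def by blast
  then have normal: "outward_unit_normal (dmn M) (emap M m ?p) ?\<nu>"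
    using nv by (rule outward_normal_nrm)
  obtain \<delta> :: real where \<delta>: "\<delta> > 0" "\<And>h. h \<in> {0..\<delta>} \<Longrightarrow> gll M i + h * \<sigma> \<in> {-1..1}"
  proof (cases "gll M i < 1")
    case True
    then show thesis
      using gll_bounds[OF ij(1)] \<sigma> by (intro that[of "1 - gll M i"]) auto
  next
    case False
    then show thesis
      using gll_bounds[OF ij(1)] \<sigma> by (intro that[of 1]) auto
  qed
  have ray: "?p + h *\<^sub>R ?d = line k (gll M i + h * \<sigma>) t" for h
    using line_add_normal[OF l, of "gll M i" t "h * \<sigma>"] by simp
  have ref: "?p + h *\<^sub>R ?d \<in> refK" if "h \<in> {0..\<delta>}" for h
    unfolding ray line_in_refK_iff using \<delta>(2)[OF that] t gll_interval_subset[OF ij(2)] by auto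
  have cl: "emap M m (?p + h *\<^sub>R ?d) \<in> closure (dmn M)" if "h \<in> {0..\<delta>}" for h
    using ref[OF that] elem_subset_closure[of m] unfolding elem_def by blast
  have "(jac M m ?p *v ?d) \<bullet> ?\<nu> \<le> 0"
    by (rule outward_normal_tangent_le[OF emap_ray_has_vector_derivative[OF ref \<delta>(1)] \<delta>(1)])
      (use normal cl in simp_all)
  then show ?thesis
    by (simp add: inner_commute)
qed

lemma bedge_subset_frontier: "edge M (bedge M b) \<subseteq> frontier (dmn M)"
  using meshed unfolding meshed_domain_def bij_betw_def by blast

lemma frontier_edge_bedge: "edge M e \<subseteq> frontier (dmn M) \<Longrightarrow> e \<in> range (bedge M)"
  using meshed unfolding meshed_domain_def bij_betw_def by blast

lemma bedge_inj: "bedge M a = bedge M b \<longleftrightarrow> a = b"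
  using meshed unfolding meshed_domain_def bij_betw_def by (metis injD)

lemma continuous_on_jac_line:
  assumes "i \<le> deg M" "j < deg M"
  shows "continuous_on {gll M j..gll M (Suc j)} (\<lambda>t. jac M m (line k (gll M i) t) *v d)"
proof -
  have "continuous_on {-1..1} (\<lambda>t. jac M m (line k (gll M i) t))"
    by (rule continuous_on_compose2[OF continuous_on_jac])
      (auto intro!: continuous_intros line_in_refK assms)
  then show ?thesis
    using gll_interval_subset[OF assms(2)]
    by (intro continuous_on_matrix_vector_mult continuous_on_const) (rule continuous_on_subset)
qed

lemma incl1_bedge: "incl1 M $ e $ b = (if e = bedge M b then incl1 M $ bedge M b $ b else 0)"
  by (simp add: incl1_def)

lemma incl1_square: "incl1 M $ bedge M b $ b * incl1 M $ bedge M b $ b = 1"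
  by (simp add: incl1_def)

text \<open>\<open>incl1\<close> separates "equal all along the edge" from everything else, so
  everything else must be shown to mean "opposite all along the edge". Both unit normals are
  orthogonal to the same tangent, hence equal up to a sign, and the function \<open>q\<close>, which
  cannot change sign, decides which.\<close>

lemma nrm_eq_incl1_edge_nrm:
  assumes x: "x \<in> edge M (bedge M b)" "x \<notin> elem_verts M"
  shows "nrm M x = (incl1 M $ bedge M b $ b) *\<^sub>R edge_nrm M (bedge M b) x"
proof -
  define e where "e = bedge M b"
  obtain m k i j where ij: "i \<le> deg M" "j < deg M" and e: "edge M e = small_edge M m k i j"
    by (rule edge_obtain_small_edge)
  obtain l where l: "l \<noteq> k"
    using other_index by metis
  let ?p = "\<lambda>t. line k (gll M i) t" and ?I = "{gll M j..gll M (Suc j)}"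
  define \<sigma> :: real where "\<sigma> = (if gll M i < 1 then 1 else -1)"
  \<comment> \<open>The chosen normal tested against the image of the inward direction. A zero would
    make it orthogonal to both columns of the Jacobian matrix; by \<open>nrm_inward\<close>,
    negative values mean that the chosen normal points outward.\<close>
  define q where
    "q t = edge_nrm M e (emap M m (?p t)) \<bullet> (jac M m (?p t) *v (\<sigma> *\<^sub>R axis l 1))" for t
  have \<sigma>: "\<sigma> \<noteq> 0"
    by (simp add: \<sigma>_def)
  have bd: "small_edge M m k i j \<subseteq> frontier (dmn M)"
    using bedge_subset_frontier[of b] e by (simp add: e_def)
  have in_edge: "emap M m (?p t) \<in> edge M e" if "t \<in> ?I" for t
    using that by (simp add: e small_edge_def)
  have ref: "?p t \<in> refK" if "t \<in> ?I" for t
    using that gll_interval_subset[OF ij(2)] ij(1) by (intro line_in_refK) auto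
  have "continuous_on ?I (\<lambda>t. emap M m (?p t))"
    using continuous_on_emap_line[OF ij(1)] gll_interval_subset[OF ij(2)] by (rule continuous_on_subset)
  then have "continuous_on ?I (\<lambda>t. edge_nrm M e (emap M m (?p t)))"
    by (rule continuous_on_compose2[OF continuous_on_edge_nrm]) (use in_edge in blast)
  then have "continuous_on ?I q"
    unfolding q_def by (intro continuous_on_inner continuous_on_jac_line ij)
  moreover have "q t \<noteq> 0" if t: "t \<in> ?I" for t
  proof
    assume "q t = 0"
    then have "edge_nrm M e (emap M m (?p t)) \<bullet> (jac M m (?p t) *v axis l 1) = 0"
      using \<sigma> by (simp add: q_def matrix_vector_mult_scaleR)
    then have "edge_nrm M e (emap M m (?p t)) = 0"
      by (rule jac_range_orthogonal[OF ref[OF t] l edge_nrm_orthogonal[OF e ij t]])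
    then show False
      using norm_edge_nrm[OF in_edge[OF t]] by simp
  qed
  ultimately have sign: "(\<forall>t\<in>?I. q t > 0) \<or> (\<forall>t\<in>?I. q t < 0)"
    by (intro connected_nonzero_sign) auto
  have pm: "nrm M y = (if \<forall>t\<in>?I. q t < 0 then edge_nrm M e y else - edge_nrm M e y)"
    if y: "y \<in> edge M e - elem_verts M" for y
  proof -
    obtain t where t: "t \<in> ?I" "y = emap M m (?p t)"
      using y by (auto simp: e small_edge_def)
    have nv: "emap M m (?p t) \<notin> elem_verts M"
      using y t by simp
    have "norm (nrm M y) = 1"
      using outward_normal_nrm[of y] y bedge_subset_frontier[of b]
      by (auto simp: e_def outward_unit_normal_def)
    then have "nrm M y = edge_nrm M e y \<or> nrm M y = - edge_nrm M e y"
      using unit_orthogonal_unique[OF jac_axis_nonzero[OF ref[OF t(1)]]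
          edge_nrm_orthogonal[OF e ij t(1)] nrm_orthogonal_tangent[OF bd ij t(1) nv]
          norm_edge_nrm[OF in_edge[OF t(1)]]] t(2) by simp
    moreover have "nrm M y \<bullet> (jac M m (?p t) *v (\<sigma> *\<^sub>R axis l 1)) \<le> 0"
      using nrm_inward[OF bd ij t(1) nv l \<sigma>_def] t(2) by simp
    moreover have "edge_nrm M e y \<bullet> (jac M m (?p t) *v (\<sigma> *\<^sub>R axis l 1)) = q t"
      by (simp add: q_def t(2))
    ultimately have "nrm M y = edge_nrm M e y \<and> q t \<le> 0 \<or> nrm M y = - edge_nrm M e y \<and> q t \<ge> 0"
      by auto
    then show ?thesis
      using sign t(1) by (meson linorder_not_le)
  qed
  \<comment> \<open>A point off the vertices keeps the condition in \<open>incl1\<close> from being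
    vacuously true.\<close>
  have "infinite (edge M e - elem_verts M)"
    using infinite_edge finite_elem_verts by (rule Diff_infinite_finite[rotated])
  then obtain y where y: "y \<in> edge M e - elem_verts M"
    by (metis ex_in_conv finite.emptyI)
  have "edge_nrm M e y \<noteq> 0"
    using norm_edge_nrm[of y e] y by auto
  then have "edge_nrm M e y \<noteq> - edge_nrm M e y"
    unfolding vec_eq_iff by auto
  then have "(\<forall>x\<in>edge M e - elem_verts M. edge_nrm M e x = nrm M x) \<longleftrightarrow> (\<forall>t\<in>?I. q t < 0)"
    using pm y by (cases "\<forall>t\<in>?I. q t < 0") auto
  then have "incl1 M $ e $ b = (if \<forall>t\<in>?I. q t < 0 then 1 else -1)"
    by (simp add: incl1_def e_def)
  then show ?thesis
    using pm[of x] x by (simp add: e_def)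
qed

section \<open>Traces on the boundary\<close>

text \<open>For a parameter strictly between -1 and 1 the point is not a corner, so conformity makes
  any second element through it share a whole side there, and normal continuity applies.\<close>

lemma normal_trace_unique:
  assumes u: "u \<in> D_space M" and i: "i \<le> deg M" and t: "-1 < t" "t < 1"
    and x: "emap M m (line k (gll M i) t) \<in> elem M m'"
    and \<nu>: "\<nu> \<bullet> (jac M m (line k (gll M i) t) *v axis k 1) = 0"
  shows "elem_trace M m' u (emap M m (line k (gll M i) t)) \<bullet> \<nu> =
    elem_trace M m u (emap M m (line k (gll M i) t)) \<bullet> \<nu>"
proof (cases "m' = m")
  case False
  let ?p = "line k (gll M i) t"
  have p: "?p \<in> refK"
    using i t by (intro line_in_refK) auto
  have "?p \<notin> corners"
    using t by (auto simp: corners_def intro!: exI[of _ k])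
  moreover obtain p' where p': "p' \<in> refK" "emap M m ?p = emap M m' p'"
    using x by (auto simp: elem_def)
  moreover have "conforming M"
    using partition by (simp add: partition_of_domain_def)
  ultimately obtain k0 s k' s' \<tau> t0 where cs: "t0 \<in> {-1..1}" "common_side M m k0 s m' k' s' \<tau>"
    "?p = line k0 s t0"
    using False p unfolding conforming_def by metis
  \<comment> \<open>A shared side running in the other direction would have \<open>t\<close> as its
    fixed coordinate, which is -1 or 1.\<close>
  have "k0 = k"
  proof (rule ccontr)
    assume "k0 \<noteq> k"
    then have "t = s"
      using cs(3) by (metis line_same line_other)
    then show False
      using cs(2) t by (auto simp: common_side_def)
  qed
  then have "\<nu> \<bullet> (jac M m (line k0 s t0) *v axis k0 1) = 0"
    using \<nu> cs(3) by simp
  moreover have "normal_continuous M u"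
    using u by (simp add: D_space_def)
  ultimately have "elem_trace M m u (emap M m (line k0 s t0)) \<bullet> \<nu> =
      elem_trace M m' u (emap M m (line k0 s t0)) \<bullet> \<nu>"
    using cs(1,2) unfolding normal_continuous_def by blast
  then show ?thesis
    using cs(3) by simp
qed simp

text \<open>Off the vertices of elements and the end points of the edge,
  \<open>normal_trace_unique\<close> moves both traces to one element, and
  \<open>nrm_eq_incl1_edge_nrm\<close> relates the two normals.\<close>

lemma bd_normal_trace_eq_flux:
  assumes u: "u \<in> D_space M"
  shows "finite {x \<in> edge M (bedge M b). bd_normal_trace M u x \<noteq>
    (incl1 M $ bedge M b $ b) * flux (bedge M b) u x}"
proof -
  define e where "e = bedge M b"
  obtain m k i j where ij: "i \<le> deg M" "j < deg M" and e: "edge M e = small_edge M m k i j"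
    by (rule edge_obtain_small_edge)
  let ?p = "\<lambda>t. line k (gll M i) t"
  let ?V = "elem_verts M \<union> {emap M m (?p (gll M j)), emap M m (?p (gll M (Suc j)))}"
  have bd: "small_edge M m k i j \<subseteq> frontier (dmn M)"
    using bedge_subset_frontier[of b] e by (simp add: e_def)
  have "bd_normal_trace M u x = (incl1 M $ e $ b) * flux e u x" if x: "x \<in> edge M e" "x \<notin> ?V" for x
  proof -
    obtain t where t: "t \<in> {gll M j..gll M (Suc j)}" "x = emap M m (?p t)"
      using x by (auto simp: e small_edge_def)
    have "t \<noteq> gll M j" "t \<noteq> gll M (Suc j)"
      using x(2) t(2) by auto
    then have t1: "-1 < t" "t < 1"
      using t(1) gll_interior[OF ij(2), of t] by auto
    have xm: "x \<in> elem M m"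
      using x(1) small_edge_subset_elem[OF ij] by (auto simp: e)
    have "{x} \<subseteq> elem M (elem_of M {x})"
      unfolding elem_of_def by (rule someI[of _ m]) (use xm in simp)
    then have "elem_trace M (elem_of M {x}) u x \<bullet> nrm M x = elem_trace M m u x \<bullet> nrm M x"
      using normal_trace_unique[OF u ij(1) t1, of m k _ "nrm M x"]
        nrm_orthogonal_tangent[OF bd ij t(1)] t(2) x(2) by simp
    moreover have "elem_trace M (elem_of M (edge M e)) u x \<bullet> edge_nrm M e x =
        elem_trace M m u x \<bullet> edge_nrm M e x"
      using normal_trace_unique[OF u ij(1) t1, of m k _ "edge_nrm M e x"] x(1) t(2)
        edge_nrm_orthogonal[OF e ij t(1)] edge_subset_elem_of[of e] by auto
    ultimately show ?thesis
      using nrm_eq_incl1_edge_nrm[of x b] x by (simp add: bd_normal_trace_def flux_def e_def)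
  qed
  then have "{x \<in> edge M e. bd_normal_trace M u x \<noteq> (incl1 M $ e $ b) * flux e u x} \<subseteq> ?V"
    by blast
  moreover have "finite ?V"
    by (simp add: finite_elem_verts)
  ultimately show ?thesis
    unfolding e_def by (rule finite_subset)
qed


section \<open>Sides of elements in the boundary\<close>

text \<open>The outward normal keeps a generic point of the edge out of the open element: otherwise
  a short segment along \<nu> would stay in the closure, giving \<nu> \<bullet> \<nu> \<le> 0. So
  the edge lies on a side of the element, which is either contained in the frontier or, apart from
  vertices, in the open domain; the same generic point rules out the latter.\<close>

lemma boundary_small_edge_on_side:
  assumes bd: "small_edge M m k i j \<subseteq> frontier (dmn M)" and ij: "i \<le> deg M" "j < deg M"
  shows "emap M m ` line k (gll M i) ` {-1..1} \<subseteq> frontier (dmn M)"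
proof -
  let ?p = "\<lambda>t. line k (gll M i) t"
  let ?V = "elem_verts M \<union> {emap M m (?p (gll M j)), emap M m (?p (gll M (Suc j)))}"
  have "infinite (small_edge M m k i j)"
    using small_edge_obtain_edge[OF ij] infinite_edge by metis
  moreover have "finite ?V"
    by (simp add: finite_elem_verts)
  ultimately have "infinite (small_edge M m k i j - ?V)"
    by (rule Diff_infinite_finite[rotated])
  then obtain x where x: "x \<in> small_edge M m k i j" "x \<notin> ?V"
    by (metis DiffE ex_in_conv finite.emptyI)
  then obtain t where t: "t \<in> {gll M j..gll M (Suc j)}" "x = emap M m (?p t)"
    by (auto simp: small_edge_def)
  have "t \<noteq> gll M j" "t \<noteq> gll M (Suc j)"
    using x(2) t(2) by auto
  then have t1: "-1 < t" "t < 1"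
    using t(1) gll_interior[OF ij(2), of t] by auto
  have front: "x \<in> frontier (dmn M)"
    using x(1) bd by blast
  have normal: "outward_unit_normal (dmn M) x (nrm M x)"
    using front x(2) by (intro outward_normal_nrm) auto
  have "gll M i \<in> {-1, 1}"
  proof (rule ccontr)
    assume "gll M i \<notin> {-1, 1}"
    then have "-1 < gll M i" "gll M i < 1"
      using gll_bounds[OF ij(1)] by auto
    then have "?p t \<in> interior refK"
      using t1 by (auto simp: interior_refK line_def)
    then have "x \<in> elem_int M m"
      by (simp add: t(2) elem_int_def)
    then obtain \<delta> where \<delta>: "\<delta> > 0" "cball x \<delta> \<subseteq> elem_int M m"
      using open_elem_int open_contains_cball by metis
    have "norm (nrm M x) = 1"
      using normal by (simp add: outward_unit_normal_def)
    then have "x + h *\<^sub>R nrm M x \<in> closure (dmn M)" if "h \<in> {0..\<delta>}" for h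
      using that \<delta>(2) elem_int_subset[of m] elem_subset_closure[of m]
      by (auto simp: subset_iff dist_norm)
    moreover have "((\<lambda>h. x + h *\<^sub>R nrm M x) has_vector_derivative nrm M x) (at 0 within {0..\<delta>})"
      unfolding has_vector_derivative_def by (rule derivative_eq_intros refl | simp)+
    ultimately have "nrm M x \<bullet> nrm M x \<le> 0"
      using outward_normal_tangent_le[of "\<lambda>h. x + h *\<^sub>R nrm M x" "nrm M x" \<delta> "dmn M" "nrm M x"]
        \<delta>(1) normal by simp
    then show False
      using \<open>norm (nrm M x) = 1\<close> by (simp add: dot_square_norm)
  qed
  then have "emap M m ` ?p ` {-1..1} \<in> elem_sides M"
    unfolding elem_sides_def mem_Collect_eq by (intro exI[of _ m] exI[of _ k] exI[of _ "gll M i"] conjI refl)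
  moreover have "\<forall>A\<in>elem_sides M. A \<subseteq> frontier (dmn M) \<or> A - elem_verts M \<subseteq> dmn M"
    using partition by (simp add: partition_of_domain_def)
  ultimately have "emap M m ` ?p ` {-1..1} \<subseteq> frontier (dmn M) \<or>
      emap M m ` ?p ` {-1..1} - elem_verts M \<subseteq> dmn M"
    by (rule bspec[rotated])
  moreover have "x \<in> emap M m ` ?p ` {-1..1} - elem_verts M"
    using t x(2) gll_interval_subset[OF ij(2)] by auto
  ultimately show ?thesis
    using frontier_disjoint_dmn[OF front] by blast
qed

lemma boundary_side_small_edge:
  assumes "emap M m ` line k (gll M i) ` {-1..1} \<subseteq> frontier (dmn M)" "i \<le> deg M" "j < deg M"
  obtains b where "edge M (bedge M b) = small_edge M m k i j"
proof -
  obtain e where e: "edge M e = small_edge M m k i j"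
    using assms(2,3) by (rule small_edge_obtain_edge)
  have "line k (gll M i) ` {gll M j..gll M (Suc j)} \<subseteq> line k (gll M i) ` {-1..1}"
    using gll_interval_subset[OF assms(3)] by (rule image_mono)
  then have "edge M e \<subseteq> frontier (dmn M)"
    using assms(1) unfolding e small_edge_def by (meson image_mono order_trans)
  then show thesis
    using frontier_edge_bedge[of e] e that by auto
qed

text \<open>All boundary fluxes are assumed to vanish although one edge is concerned, since only the
  \<open>deg M\<close> small edges of the whole side together supply enough zeros.\<close>

lemma boundary_flux_zero:
  assumes u: "u \<in> D_space M" and zero: "\<And>b. dof1 M u $ bedge M b = 0"
  shows "finite {x \<in> edge M (bedge M b). flux (bedge M b) u x \<noteq> 0}"
proof -
  define e where "e = bedge M b"
  obtain m k i j where ij: "i \<le> deg M" "j < deg M" and e: "edge M e = small_edge M m k i j"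
    by (rule edge_obtain_small_edge)
  let ?p = "\<lambda>t. line k (gll M i) t"
  obtain l where l: "l \<noteq> k"
    using other_index by metis
  obtain u' where u': "u' \<in> D_ref (deg M)" "\<And>x. x \<in> refK \<Longrightarrow>
      elem_trace M m u (emap M m x) = (1 / det (jac M m x)) *\<^sub>R (jac M m x *v u' x)"
    using D_space_trace_rep[OF u] by metis
  obtain P where P: "degree P \<le> deg M - 1" "\<And>t. u' (?p t) $ l = poly P t"
    using D_ref_component[OF u'(1) l] by metis
  \<comment> \<open>In the Piola image of \<open>u'\<close> the part along the edge is orthogonal to
    the edge normal. The other part carries \<open>P\<close>, with a factor that is nonzero because
    the columns of the Jacobian matrix span the plane.\<close>
  have flux_rep: "flux e' u (emap M m (?p t)) = poly P t / det (jac M m (?p t)) *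
      ((jac M m (?p t) *v axis l 1) \<bullet> edge_nrm M e' (emap M m (?p t)))"
    if e': "edge M e' = small_edge M m k i j'" and j': "j' < deg M"
      and t: "gll M j' < t" "t < gll M (Suc j')" for e' j' t
  proof -
    have t1: "-1 < t" "t < 1" and tI: "t \<in> {gll M j'..gll M (Suc j')}"
      using gll_interior[OF j' t] t by auto
    then have ref: "?p t \<in> refK"
      using ij by (intro line_in_refK) auto
    have orth: "edge_nrm M e' (emap M m (?p t)) \<bullet> (jac M m (?p t) *v axis k 1) = 0"
      using edge_nrm_orthogonal[OF e' ij(1) j' tI] .
    have "emap M m (?p t) \<in> edge M e'"
      using tI by (simp add: e' small_edge_def)
    then have "flux e' u (emap M m (?p t)) =
        elem_trace M m u (emap M m (?p t)) \<bullet> edge_nrm M e' (emap M m (?p t))"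
      unfolding flux_def
      by (intro normal_trace_unique[OF u ij(1) t1 _ orth] subsetD[OF edge_subset_elem_of])
    moreover have "jac M m (?p t) *v u' (?p t) = (u' (?p t) $ k) *\<^sub>R (jac M m (?p t) *v axis k 1) +
        poly P t *\<^sub>R (jac M m (?p t) *v axis l 1)"
      unfolding P(2)[symmetric] by (subst vec2_decompose[OF l, of "u' (?p t)"])
        (simp add: matrix_vector_right_distrib matrix_vector_mult_scaleR)
    ultimately show ?thesis
      using orth by (simp add: u'(2)[OF ref] inner_add_left inner_add_right inner_commute)
  qed
  have "\<forall>j'\<in>{..<deg M}. \<exists>t. gll M j' < t \<and> t < gll M (Suc j') \<and> poly P t = 0"
  proof
    fix j' assume "j' \<in> {..<deg M}"
    then have j': "j' < deg M"
      by simp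
    have "emap M m ` ?p ` {-1..1} \<subseteq> frontier (dmn M)"
      using bedge_subset_frontier[of b] e ij by (intro boundary_small_edge_on_side) (auto simp: e_def)
    then obtain b' where e': "edge M (bedge M b') = small_edge M m k i j'"
      using ij(1) j' by (rule boundary_side_small_edge)
    have "edge_integral M (edge M (bedge M b')) (flux (bedge M b') u) = 0"
      using zero[of b'] by (simp add: dof1_eq_flux)
    then obtain t where t: "gll M j' < t" "t < gll M (Suc j')"
      "flux (bedge M b') u (emap M m (?p t)) = 0"
      using edge_integral_zero_imp_interior_zero[OF e' ij(1) j' continuous_on_flux[OF u]] by metis
    let ?n = "edge_nrm M (bedge M b') (emap M m (?p t))"
    have t1: "-1 < t" "t < 1" and tI: "t \<in> {gll M j'..gll M (Suc j')}"
      using gll_interior[OF j' t(1,2)] t by auto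
    then have ref: "?p t \<in> refK"
      using ij by (intro line_in_refK) auto
    have "?n \<noteq> 0"
      using norm_edge_nrm[of "emap M m (?p t)" "bedge M b'"] tI by (auto simp: e' small_edge_def)
    then have "?n \<bullet> (jac M m (?p t) *v axis l 1) \<noteq> 0"
      using jac_range_orthogonal[OF ref l edge_nrm_orthogonal[OF e' ij(1) j' tI]] by blast
    then have "poly P t = 0"
      using t(3) flux_rep[OF e' j' t(1,2)] det_jac_pos[OF ref, of m] by (simp add: inner_commute)
    then show "\<exists>t. gll M j' < t \<and> t < gll M (Suc j') \<and> poly P t = 0"
      using t by blast
  qed
  from bchoice[OF this] obtain z where z: "\<And>j'. j' < deg M \<Longrightarrow> gll M j' < z j'"
    "\<And>j'. j' < deg M \<Longrightarrow> z j' < gll M (Suc j')" "\<And>j'. j' < deg M \<Longrightarrow> poly P (z j') = 0"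
    by auto
  \<comment> \<open>The zeros lie in disjoint open intervals, so they are \<open>deg M\<close>
    distinct zeros of a polynomial of degree at most \<open>deg M - 1\<close>.\<close>
  have z_less: "z i' < z j'" if "i' < j'" "j' < deg M" for i' j'
    using that z(1)[of j'] z(2)[of i'] gll_le[of "Suc i'" j'] by auto
  have "inj_on z {..<deg M}"
  proof (rule inj_onI)
    fix i' j' assume "i' \<in> {..<deg M}" "j' \<in> {..<deg M}" "z i' = z j'"
    then show "i' = j'"
      using z_less[of i' j'] z_less[of j' i'] by (cases i' j' rule: linorder_cases) auto
  qed
  then have "card (z ` {..<deg M}) = deg M"
    by (simp add: card_image)
  then have "P = 0"
    using P(1) deg_pos z(3) by (intro poly_eqI_degree[of "z ` {..<deg M}"]) auto
  then have "flux e u (emap M m (?p t)) = 0" if "gll M j < t" "t < gll M (Suc j)" for t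
    using flux_rep[OF e ij(2) that] by simp
  then have "{x \<in> edge M e. flux e u x \<noteq> 0} \<subseteq>
      {emap M m (?p (gll M j)), emap M m (?p (gll M (Suc j)))}"
    by (auto simp: e small_edge_def order.order_iff_strict)
  then show ?thesis
    unfolding e_def by (rule finite_subset) simp
qed

section \<open>Values at boundary nodes\<close>

lemma node_obtain:
  assumes "i \<le> deg M" "j \<le> deg M"
  obtains v where "node M v = emap M m (line k (gll M i) (gll M j))"
proof -
  have "line k (gll M i) (gll M j) \<in> {vector [gll M i', gll M j'] | i' j'. i' \<le> deg M \<and> j' \<le> deg M}"
  proof (cases "k = 1")
    case True
    then have "line k (gll M i) (gll M j) = vector [gll M j, gll M i]"
      by (simp add: vec_eq_iff forall_2 line_def)
    then show ?thesis
      using assms by blast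
  next
    case False
    then have "line k (gll M i) (gll M j) = vector [gll M i, gll M j]"
      using exhaust_2[of k] by (auto simp: vec_eq_iff forall_2 line_def)
    then show ?thesis
      using assms by blast
  qed
  then obtain i' j' where "i' \<le> deg M" "j' \<le> deg M"
    and eq: "line k (gll M i) (gll M j) = vector [gll M i', gll M j']"
    by blast
  then have "emap M m (line k (gll M i) (gll M j)) \<in> mesh_nodes M"
    unfolding mesh_nodes_def eq by blast
  then have "emap M m (line k (gll M i) (gll M j)) \<in> range (node M)"
    using meshed by (simp add: meshed_domain_def bij_betw_def)
  then show thesis
    using that by (metis imageE)
qed

lemma bnode_frontier: "node M (bnode M b) \<in> frontier (dmn M)"
  using meshed unfolding meshed_domain_def bij_betw_def by blast

lemma frontier_node_bnode: "node M v \<in> frontier (dmn M) \<Longrightarrow> v \<in> range (bnode M)"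
  using meshed unfolding meshed_domain_def bij_betw_def by blast

lemma bnode_inj: "bnode M a = bnode M b \<longleftrightarrow> a = b"
  using meshed unfolding meshed_domain_def bij_betw_def by (metis injD)

text \<open>As for fluxes, one small edge uses the whole side containing it: the side lies in the
  frontier, so all its \<open>deg M + 1\<close> nodes are boundary nodes.\<close>

lemma boundary_value_zero:
  assumes f: "f \<in> C_space M" and zero: "\<And>b. f (node M (bnode M b)) = 0"
    and x: "x \<in> edge M (bedge M b)"
  shows "f x = 0"
proof -
  define e where "e = bedge M b"
  obtain m k i j where ij: "i \<le> deg M" "j < deg M" and e: "edge M e = small_edge M m k i j"
    by (rule edge_obtain_small_edge)
  let ?p = "\<lambda>t. line k (gll M i) t"
  obtain f' where f': "f' \<in> C_ref (deg M)" "\<And>x. x \<in> refK \<Longrightarrow> f (emap M m x) = f' x"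
    using f unfolding C_space_def by blast
  obtain P where P: "degree P \<le> deg M" "\<And>t. f' (?p t) = poly P t"
    using tensor_poly_line[OF f'(1)[unfolded C_ref_def], of k "gll M i"] by auto
  have rep: "f (emap M m (?p t)) = poly P t" if "t \<in> {-1..1}" for t
    using f'(2)[OF line_in_refK[OF ij(1) that]] P(2) by simp
  have side: "emap M m ` ?p ` {-1..1} \<subseteq> frontier (dmn M)"
    using bedge_subset_frontier[of b] e ij by (intro boundary_small_edge_on_side) (auto simp: e_def)
  have "poly P (gll M j') = 0" if j': "j' \<le> deg M" for j'
  proof -
    obtain v where v: "node M v = emap M m (?p (gll M j'))"
      using ij(1) j' by (rule node_obtain)
    then have "node M v \<in> frontier (dmn M)"
      using side gll_bounds[OF j'] by auto
    then have "f (node M v) = 0"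
      using frontier_node_bnode[of v] zero by auto
    then show ?thesis
      using rep[OF gll_bounds[OF j']] v by simp
  qed
  moreover have "card (gll M ` {..deg M}) = Suc (deg M)"
    using gll_inj by (subst card_image) (auto intro!: inj_onI)
  ultimately have "P = 0"
    using P(1) by (intro poly_eqI_degree[of "gll M ` {..deg M}"]) auto
  then show ?thesis
    using x rep gll_interval_subset[OF ij(2)] by (auto simp: e_def[symmetric] e small_edge_def)
qed

text \<open>Boundary integrals control a nodal value only through an edge containing the node. The
  frontier is a union of sides, and the GLL nodes cut each such side into boundary small
  edges.\<close>

lemma bnode_in_bedge:
  obtains b where "node M (bnode M a) \<in> edge M (bedge M b)"
proof -
  have "frontier (dmn M) = \<Union>{A \<in> elem_sides M. A \<subseteq> frontier (dmn M)}"
    using partition by (simp add: partition_of_domain_def)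
  then have "node M (bnode M a) \<in> \<Union>{A \<in> elem_sides M. A \<subseteq> frontier (dmn M)}"
    using bnode_frontier[of a] by simp
  then obtain m k s where s: "s \<in> {-1, 1}"
    "node M (bnode M a) \<in> emap M m ` line k s ` {-1..1}"
    "emap M m ` line k s ` {-1..1} \<subseteq> frontier (dmn M)"
    unfolding elem_sides_def by blast
  obtain i where i: "i \<le> deg M" "s = gll M i"
    using s(1) gll_0 gll_deg that[of 0] that[of "deg M"] by auto
  obtain t where t: "t \<in> {-1..1}" "node M (bnode M a) = emap M m (line k s t)"
    using s(2) by blast
  obtain j where j: "j < deg M" "t \<in> {gll M j..gll M (Suc j)}"
    using t(1) by (rule gll_cover)
  obtain b where "edge M (bedge M b) = small_edge M m k i j"
    using boundary_side_small_edge[OF _ i(1) j(1), of m k] s(3) unfolding i(2) .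
  then show thesis
    using that[of b] t(2) j(2) i(2) by (simp add: small_edge_def)
qed

section \<open>Integrals over the boundary\<close>

text \<open>Continuity is asked edge by edge and not on \<partial>\<Omega> as a whole, because
  normal components may jump from one edge to the next.\<close>

definition boundary_continuous :: "(real^2 \<Rightarrow> real) \<Rightarrow> bool" where
  "boundary_continuous f \<longleftrightarrow> (\<forall>b. almost_continuous_on (edge M (bedge M b)) f)"

lemma boundary_continuous_mult:
  "boundary_continuous f \<Longrightarrow> boundary_continuous g \<Longrightarrow> boundary_continuous (\<lambda>x. f x * g x)"
  unfolding boundary_continuous_def by (auto intro: almost_continuous_on_mult)

lemma boundary_continuous_cmult: "boundary_continuous f \<Longrightarrow> boundary_continuous (\<lambda>x. c * f x)"
  unfolding boundary_continuous_def by (auto intro: almost_continuous_on_cmult)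

lemma boundary_continuous_sum:
  "(\<And>i. i \<in> I \<Longrightarrow> boundary_continuous (f i)) \<Longrightarrow> boundary_continuous (\<lambda>x. \<Sum>i\<in>I. f i x)"
  unfolding boundary_continuous_def by (auto intro: almost_continuous_on_sum)

lemma boundary_continuous_C_space: "f \<in> C_space M \<Longrightarrow> boundary_continuous f"
  unfolding boundary_continuous_def
proof
  fix b assume "f \<in> C_space M"
  moreover have "edge M (bedge M b) \<subseteq> closure (dmn M)"
    using bedge_subset_frontier[of b] by (auto simp: frontier_def)
  ultimately show "almost_continuous_on (edge M (bedge M b)) f"
    by (intro continuous_imp_almost_continuous_on continuous_on_subset[OF C_space_continuous])
qed

lemma boundary_continuous_normal_trace: "u \<in> D_space M \<Longrightarrow> boundary_continuous (bd_normal_trace M u)"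
  unfolding boundary_continuous_def
  using bd_normal_trace_eq_flux
  by (auto intro!: almost_continuous_on_cong[OF almost_continuous_on_cmult[OF
    continuous_imp_almost_continuous_on[OF continuous_on_flux]]])

lemma bd_integral_cmult: "bd_integral M (\<lambda>x. c * f x) = c * bd_integral M f"
  by (simp add: bd_integral_def edge_integral_cmult sum_distrib_left)

lemma bd_integral_sum:
  assumes "finite I" "\<And>i. i \<in> I \<Longrightarrow> boundary_continuous (f i)"
  shows "bd_integral M (\<lambda>x. \<Sum>i\<in>I. f i x) = (\<Sum>i\<in>I. bd_integral M (f i))"
  unfolding bd_integral_def using assms
  by (subst sum.swap) (intro sum.cong edge_integral_sum, auto simp: boundary_continuous_def)

lemma bd_integral_cong:
  assumes "boundary_continuous g" "\<And>b. finite {x \<in> edge M (bedge M b). f x \<noteq> g x}"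
  shows "bd_integral M f = bd_integral M g"
  unfolding bd_integral_def using assms
  by (intro sum.cong edge_integral_cong) (auto simp: boundary_continuous_def)

lemma bd_integral_zero:
  assumes f: "boundary_continuous f" and nonneg: "\<And>x. f x \<ge> 0" and zero: "bd_integral M f = 0"
  shows "finite {x \<in> edge M (bedge M b). f x \<noteq> 0}"
proof (rule edge_integral_zero)
  have ac: "almost_continuous_on (edge M (bedge M b)) f" for b
    using f by (simp add: boundary_continuous_def)
  then show "almost_continuous_on (edge M (bedge M b)) f" .
  have "edge_integral M (edge M (bedge M b)) f \<ge> 0" for b
    using ac nonneg by (rule edge_integral_nonneg)
  then show "edge_integral M (edge M (bedge M b)) f = 0"
    using zero unfolding bd_integral_def by (subst (asm) sum_nonneg_eq_0_iff) auto
qed (rule nonneg)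

end

section \<open>Matrices with trivial kernel\<close>

lemma matrix_inv_right_of_kernel:
  fixes A :: "real^'n^'n"
  assumes "\<And>x. A *v x = 0 \<Longrightarrow> x = 0"
  shows "A ** matrix_inv A = mat 1"
proof -
  have "invertible A"
    unfolding invertible_left_inverse matrix_left_invertible_ker using assms by blast
  then show ?thesis
    unfolding invertible_def matrix_inv_def using someI_ex by (metis (mono_tags, lifting))
qed

lemma matrix_inv_mult_vector:
  fixes A :: "real^'n^'n"
  assumes "\<And>x. A *v x = 0 \<Longrightarrow> x = 0"
  shows "A *v (matrix_inv A *v y) = y"
  by (simp add: matrix_vector_mul_assoc matrix_inv_right_of_kernel[OF assms])

section \<open>Mass matrices\<close>

context gll_meshed_domain
begin

lemma dmn_integral_expand:
  fixes u :: "'i::finite \<Rightarrow> real^2 \<Rightarrow> 'a::real_inner"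
  assumes "\<And>i. piecewise_continuous M (u i)" "piecewise_continuous M w"
    and "\<And>m x. x \<in> elem_int M m \<Longrightarrow> g x = (\<Sum>i\<in>UNIV. (c $ i) *\<^sub>R u i x)"
  shows "dmn_integral M (\<lambda>x. g x \<bullet> w x) = (\<Sum>i\<in>UNIV. c $ i * dmn_integral M (\<lambda>x. u i x \<bullet> w x))"
proof -
  have pc: "piecewise_continuous M (\<lambda>x. u i x \<bullet> w x)" for i
    using assms by (intro piecewise_continuous_inner)
  have pc': "piecewise_continuous M (\<lambda>x. c $ i * (u i x \<bullet> w x))" for i
    using piecewise_continuous_scaleR[OF piecewise_continuous_const[of M "c $ i"] pc[of i]] by simp
  have "dmn_integral M (\<lambda>x. g x \<bullet> w x) = dmn_integral M (\<lambda>x. \<Sum>i\<in>UNIV. c $ i * (u i x \<bullet> w x))"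
  proof (rule dmn_integral_cong)
    show "piecewise_continuous M (\<lambda>x. \<Sum>i\<in>UNIV. c $ i * (u i x \<bullet> w x))"
      using pc' by (intro piecewise_continuous_sum)
    show "g x \<bullet> w x = (\<Sum>i\<in>UNIV. c $ i * (u i x \<bullet> w x))" if "x \<in> elem_int M m" for m x
      using assms(3)[OF that] by (simp add: inner_sum_left)
  qed
  also have "\<dots> = (\<Sum>i\<in>UNIV. c $ i * dmn_integral M (\<lambda>x. u i x \<bullet> w x))"
    using pc pc' by (simp add: dmn_integral_sum dmn_integral_cmult)
  finally show ?thesis .
qed

lemma dmn_integral_gram:
  fixes u :: "'i::finite \<Rightarrow> real^2 \<Rightarrow> 'a::real_inner"
  assumes u: "\<And>i. piecewise_continuous M (u i)"
    and A: "\<And>i j. A $ i $ j = dmn_integral M (\<lambda>x. u i x \<bullet> u j x)"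
    and g: "\<And>m x. x \<in> elem_int M m \<Longrightarrow> g x = (\<Sum>i\<in>UNIV. (c $ i) *\<^sub>R u i x)"
    and h: "\<And>m x. x \<in> elem_int M m \<Longrightarrow> h x = (\<Sum>i\<in>UNIV. (d $ i) *\<^sub>R u i x)"
  shows "dmn_integral M (\<lambda>x. g x \<bullet> h x) = (A *v c) \<bullet> d"
proof -
  have "piecewise_continuous M (\<lambda>x. \<Sum>i\<in>UNIV. (c $ i) *\<^sub>R u i x)"
    by (intro piecewise_continuous_sum piecewise_continuous_scaleR piecewise_continuous_const u)
  moreover have "piecewise_continuous M g \<longleftrightarrow> piecewise_continuous M (\<lambda>x. \<Sum>i\<in>UNIV. (c $ i) *\<^sub>R u i x)"
    by (rule piecewise_continuous_cong) (rule g)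
  ultimately have pcg: "piecewise_continuous M g"
    by simp
  have gu: "dmn_integral M (\<lambda>x. u j x \<bullet> g x) = (A *v c) $ j" for j
  proof -
    have "dmn_integral M (\<lambda>x. u j x \<bullet> g x) = dmn_integral M (\<lambda>x. g x \<bullet> u j x)"
      by (simp add: inner_commute)
    also have "\<dots> = (\<Sum>i\<in>UNIV. c $ i * dmn_integral M (\<lambda>x. u i x \<bullet> u j x))"
      using u u g by (rule dmn_integral_expand)
    also have "\<dots> = (A *v c) $ j"
      by (simp add: matrix_vector_mult_def A inner_commute mult.commute)
    finally show ?thesis .
  qed
  have "dmn_integral M (\<lambda>x. g x \<bullet> h x) = dmn_integral M (\<lambda>x. h x \<bullet> g x)"
    by (simp add: inner_commute)
  also have "\<dots> = (\<Sum>j\<in>UNIV. d $ j * dmn_integral M (\<lambda>x. u j x \<bullet> g x))"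
    using u pcg h by (rule dmn_integral_expand)
  also have "\<dots> = (A *v c) \<bullet> d"
    unfolding gu by (simp add: inner_vec_def mult.commute)
  finally show ?thesis .
qed

text \<open>The integral of the squared norm of the combination is
  \<open>(A *v c) \<bullet> c\<close>, which is zero.\<close>

lemma dmn_gram_kernel:
  fixes u :: "'i::finite \<Rightarrow> real^2 \<Rightarrow> 'a::real_inner"
  assumes u: "\<And>i. piecewise_continuous M (u i)"
    and A: "\<And>i j. A $ i $ j = dmn_integral M (\<lambda>x. u i x \<bullet> u j x)"
    and c: "A *v c = 0" and x: "x \<in> elem_int M m"
  shows "(\<Sum>i\<in>UNIV. (c $ i) *\<^sub>R u i x) = 0"
proof -
  let ?g = "\<lambda>x. \<Sum>i\<in>UNIV. (c $ i) *\<^sub>R u i x"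
  have "dmn_integral M (\<lambda>x. ?g x \<bullet> ?g x) = 0"
    using dmn_integral_gram[where g = ?g and h = ?g, OF u A refl refl] c by simp
  moreover have "piecewise_continuous M (\<lambda>x. ?g x \<bullet> ?g x)"
    by (intro piecewise_continuous_inner piecewise_continuous_sum piecewise_continuous_scaleR
        piecewise_continuous_const u)
  ultimately have "?g x \<bullet> ?g x = 0"
    using x by (intro dmn_integral_zero[of "\<lambda>x. ?g x \<bullet> ?g x"]) auto
  then show ?thesis
    by simp
qed

lemma bd_integral_gram:
  fixes f :: "'i::finite \<Rightarrow> real^2 \<Rightarrow> real"
  assumes f: "\<And>i. boundary_continuous (f i)"
    and A: "\<And>i j. A $ i $ j = bd_integral M (\<lambda>x. f i x * f j x)"
  shows "bd_integral M (\<lambda>x. (\<Sum>i\<in>UNIV. f i x * c $ i) * f j x) = (A *v c) $ j"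
proof -
  have "bd_integral M (\<lambda>x. (\<Sum>i\<in>UNIV. f i x * c $ i) * f j x) =
      bd_integral M (\<lambda>x. \<Sum>i\<in>UNIV. c $ i * (f j x * f i x))"
    by (simp add: sum_distrib_left sum_distrib_right ac_simps)
  also have "\<dots> = (\<Sum>i\<in>UNIV. bd_integral M (\<lambda>x. c $ i * (f j x * f i x)))"
    using f by (intro bd_integral_sum boundary_continuous_cmult boundary_continuous_mult) auto
  also have "\<dots> = (A *v c) $ j"
    by (simp add: bd_integral_cmult matrix_vector_mult_def A mult.commute)
  finally show ?thesis .
qed

text \<open>The quadratic form argument again; on the boundary the integrands are controlled up to
  finite sets only, and so is the conclusion.\<close>

lemma bd_gram_kernel:
  fixes f :: "'i::finite \<Rightarrow> real^2 \<Rightarrow> real"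
  assumes f: "\<And>i. boundary_continuous (f i)"
    and A: "\<And>i j. A $ i $ j = bd_integral M (\<lambda>x. f i x * f j x)"
    and c: "A *v c = 0"
  shows "finite {x \<in> edge M (bedge M b). (\<Sum>i\<in>UNIV. f i x * c $ i) \<noteq> 0}"
proof -
  let ?F = "\<lambda>x. \<Sum>i\<in>UNIV. f i x * c $ i"
  have F: "boundary_continuous ?F"
    using boundary_continuous_sum[of UNIV "\<lambda>i x. c $ i * f i x"] f
    by (simp add: boundary_continuous_cmult mult.commute)
  have "bd_integral M (\<lambda>x. ?F x * ?F x) = bd_integral M (\<lambda>x. \<Sum>j\<in>UNIV. c $ j * (?F x * f j x))"
    by (simp add: sum_distrib_left ac_simps)
  also have "\<dots> = (\<Sum>j\<in>UNIV. bd_integral M (\<lambda>x. c $ j * (?F x * f j x)))"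
    using f F by (intro bd_integral_sum boundary_continuous_cmult boundary_continuous_mult) auto
  also have "\<dots> = 0"
    using bd_integral_gram[OF f A] c by (simp add: bd_integral_cmult)
  finally have "finite {x \<in> edge M (bedge M b). ?F x * ?F x \<noteq> 0}"
    using F by (intro bd_integral_zero boundary_continuous_mult) auto
  then show ?thesis
    by simp
qed

end

section \<open>Degrees of freedom\<close>

locale gll_basis = gll_meshed_domain M
  for M :: "('m::finite, 'v::finite, 'e::finite, 'c::finite, 'bv::finite, 'be::finite) gll_mesh" +
  assumes basis: "basis_functions M"
begin

lemma psi0_C_space: "psi0 M v \<in> C_space M" and dof0_psi0: "dof0 M (psi0 M v) = axis v 1"
  and psi1_D_space: "psi1 M e \<in> D_space M" and dof1_psi1: "dof1 M (psi1 M e) = axis e 1"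
  and psi2_S_space: "psi2 M c \<in> S_space M"
  using basis unfolding basis_functions_def by blast+

lemma C_space_expand:
  "f \<in> C_space M \<Longrightarrow> x \<in> closure (dmn M) \<Longrightarrow> f x = (\<Sum>v\<in>UNIV. (dof0 M f $ v) *\<^sub>R psi0 M v x)"
  using basis unfolding basis_functions_def by (simp add: mult.commute)

lemma D_space_expand:
  "u \<in> D_space M \<Longrightarrow> x \<in> elem_int M m \<Longrightarrow> u x = (\<Sum>e\<in>UNIV. (dof1 M u $ e) *\<^sub>R psi1 M e x)"
  using basis unfolding basis_functions_def by blast

lemma S_space_expand:
  "g \<in> S_space M \<Longrightarrow> x \<in> elem_int M m \<Longrightarrow> g x = (\<Sum>c\<in>UNIV. (dof2 M g $ c) *\<^sub>R psi2 M c x)"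
  using basis unfolding basis_functions_def by (simp add: mult.commute)

lemma psi0_piecewise_continuous: "piecewise_continuous M (psi0 M v)"
  using psi0_C_space by (rule C_space_piecewise_continuous)

lemma psi1_piecewise_continuous: "piecewise_continuous M (psi1 M e)"
  using psi1_D_space by (rule D_space_piecewise_continuous)

lemma psi2_piecewise_continuous: "piecewise_continuous M (psi2 M c)"
  using psi2_S_space by (rule S_space_piecewise_continuous)

lemma mass0_eq: "mass0 M $ v $ w = dmn_integral M (\<lambda>x. psi0 M v x \<bullet> psi0 M w x)"
  and mass1_eq: "mass1 M $ e $ f = dmn_integral M (\<lambda>x. psi1 M e x \<bullet> psi1 M f x)"
  and mass2_eq: "mass2 M $ c $ d = dmn_integral M (\<lambda>x. psi2 M c x \<bullet> psi2 M d x)"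
  by (simp_all add: mass0_def mass1_def mass2_def)

lemma mem_elem_int_closure: "x \<in> elem_int M m \<Longrightarrow> x \<in> closure (dmn M)"
  using elem_int_subset elem_subset_closure by blast

lemma dmn_integral_C_space:
  assumes "f \<in> C_space M" "g \<in> C_space M"
  shows "dmn_integral M (\<lambda>x. f x * g x) = dual_dof2 M f \<bullet> dof0 M g"
  using dmn_integral_gram[where g = f and h = g, OF psi0_piecewise_continuous mass0_eq
      C_space_expand[OF assms(1) mem_elem_int_closure]
      C_space_expand[OF assms(2) mem_elem_int_closure]]
  by (simp add: dual_dof2_def)

lemma dmn_integral_D_space:
  assumes "u \<in> D_space M"
    and "\<And>m x. x \<in> elem_int M m \<Longrightarrow> w x = (\<Sum>e\<in>UNIV. (a $ e) *\<^sub>R psi1 M e x)"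
  shows "dmn_integral M (\<lambda>x. u x \<bullet> w x) = dual_dof1 M u \<bullet> a"
  using dmn_integral_gram[where g = u and h = w, OF psi1_piecewise_continuous mass1_eq
      D_space_expand[OF assms(1)] assms(2)]
  by (simp add: dual_dof1_def)

lemma dmn_integral_S_space:
  assumes "g \<in> S_space M"
    and "\<And>m x. x \<in> elem_int M m \<Longrightarrow> h x = (\<Sum>c\<in>UNIV. (a $ c) *\<^sub>R psi2 M c x)"
  shows "dmn_integral M (\<lambda>x. g x * h x) = dual_dof0 M g \<bullet> a"
  using dmn_integral_gram[where g = g and h = h, OF psi2_piecewise_continuous mass2_eq
      S_space_expand[OF assms(1)] assms(2)]
  by (simp add: dual_dof0_def)

lemma dof1_combination: "dof1 M (\<lambda>x. \<Sum>e\<in>UNIV. (a $ e) *\<^sub>R psi1 M e x) = a"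
proof -
  have "dof1 M (\<lambda>x. \<Sum>e\<in>UNIV. (a $ e) *\<^sub>R psi1 M e x) = (\<Sum>e\<in>UNIV. (a $ e) *\<^sub>R dof1 M (psi1 M e))"
    by (rule dof1_sum) (simp_all add: psi1_D_space)
  also have "\<dots> = a"
    by (simp add: dof1_psi1 vec_eq_iff axis_def if_distrib cong: if_cong)
  finally show ?thesis .
qed

lemma dof0_combination: "dof0 M (\<lambda>x. \<Sum>v\<in>UNIV. (a $ v) *\<^sub>R psi0 M v x) = a"
proof -
  have "psi0 M v (node M w) = (if w = v then 1 else 0)" for v w
    using dof0_psi0[of v] by (auto simp: dof0_def vec_eq_iff axis_def)
  then have "(\<Sum>v\<in>UNIV. (a $ v) *\<^sub>R psi0 M v (node M w)) = (\<Sum>v\<in>UNIV. if v = w then a $ w else 0)" for w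
    by (intro sum.cong) auto
  then show ?thesis
    by (simp add: dof0_def vec_eq_iff)
qed

lemma mass1_kernel:
  assumes "mass1 M *v a = 0"
  shows "a = 0"
proof -
  have "(\<Sum>e\<in>UNIV. (a $ e) *\<^sub>R psi1 M e x) = 0" if "x \<in> elem_int M m" for m x
    using psi1_piecewise_continuous mass1_eq assms that by (rule dmn_gram_kernel)
  \<comment> \<open>The combination agrees on the open elements with the zero field, here written as
    an empty sum so that \<open>dof1_sum\<close> applies.\<close>
  then have "dof1 M (\<lambda>x. \<Sum>e\<in>UNIV. (a $ e) *\<^sub>R psi1 M e x) = (\<Sum>e\<in>{}. 0 *\<^sub>R dof1 M (psi1 M e))"
    by (intro dof1_sum) auto
  then show ?thesis
    by (simp add: dof1_combination)
qed

lemma node_closure: "node M v \<in> closure (dmn M)"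
proof -
  have "node M v \<in> mesh_nodes M"
    using meshed by (auto simp: meshed_domain_def bij_betw_def)
  then obtain m i j where "node M v = emap M m (vector [gll M i, gll M j])" "i \<le> deg M" "j \<le> deg M"
    unfolding mesh_nodes_def by blast
  moreover have "vector [gll M i, gll M j] \<in> refK" if "i \<le> deg M" "j \<le> deg M" for i j
    using gll_bounds that by (simp add: refK_def forall_2)
  ultimately show ?thesis
    using elem_subset_closure[of m] unfolding elem_def by blast
qed

text \<open>Nodes may lie outside every open element, so vanishing has to be carried to the closed
  elements by continuity before nodal values can be read off.\<close>

lemma mass0_kernel:
  assumes "mass0 M *v a = 0"
  shows "a = 0"
proof -
  let ?f = "\<lambda>x. \<Sum>v\<in>UNIV. (a $ v) *\<^sub>R psi0 M v x"
  have "?f \<in> C_space M"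
    using C_space_sum[of UNIV "psi0 M" "\<lambda>v. a $ v"] psi0_C_space by simp
  then have cont: "continuous_on (closure (dmn M)) ?f"
    by (rule C_space_continuous)
  have zero: "?f x = 0" if "x \<in> elem_int M m" for m x
    using psi0_piecewise_continuous mass0_eq assms that by (rule dmn_gram_kernel)
  have "?f x = 0" if x: "x \<in> elem M m" for m x
  proof -
    have "continuous_on (elem M m) ?f"
      using cont elem_subset_closure by (rule continuous_on_subset)
    then have "(?f \<longlongrightarrow> ?f x) (at x within elem_int M m)"
      using x elem_int_subset[of m] tendsto_within_subset unfolding continuous_on_def by blast
    moreover have "(?f \<longlongrightarrow> 0) (at x within elem_int M m)"
      by (rule Lim_transform_within[OF tendsto_const, of 1]) (use zero in auto)
    ultimately show ?thesis
      using tendsto_unique not_trivial_limit_elem_int[OF x] by blast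
  qed
  then have "?f (node M v) = 0" for v
    using node_closure[of v] unfolding closure_dmn by blast
  then have "dof0 M ?f = 0"
    by (simp add: dof0_def vec_eq_iff)
  then show ?thesis
    unfolding dof0_combination .
qed

section \<open>Boundary dual degrees of freedom\<close>

lemma bd_psi1_eq: "bd_psi1 M b x = (incl1 M $ bedge M b $ b) * bd_normal_trace M (psi1 M (bedge M b)) x"
  unfolding bd_psi1_def by (subst incl1_bedge) (simp add: if_distrib cong: if_cong)

lemma bd_psi0_eq: "bd_psi0 M b x = psi0 M (bnode M b) x"
  unfolding bd_psi0_def incl0_def by (simp add: if_distrib cong: if_cong)

lemma bd_psi1_boundary_continuous: "boundary_continuous (bd_psi1 M b)"
  using boundary_continuous_cmult[OF boundary_continuous_normal_trace[OF psi1_D_space]]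
  by (simp add: bd_psi1_eq[abs_def])

lemma bd_psi0_boundary_continuous: "boundary_continuous (bd_psi0 M b)"
  using boundary_continuous_C_space[OF psi0_C_space] by (simp add: bd_psi0_eq[abs_def])

lemma bd_mass1_eq: "bd_mass1 M $ a $ b = bd_integral M (\<lambda>x. bd_psi1 M a x * bd_psi1 M b x)"
  and bd_mass0_eq: "bd_mass0 M $ a' $ b' = bd_integral M (\<lambda>x. bd_psi0 M a' x * bd_psi0 M b' x)"
  by (simp_all add: bd_mass1_def bd_mass0_def)

text \<open>By \<open>bd_gram_kernel\<close> the combination vanishes on every boundary edge up to
  finitely many points. Its flux through the edge of \<open>b\<close> then isolates
  \<open>c $ b\<close>, since the fluxes of the basis fields are unit vectors.\<close>

lemma bd_mass1_kernel:
  assumes "bd_mass1 M *v c = 0"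
  shows "c = 0"
proof -
  let ?\<sigma> = "\<lambda>b. incl1 M $ bedge M b $ b"
  have "c $ b = 0" for b
  proof -
    let ?e = "bedge M b"
    \<comment> \<open>The combination with each normal trace replaced by the flux integrand of the
      single edge \<open>?e\<close>, stripped of the common sign \<open>?\<sigma> b\<close>.\<close>
    let ?G = "\<lambda>x. \<Sum>a\<in>UNIV. (c $ a * ?\<sigma> a) * flux ?e (psi1 M (bedge M a)) x"
    have "finite {x \<in> edge M ?e. (\<Sum>a\<in>UNIV. bd_psi1 M a x * c $ a) \<noteq> 0}"
      using bd_psi1_boundary_continuous bd_mass1_eq assms by (rule bd_gram_kernel)
    moreover have "finite (\<Union>a. {x \<in> edge M ?e.
        bd_normal_trace M (psi1 M (bedge M a)) x \<noteq> ?\<sigma> b * flux ?e (psi1 M (bedge M a)) x})"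
      using bd_normal_trace_eq_flux[OF psi1_D_space] by simp
    ultimately have "finite ({x \<in> edge M ?e. (\<Sum>a\<in>UNIV. bd_psi1 M a x * c $ a) \<noteq> 0} \<union>
        (\<Union>a. {x \<in> edge M ?e.
          bd_normal_trace M (psi1 M (bedge M a)) x \<noteq> ?\<sigma> b * flux ?e (psi1 M (bedge M a)) x}))"
      by (rule finite_UnI)
    moreover have "{x \<in> edge M ?e. ?G x \<noteq> 0} \<subseteq>
        {x \<in> edge M ?e. (\<Sum>a\<in>UNIV. bd_psi1 M a x * c $ a) \<noteq> 0} \<union>
        (\<Union>a. {x \<in> edge M ?e.
          bd_normal_trace M (psi1 M (bedge M a)) x \<noteq> ?\<sigma> b * flux ?e (psi1 M (bedge M a)) x})"
    proof (rule ccontr)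
      assume "\<not> ?thesis"
      then obtain x where x: "?G x \<noteq> 0" "(\<Sum>a\<in>UNIV. bd_psi1 M a x * c $ a) = 0"
        "\<And>a. bd_normal_trace M (psi1 M (bedge M a)) x = ?\<sigma> b * flux ?e (psi1 M (bedge M a)) x"
        by blast
      have "(\<Sum>a\<in>UNIV. bd_psi1 M a x * c $ a) = ?\<sigma> b * ?G x"
        by (simp add: bd_psi1_eq x(3) sum_distrib_left ac_simps)
      then show False
        using x(1,2) incl1_square[of b] by auto
    qed
    ultimately have fin: "finite {x \<in> edge M ?e. ?G x \<noteq> 0}"
      by (rule finite_subset[rotated])
    have ac: "almost_continuous_on (edge M ?e) (\<lambda>x. k * flux ?e (psi1 M (bedge M a)) x)" for k a
      by (intro almost_continuous_on_cmult continuous_imp_almost_continuous_on continuous_on_flux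
          psi1_D_space)
    \<comment> \<open>The zero function is written as a multiple of a flux: this is almost
      continuous by \<open>ac\<close>, and \<open>edge_integral_cmult\<close> evaluates its
      integral.\<close>
    have "edge_integral M (edge M ?e) ?G = edge_integral M (edge M ?e) (\<lambda>x. 0 * flux ?e (psi1 M ?e) x)"
      using fin by (intro edge_integral_cong ac) simp
    also have "\<dots> = 0"
      unfolding edge_integral_cmult by simp
    also have "edge_integral M (edge M ?e) ?G =
        (\<Sum>a\<in>UNIV. edge_integral M (edge M ?e) (\<lambda>x. (c $ a * ?\<sigma> a) * flux ?e (psi1 M (bedge M a)) x))"
      using finite ac by (rule edge_integral_sum)
    finally have "(\<Sum>a\<in>UNIV. (c $ a * ?\<sigma> a) * dof1 M (psi1 M (bedge M a)) $ ?e) = 0"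
      by (simp add: edge_integral_cmult dof1_eq_flux)
    moreover have "(c $ a * ?\<sigma> a) * dof1 M (psi1 M (bedge M a)) $ ?e = (if a = b then c $ b * ?\<sigma> b else 0)" for a
      by (auto simp: dof1_psi1 axis_def bedge_inj)
    ultimately have "c $ b * ?\<sigma> b = 0"
      by simp
    then show ?thesis
      using incl1_square[of b] by auto
  qed
  then show ?thesis
    by (simp add: vec_eq_iff)
qed

lemma psi0_bnode: "psi0 M (bnode M a) (node M (bnode M b)) = (if a = b then 1 else 0)"
proof -
  have "dof0 M (psi0 M (bnode M a)) $ bnode M b = (if a = b then 1 else 0)"
    unfolding dof0_psi0 by (auto simp: axis_def bnode_inj)
  then show ?thesis
    by (simp add: dof0_def)
qed

text \<open>The exceptional parameters form a null set, so the continuous absolute value of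
  \<open>f\<close> integrates to zero along the curve.\<close>

lemma continuous_on_edge_zero:
  fixes f :: "real^2 \<Rightarrow> real"
  assumes f: "continuous_on (edge M e) f" and fin: "finite {x \<in> edge M e. f x \<noteq> 0}"
    and x: "x \<in> edge M e"
  shows "f x = 0"
proof -
  obtain a b :: real and \<gamma> where par: "a < b" "continuous_on {a..b} \<gamma>" "inj_on \<gamma> {a..b}"
    "\<gamma> ` {a..b} = edge M e"
    by (rule edge_parametrization[of e]) (rule that; assumption)
  have "finite {t \<in> {a..b}. f (\<gamma> t) \<noteq> 0}"
  proof (rule inj_on_finite)
    show "inj_on \<gamma> {t \<in> {a..b}. f (\<gamma> t) \<noteq> 0}"
      using par(3) by (rule inj_on_subset) blast
    show "\<gamma> ` {t \<in> {a..b}. f (\<gamma> t) \<noteq> 0} \<subseteq> {x \<in> edge M e. f x \<noteq> 0}"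
      using par(4) by blast
  qed (rule fin)
  then have "integral {a..b} (\<lambda>t. 0) = integral {a..b} (\<lambda>t. \<bar>f (\<gamma> t)\<bar>)"
    by (intro integral_spike[OF negligible_finite]) auto
  moreover have "continuous_on {a..b} (\<lambda>t. \<bar>f (\<gamma> t)\<bar>)"
    using par by (intro continuous_intros continuous_on_compose2[OF f]) auto
  ultimately have "\<forall>t\<in>{a..b}. \<bar>f (\<gamma> t)\<bar> = 0"
    using par(1) integral_eq_0_iff[of a b "\<lambda>t. \<bar>f (\<gamma> t)\<bar>"] by simp
  then show ?thesis
    using x unfolding par(4)[symmetric] by auto
qed

text \<open>Unlike fluxes, nodal values are pointwise, so vanishing up to finitely many points is
  too weak; continuity along an edge through the node removes the exceptions.\<close>

lemma bd_mass0_kernel: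
  assumes "bd_mass0 M *v c = 0"
  shows "c = 0"
proof -
  let ?F = "\<lambda>x. \<Sum>a\<in>UNIV. bd_psi0 M a x * c $ a"
  have "c $ a = 0" for a
  proof -
    obtain b where b: "node M (bnode M a) \<in> edge M (bedge M b)"
      by (rule bnode_in_bedge)
    have "edge M (bedge M b) \<subseteq> closure (dmn M)"
      using bedge_subset_frontier[of b] by (auto simp: frontier_def)
    then have cont: "continuous_on (edge M (bedge M b)) ?F"
      unfolding bd_psi0_eq
      by (intro continuous_intros continuous_on_subset[OF C_space_continuous[OF psi0_C_space]])
    have fin: "finite {x \<in> edge M (bedge M b). ?F x \<noteq> 0}"
      using bd_psi0_boundary_continuous bd_mass0_eq assms by (rule bd_gram_kernel)
    have "?F x = 0" if "x \<in> edge M (bedge M b)" for x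
      using cont fin that by (rule continuous_on_edge_zero)
    then have "?F (node M (bnode M a)) = 0"
      using b by blast
    moreover have "?F (node M (bnode M a)) = (\<Sum>a'\<in>UNIV. if a' = a then c $ a else 0)"
      by (intro sum.cong) (auto simp: bd_psi0_eq psi0_bnode)
    ultimately show ?thesis
      by simp
  qed
  then show ?thesis
    by (simp add: vec_eq_iff)
qed

section \<open>Pairing dual boundary functions with traces of basis functions\<close>

lemma dual_bd_psi0_combination:
  "(\<Sum>b\<in>UNIV. dual_bd_psi0 M b x * B $ b) =
    (\<Sum>a\<in>UNIV. bd_psi1 M a x * (matrix_inv (bd_mass1 M) *v B) $ a)"
  unfolding dual_bd_psi0_def matrix_vector_mult_def
  by (simp add: sum_distrib_left sum_distrib_right mult.assoc) (rule sum.swap)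

lemma dual_bd_psi1_combination:
  "(\<Sum>b\<in>UNIV. dual_bd_psi1 M b x * B $ b) =
    (\<Sum>a\<in>UNIV. bd_psi0 M a x * (matrix_inv (bd_mass0 M) *v B) $ a)"
  unfolding dual_bd_psi1_def matrix_vector_mult_def
  by (simp add: sum_distrib_left sum_distrib_right mult.assoc) (rule sum.swap)

text \<open>The normal trace is a multiple of the flux off one finite set, and the flux vanishes off
  another because this basis field has no flux through any boundary edge.\<close>

lemma bd_normal_trace_psi1_zero:
  assumes "e \<notin> range (bedge M)"
  shows "finite {x \<in> edge M (bedge M b). bd_normal_trace M (psi1 M e) x \<noteq> 0}"
proof -
  have "dof1 M (psi1 M e) $ bedge M b = 0" for b
    using assms by (auto simp: dof1_psi1 axis_def)
  then have "finite {x \<in> edge M (bedge M b). flux (bedge M b) (psi1 M e) x \<noteq> 0}"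
    by (rule boundary_flux_zero[OF psi1_D_space])
  from finite_UnI[OF this bd_normal_trace_eq_flux[OF psi1_D_space, of b e]]
  show ?thesis
    by (rule rev_finite_subset) auto
qed

text \<open>For a boundary edge the normal trace of \<open>psi1\<close> is \<open>bd_psi1\<close> up
  to sign, and expanding \<open>h\<close> in the dual basis makes the boundary mass matrix meet its
  inverse. For any other edge the trace vanishes up to finitely many points and the row of
  \<open>incl1\<close> is zero.\<close>

lemma bd_integral_normal_trace_psi1:
  assumes h: "\<And>x. x \<in> frontier (dmn M) - elem_verts M \<Longrightarrow> h x = (\<Sum>b\<in>UNIV. dual_bd_psi0 M b x * B $ b)"
  shows "boundary_continuous h"
    and "bd_integral M (\<lambda>x. h x * bd_normal_trace M (psi1 M e) x) = (incl1 M *v B) $ e"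
proof -
  define \<beta> where "\<beta> = matrix_inv (bd_mass1 M) *v B"
  let ?H = "\<lambda>x. \<Sum>a\<in>UNIV. bd_psi1 M a x * \<beta> $ a"
  have fin: "finite {x \<in> edge M (bedge M b). h x \<noteq> ?H x}" for b
  proof (rule finite_subset[OF _ finite_elem_verts[of M]])
    show "{x \<in> edge M (bedge M b). h x \<noteq> ?H x} \<subseteq> elem_verts M"
      using h bedge_subset_frontier[of b] by (auto simp: dual_bd_psi0_combination \<beta>_def)
  qed
  have H: "boundary_continuous ?H"
    using boundary_continuous_sum[of UNIV "\<lambda>a x. \<beta> $ a * bd_psi1 M a x"] bd_psi1_boundary_continuous
    by (simp add: boundary_continuous_cmult mult.commute)
  then show "boundary_continuous h"
    using fin unfolding boundary_continuous_def by (blast intro: almost_continuous_on_cong)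
  show "bd_integral M (\<lambda>x. h x * bd_normal_trace M (psi1 M e) x) = (incl1 M *v B) $ e"
  proof (cases "e \<in> range (bedge M)")
    case True
    then obtain b where b: "e = bedge M b"
      by blast
    let ?\<sigma> = "incl1 M $ bedge M b $ b"
    have nt: "bd_normal_trace M (psi1 M e) x = ?\<sigma> * bd_psi1 M b x" for x
      using incl1_square[of b] by (simp add: bd_psi1_eq b mult.assoc[symmetric])
    have "bd_integral M (\<lambda>x. h x * bd_normal_trace M (psi1 M e) x) =
        bd_integral M (\<lambda>x. ?\<sigma> * (?H x * bd_psi1 M b x))"
    proof (rule bd_integral_cong)
      show "boundary_continuous (\<lambda>x. ?\<sigma> * (?H x * bd_psi1 M b x))"
        by (intro boundary_continuous_cmult boundary_continuous_mult H bd_psi1_boundary_continuous)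
      show "finite {x \<in> edge M (bedge M b'). h x * bd_normal_trace M (psi1 M e) x \<noteq>
          ?\<sigma> * (?H x * bd_psi1 M b x)}" for b'
        by (rule finite_subset[OF _ fin[of b']]) (auto simp: nt)
    qed
    also have "\<dots> = ?\<sigma> * (bd_mass1 M *v \<beta>) $ b"
      unfolding bd_integral_cmult
      by (subst bd_integral_gram[OF bd_psi1_boundary_continuous bd_mass1_eq]) simp
    also have "\<dots> = ?\<sigma> * B $ b"
      unfolding \<beta>_def by (subst matrix_inv_mult_vector[OF bd_mass1_kernel]) simp_all
    also have "\<dots> = (\<Sum>b'\<in>UNIV. if b' = b then ?\<sigma> * B $ b else 0)"
      by simp
    also have "\<dots> = (\<Sum>b'\<in>UNIV. incl1 M $ e $ b' * B $ b')"
      by (intro sum.cong refl) (auto simp: incl1_def b bedge_inj)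
    finally show ?thesis
      by (simp add: matrix_vector_mult_def)
  next
    case False
    then have "incl1 M $ e $ b = 0" for b
      by (auto simp: incl1_def)
    then have "(incl1 M *v B) $ e = 0"
      by (simp add: matrix_vector_mult_def)
    moreover have "bd_integral M (\<lambda>x. h x * bd_normal_trace M (psi1 M e) x) = bd_integral M (\<lambda>x. 0 * ?H x)"
      using boundary_continuous_cmult[OF H]
      by (rule bd_integral_cong)
        (auto intro!: finite_subset[OF _ bd_normal_trace_psi1_zero[OF False]])
    ultimately show ?thesis
      unfolding bd_integral_cmult by simp
  qed
qed

text \<open>The same cancellation with \<open>bd_mass0\<close>, now without a sign. For a node off
  the boundary, \<open>psi0\<close> vanishes at all boundary nodes and hence on all boundary
  edges.\<close>

lemma bd_integral_psi0:
  assumes h: "\<And>x. x \<in> frontier (dmn M) \<Longrightarrow> h x = (\<Sum>b\<in>UNIV. dual_bd_psi1 M b x * B $ b)"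
  shows "boundary_continuous h"
    and "bd_integral M (\<lambda>x. h x * psi0 M v x) = (incl0 M *v B) $ v"
proof -
  define \<beta> where "\<beta> = matrix_inv (bd_mass0 M) *v B"
  let ?H = "\<lambda>x. \<Sum>a\<in>UNIV. bd_psi0 M a x * \<beta> $ a"
  have hH: "h x = ?H x" if "x \<in> edge M (bedge M b)" for x b
    using h bedge_subset_frontier[of b] that by (auto simp: dual_bd_psi1_combination \<beta>_def)
  then have empty: "{x \<in> edge M (bedge M b). h x \<noteq> ?H x} = {}" for b
    by blast
  have fin: "finite {x \<in> edge M (bedge M b). h x \<noteq> ?H x}" for b
    unfolding empty by simp
  have H: "boundary_continuous ?H"
    using boundary_continuous_sum[of UNIV "\<lambda>a x. \<beta> $ a * bd_psi0 M a x"] bd_psi0_boundary_continuous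
    by (simp add: boundary_continuous_cmult mult.commute)
  then show "boundary_continuous h"
    using fin unfolding boundary_continuous_def by (blast intro: almost_continuous_on_cong)
  show "bd_integral M (\<lambda>x. h x * psi0 M v x) = (incl0 M *v B) $ v"
  proof (cases "v \<in> range (bnode M)")
    case True
    then obtain b where b: "v = bnode M b"
      by blast
    have "bd_integral M (\<lambda>x. h x * psi0 M v x) = bd_integral M (\<lambda>x. ?H x * bd_psi0 M b x)"
    proof (rule bd_integral_cong)
      show "boundary_continuous (\<lambda>x. ?H x * bd_psi0 M b x)"
        by (intro boundary_continuous_mult H bd_psi0_boundary_continuous)
      show "finite {x \<in> edge M (bedge M b'). h x * psi0 M v x \<noteq> ?H x * bd_psi0 M b x}" for b'
        by (rule finite_subset[OF _ fin[of b']]) (auto simp: bd_psi0_eq b)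
    qed
    also have "\<dots> = (bd_mass0 M *v \<beta>) $ b"
      by (rule bd_integral_gram[OF bd_psi0_boundary_continuous bd_mass0_eq])
    also have "\<dots> = B $ b"
      unfolding \<beta>_def by (subst matrix_inv_mult_vector[OF bd_mass0_kernel]) simp_all
    also have "\<dots> = (\<Sum>b'\<in>UNIV. if b' = b then B $ b else 0)"
      by simp
    also have "\<dots> = (\<Sum>b'\<in>UNIV. incl0 M $ v $ b' * B $ b')"
      by (intro sum.cong refl) (auto simp: incl0_def b bnode_inj)
    finally show ?thesis
      by (simp add: matrix_vector_mult_def)
  next
    case False
    then have "incl0 M $ v $ b = 0" for b
      by (auto simp: incl0_def)
    then have "(incl0 M *v B) $ v = 0"
      by (simp add: matrix_vector_mult_def)
    have "psi0 M v (node M (bnode M b)) = 0" for b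
      using dof0_psi0[of v] False by (auto simp: dof0_def vec_eq_iff axis_def)
    then have z: "psi0 M v x = 0" if "x \<in> edge M (bedge M b)" for b x
      using boundary_value_zero[OF psi0_C_space] that by blast
    have "{x \<in> edge M (bedge M b). h x * psi0 M v x \<noteq> 0 * ?H x} = {}" for b
      using z by auto
    then have "finite {x \<in> edge M (bedge M b). h x * psi0 M v x \<noteq> 0 * ?H x}" for b
      by (simp only: finite.emptyI)
    with boundary_continuous_cmult[OF H]
    have "bd_integral M (\<lambda>x. h x * psi0 M v x) = bd_integral M (\<lambda>x. 0 * ?H x)"
      by (rule bd_integral_cong)
    then show ?thesis
      unfolding bd_integral_cmult using \<open>(incl0 M *v B) $ v = 0\<close> by simp
  qed
qed

text \<open>Uniqueness behind \<open>THE\<close>: two coefficient vectors of the same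
  \<open>h\<close> give the same boundary integrals, hence the same product with
  \<open>incl1\<close>, whose row at a boundary edge has a single nonzero entry.\<close>

lemma bd_coeff0_eq:
  assumes h: "\<And>x. x \<in> frontier (dmn M) - elem_verts M \<Longrightarrow> h x = (\<Sum>b\<in>UNIV. dual_bd_psi0 M b x * B $ b)"
  shows "bd_coeff0 M h = B"
  unfolding bd_coeff0_def
proof (rule the_equality)
  fix B' assume "\<forall>x\<in>frontier (dmn M) - elem_verts M. h x = (\<Sum>b\<in>UNIV. dual_bd_psi0 M b x * B' $ b)"
  then have "incl1 M *v B' = incl1 M *v B"
    using bd_integral_normal_trace_psi1(2)[of h B'] bd_integral_normal_trace_psi1(2)[OF h]
    by (simp add: vec_eq_iff)
  moreover have "(incl1 M *v C) $ bedge M b = incl1 M $ bedge M b $ b * C $ b" for C b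
  proof -
    have "(incl1 M *v C) $ bedge M b = (\<Sum>b'\<in>UNIV. if b' = b then incl1 M $ bedge M b $ b * C $ b else 0)"
      unfolding matrix_vector_mult_def vec_lambda_beta
      by (intro sum.cong refl) (auto simp: incl1_def bedge_inj)
    then show ?thesis
      by simp
  qed
  ultimately have "incl1 M $ bedge M b $ b * B' $ b = incl1 M $ bedge M b $ b * B $ b" for b
    by metis
  then show "B' = B"
    using incl1_square by (auto simp: vec_eq_iff) (metis mult_cancel_left mult_zero_left zero_neq_one)
qed (use h in blast)

text \<open>As for \<open>bd_coeff0_eq\<close>; the rows of \<open>incl0\<close> at boundary nodes
  are unit vectors.\<close>

lemma bd_coeff1_eq:
  assumes h: "\<And>x. x \<in> frontier (dmn M) \<Longrightarrow> h x = (\<Sum>b\<in>UNIV. dual_bd_psi1 M b x * B $ b)"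
  shows "bd_coeff1 M h = B"
  unfolding bd_coeff1_def
proof (rule the_equality)
  fix B' assume "\<forall>x\<in>frontier (dmn M). h x = (\<Sum>b\<in>UNIV. dual_bd_psi1 M b x * B' $ b)"
  then have eq: "incl0 M *v B' = incl0 M *v B"
    using bd_integral_psi0(2)[of h B'] bd_integral_psi0(2)[OF h]
    by (simp add: vec_eq_iff)
  have "(incl0 M *v C) $ bnode M b = C $ b" for C b
  proof -
    have "(incl0 M *v C) $ bnode M b = (\<Sum>b'\<in>UNIV. if b' = b then C $ b else 0)"
      unfolding matrix_vector_mult_def vec_lambda_beta
      by (intro sum.cong refl) (auto simp: incl0_def bnode_inj)
    then show ?thesis
      by simp
  qed
  then show "B' = B"
    using eq by (metis vec_eq_iff)
qed (use h in blast)

section \<open>The dual gradient and the dual rotation\<close>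

text \<open>The element is chosen from the point \<open>x\<close> alone, so the traces of
  \<open>q\<close> and of all basis fields are taken in the same element and the expansion has no
  exceptional points.\<close>

lemma bd_normal_trace_expand:
  assumes "q \<in> D_space M" "x \<in> closure (dmn M)"
  shows "bd_normal_trace M q x = (\<Sum>e\<in>UNIV. dof1 M q $ e * bd_normal_trace M (psi1 M e) x)"
proof -
  have "\<exists>m. {x} \<subseteq> elem M m"
    using assms(2) closure_dmn by auto
  then have "{x} \<subseteq> elem M (elem_of M {x})"
    unfolding elem_of_def by (rule someI_ex)
  then have "elem_trace M (elem_of M {x}) q x =
      (\<Sum>e\<in>UNIV. (dof1 M q $ e) *\<^sub>R elem_trace M (elem_of M {x}) (psi1 M e) x)"
    by (intro elem_trace_sum psi1_D_space D_space_expand assms(1)) auto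
  then show ?thesis
    by (simp add: bd_normal_trace_def inner_sum_left)
qed

lemma bd_integral_normal_trace:
  assumes h: "\<And>x. x \<in> frontier (dmn M) - elem_verts M \<Longrightarrow> h x = (\<Sum>b\<in>UNIV. dual_bd_psi0 M b x * B $ b)"
    and q: "q \<in> D_space M"
  shows "bd_integral M (\<lambda>x. h x * bd_normal_trace M q x) = (incl1 M *v B) \<bullet> dof1 M q"
proof -
  let ?S = "\<lambda>x. \<Sum>e\<in>UNIV. dof1 M q $ e * (h x * bd_normal_trace M (psi1 M e) x)"
  have bc: "boundary_continuous (\<lambda>x. h x * bd_normal_trace M (psi1 M e) x)" for e
    by (intro boundary_continuous_mult boundary_continuous_normal_trace psi1_D_space
        bd_integral_normal_trace_psi1(1)[OF h])
  have "h x * bd_normal_trace M q x = ?S x" if "x \<in> edge M (bedge M b)" for x b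
  proof -
    have "x \<in> closure (dmn M)"
      using that bedge_subset_frontier[of b] by (auto simp: frontier_def)
    then show ?thesis
      by (simp add: bd_normal_trace_expand[OF q] sum_distrib_left ac_simps)
  qed
  then have "{x \<in> edge M (bedge M b). h x * bd_normal_trace M q x \<noteq> ?S x} = {}" for b
    by blast
  then have "finite {x \<in> edge M (bedge M b). h x * bd_normal_trace M q x \<noteq> ?S x}" for b
    by (simp only: finite.emptyI)
  then have "bd_integral M (\<lambda>x. h x * bd_normal_trace M q x) = bd_integral M ?S"
    by (intro bd_integral_cong boundary_continuous_sum boundary_continuous_cmult bc)
  also have "\<dots> = (\<Sum>e\<in>UNIV. bd_integral M (\<lambda>x. dof1 M q $ e * (h x * bd_normal_trace M (psi1 M e) x)))"
    by (intro bd_integral_sum boundary_continuous_cmult bc) simp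
  also have "\<dots> = (\<Sum>e\<in>UNIV. dof1 M q $ e * (incl1 M *v B) $ e)"
    unfolding bd_integral_cmult by (subst bd_integral_normal_trace_psi1(2)[OF h]) simp_all
  finally show ?thesis
    by (simp add: inner_vec_def mult.commute)
qed

lemma bd_integral_C_space:
  assumes h: "\<And>x. x \<in> frontier (dmn M) \<Longrightarrow> h x = (\<Sum>b\<in>UNIV. dual_bd_psi1 M b x * B $ b)"
    and c: "c \<in> C_space M"
  shows "bd_integral M (\<lambda>x. h x * c x) = (incl0 M *v B) \<bullet> dof0 M c"
proof -
  let ?S = "\<lambda>x. \<Sum>v\<in>UNIV. dof0 M c $ v * (h x * psi0 M v x)"
  have bc: "boundary_continuous (\<lambda>x. h x * psi0 M v x)" for v
    by (intro boundary_continuous_mult boundary_continuous_C_space psi0_C_space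
        bd_integral_psi0(1)[OF h])
  have "h x * c x = ?S x" if "x \<in> edge M (bedge M b)" for x b
  proof -
    have "x \<in> closure (dmn M)"
      using that bedge_subset_frontier[of b] by (auto simp: frontier_def)
    then show ?thesis
      by (subst C_space_expand[OF c]) (simp_all add: sum_distrib_left ac_simps)
  qed
  then have "{x \<in> edge M (bedge M b). h x * c x \<noteq> ?S x} = {}" for b
    by blast
  then have "finite {x \<in> edge M (bedge M b). h x * c x \<noteq> ?S x}" for b
    by (simp only: finite.emptyI)
  then have "bd_integral M (\<lambda>x. h x * c x) = bd_integral M ?S"
    by (intro bd_integral_cong boundary_continuous_sum boundary_continuous_cmult bc)
  also have "\<dots> = (\<Sum>v\<in>UNIV. bd_integral M (\<lambda>x. dof0 M c $ v * (h x * psi0 M v x)))"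
    by (intro bd_integral_sum boundary_continuous_cmult bc) simp
  also have "\<dots> = (\<Sum>v\<in>UNIV. dof0 M c $ v * (incl0 M *v B) $ v)"
    by (simp add: bd_integral_cmult bd_integral_psi0(2)[OF h])
  finally show ?thesis
    by (simp add: inner_vec_def mult.commute)
qed

lemma inner_transpose: "y \<bullet> (E *v x) = (transpose E *v y) \<bullet> x" for E :: "real^'i::finite^'j::finite"
  by (simp add: dot_lmul_matrix transpose_matrix_vector)

lemma dmn_integral_div:
  assumes E: "incidence21 M E" and s: "s \<in> S_space M" and q: "q \<in> D_space M"
  shows "dmn_integral M (\<lambda>x. s x * (- div2 q x)) = - (transpose E *v dual_dof0 M s) \<bullet> dof1 M q"
proof -
  have "- div2 q x = (\<Sum>c\<in>UNIV. ((- (E *v dof1 M q)) $ c) *\<^sub>R psi2 M c x)" if "x \<in> elem_int M m" for m x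
    using E q that unfolding incidence21_def by (simp add: sum_negf mult.commute)
  then have "dmn_integral M (\<lambda>x. s x * (- div2 q x)) = dual_dof0 M s \<bullet> (- (E *v dof1 M q))"
    by (rule dmn_integral_S_space[OF s])
  then show ?thesis
    by (simp add: inner_transpose)
qed

lemma dmn_integral_curl:
  assumes E: "incidence10 M E" and d: "d \<in> D_space M" and c: "c \<in> C_space M"
  shows "dmn_integral M (\<lambda>x. d x \<bullet> curl2 c x) = (transpose E *v dual_dof1 M d) \<bullet> dof0 M c"
proof -
  have "curl2 c x = (\<Sum>e\<in>UNIV. ((E *v dof0 M c) $ e) *\<^sub>R psi1 M e x)" if "x \<in> elem_int M m" for m x
    using E c that unfolding incidence10_def by blast
  then have "dmn_integral M (\<lambda>x. d x \<bullet> curl2 c x) = dual_dof1 M d \<bullet> (E *v dof0 M c)"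
    by (rule dmn_integral_D_space[OF d])
  then show ?thesis
    by (simp add: inner_transpose)
qed

section \<open>Realising prescribed dual degrees of freedom\<close>

lemma dual_psi1_combination:
  "(\<Sum>e\<in>UNIV. (y $ e) *\<^sub>R dual_psi1 M e x) =
    (\<Sum>f\<in>UNIV. ((matrix_inv (mass1 M) *v y) $ f) *\<^sub>R psi1 M f x)"
  unfolding dual_psi1_def matrix_vector_mult_def
  by (simp add: scaleR_sum_right scaleR_sum_left mult.commute) (rule sum.swap)

lemma dual_psi2_combination:
  "(\<Sum>v\<in>UNIV. dual_psi2 M v x * y $ v) =
    (\<Sum>w\<in>UNIV. ((matrix_inv (mass0 M) *v y) $ w) *\<^sub>R psi0 M w x)"
  unfolding dual_psi2_def matrix_vector_mult_def
  by (simp add: sum_distrib_left sum_distrib_right ac_simps) (rule sum.swap)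

text \<open>Existence behind the \<open>SOME\<close> in \<open>dual_grad\<close>: the mass matrix
  cancels its inverse in the dual basis, so \<open>y\<close> itself serves as the coefficient vector
  there.\<close>

lemma dual_D_space_obtain:
  obtains g where "g \<in> dual_D_space M" "dual_dof1 M g = y"
proof
  let ?g = "\<lambda>x. \<Sum>e\<in>UNIV. (y $ e) *\<^sub>R dual_psi1 M e x"
  let ?a = "matrix_inv (mass1 M) *v y"
  have g: "?g = (\<lambda>x. \<Sum>f\<in>UNIV. (?a $ f) *\<^sub>R psi1 M f x)"
    by (simp only: dual_psi1_combination)
  have "?g \<in> D_space M"
    unfolding g by (intro D_space_sum psi1_D_space)
  then show "?g \<in> dual_D_space M"
    unfolding dual_D_space_def by blast
  show "dual_dof1 M ?g = y"
    unfolding dual_dof1_def g dof1_combination by (rule matrix_inv_mult_vector[OF mass1_kernel])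
qed

lemma dual_C_space_obtain:
  obtains r where "r \<in> dual_C_space M" "dual_dof2 M r = y"
proof
  let ?r = "\<lambda>x. \<Sum>v\<in>UNIV. dual_psi2 M v x * y $ v"
  let ?a = "matrix_inv (mass0 M) *v y"
  have r: "?r = (\<lambda>x. \<Sum>w\<in>UNIV. (?a $ w) *\<^sub>R psi0 M w x)"
    by (simp only: dual_psi2_combination)
  have "?r \<in> C_space M"
    unfolding r using C_space_sum[of UNIV "psi0 M" "\<lambda>w. ?a $ w"] psi0_C_space by simp
  then show "?r \<in> dual_C_space M"
    unfolding dual_C_space_def by blast
  show "dual_dof2 M ?r = y"
    unfolding dual_dof2_def r dof0_combination by (rule matrix_inv_mult_vector[OF mass0_kernel])
qed

text \<open>Both sides of the defining relation are linear in \<open>dof1 M q\<close>, represented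
  by \<open>dual_dof1 M g\<close> and by the claimed vector. Hence fields with that vector satisfy
  the relation, and fields satisfying it have that vector.\<close>

lemma dual_dof1_dual_grad:
  assumes E: "incidence21 M E" and s: "s \<in> dual_S_space M" and h: "h \<in> dual_bd_D_space M"
  shows "dual_dof1 M (dual_grad M s h) = - (transpose E *v dual_dof0 M s) + incl1 M *v bd_coeff0 M h"
    (is "_ = ?y")
proof -
  have s': "s \<in> S_space M"
    using s by (simp add: dual_S_space_def)
  obtain B where B: "\<And>x. x \<in> frontier (dmn M) - elem_verts M \<Longrightarrow> h x = (\<Sum>b\<in>UNIV. dual_bd_psi0 M b x * B $ b)"
    using h unfolding dual_bd_D_space_def by blast
  have rhs: "dmn_integral M (\<lambda>x. s x * (- div2 q x)) + bd_integral M (\<lambda>x. h x * bd_normal_trace M q x) =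
      ?y \<bullet> dof1 M q" if "q \<in> D_space M" for q
    using dmn_integral_div[OF E s' that] bd_integral_normal_trace[OF B that] bd_coeff0_eq[OF B]
    by (simp add: inner_add_left inner_diff_left)
  have lhs: "dmn_integral M (\<lambda>x. g x \<bullet> q x) = dual_dof1 M g \<bullet> dof1 M q"
    if "g \<in> dual_D_space M" "q \<in> D_space M" for g q
    using that D_space_expand by (intro dmn_integral_D_space) (auto simp: dual_D_space_def)
  let ?P = "\<lambda>g. g \<in> dual_D_space M \<and> (\<forall>q\<in>D_space M. dmn_integral M (\<lambda>x. g x \<bullet> q x) =
      dmn_integral M (\<lambda>x. s x * (- div2 q x)) + bd_integral M (\<lambda>x. h x * bd_normal_trace M q x))"
  obtain g0 where "g0 \<in> dual_D_space M" "dual_dof1 M g0 = ?y"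
    by (rule dual_D_space_obtain)
  \<comment> \<open>This makes the predicate satisfiable, so that \<open>SOME\<close> does pick a
    solution.\<close>
  then have "?P g0"
    using lhs rhs by simp
  then have grad: "?P (dual_grad M s h)"
    unfolding dual_grad_def by (rule someI[where P = ?P])
  \<comment> \<open>Testing with \<open>psi1 M e\<close>, whose degrees of freedom are
    \<open>axis e 1\<close>, extracts the entry \<open>e\<close>.\<close>
  then have "dual_dof1 M (dual_grad M s h) \<bullet> axis e 1 = ?y \<bullet> axis e 1" for e
    using lhs[of "dual_grad M s h" "psi1 M e"] rhs[OF psi1_D_space[of e]] psi1_D_space[of e]
    by (simp add: dof1_psi1)
  then show ?thesis
    by (simp add: vec_eq_iff inner_axis)
qed

text \<open>The argument for the gradient with nodal test functions; the curl enters the defining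
  relation with a plus sign, and so does the transposed incidence matrix.\<close>

lemma dual_dof2_dual_rot:
  assumes E: "incidence10 M E" and d: "d \<in> dual_D_space M" and h: "h \<in> dual_bd_C_space M"
  shows "dual_dof2 M (dual_rot M d h) = transpose E *v dual_dof1 M d + incl0 M *v bd_coeff1 M h"
    (is "_ = ?y")
proof -
  have d': "d \<in> D_space M"
    using d by (simp add: dual_D_space_def)
  obtain B where B: "\<And>x. x \<in> frontier (dmn M) \<Longrightarrow> h x = (\<Sum>b\<in>UNIV. dual_bd_psi1 M b x * B $ b)"
    using h unfolding dual_bd_C_space_def by blast
  have rhs: "dmn_integral M (\<lambda>x. d x \<bullet> curl2 c x) + bd_integral M (\<lambda>x. h x * c x) =
      ?y \<bullet> dof0 M c" if "c \<in> C_space M" for c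
    using dmn_integral_curl[OF E d' that] bd_integral_C_space[OF B that] bd_coeff1_eq[OF B]
    by (simp add: inner_add_left)
  have lhs: "dmn_integral M (\<lambda>x. r x * c x) = dual_dof2 M r \<bullet> dof0 M c"
    if "r \<in> dual_C_space M" "c \<in> C_space M" for r c
    using that by (intro dmn_integral_C_space) (auto simp: dual_C_space_def)
  let ?P = "\<lambda>r. r \<in> dual_C_space M \<and> (\<forall>c\<in>C_space M. dmn_integral M (\<lambda>x. r x * c x) =
      dmn_integral M (\<lambda>x. d x \<bullet> curl2 c x) + bd_integral M (\<lambda>x. h x * c x))"
  obtain r0 where "r0 \<in> dual_C_space M" "dual_dof2 M r0 = ?y"
    by (rule dual_C_space_obtain)
  then have "?P r0"
    using lhs rhs by simp
  then have rot: "?P (dual_rot M d h)"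
    unfolding dual_rot_def by (rule someI[where P = ?P])
  then have "dual_dof2 M (dual_rot M d h) \<bullet> axis v 1 = ?y \<bullet> axis v 1" for v
    using lhs[of "dual_rot M d h" "psi0 M v"] rhs[OF psi0_C_space[of v]] psi0_C_space[of v]
    by (simp add: dof0_psi0)
  then show ?thesis
    by (simp add: vec_eq_iff inner_axis)
qed

end

theorem mainTheorem6:
  fixes M :: "('m::finite, 'v::finite, 'e::finite, 'c::finite, 'bv::finite, 'be::finite) gll_mesh"
    and E10 :: "real^'v^'e" and E21 :: "real^'e^'c"
  assumes "meshed_domain M"
    and "basis_functions M"
    and "incidence10 M E10" and "incidence21 M E21"
  shows "(\<forall>s\<in>dual_S_space M. \<forall>s'\<in>dual_bd_D_space M.
            dual_dof1 M (dual_grad M s s') =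
              - (transpose E21 *v dual_dof0 M s) + incl1 M *v bd_coeff0 M s') \<and>
         (\<forall>d\<in>dual_D_space M. \<forall>d'\<in>dual_bd_C_space M.
            dual_dof2 M (dual_rot M d d') =
              transpose E10 *v dual_dof1 M d + incl0 M *v bd_coeff1 M d')"
proof -
  interpret gll_basis M
    using assms(1,2) by unfold_locales
  show ?thesis
    using dual_dof1_dual_grad[OF assms(4)] dual_dof2_dual_rot[OF assms(3)] by blast
qed

end
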